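(* Let $X$ be a connected simplicial complex with fundamental group $\pi=\pi_1(X)$, and let $u_X:X\to B\pi$ be a classifying map for the universal covering of $X$. Then $$\mathrm{cat}_{\mathrm{LS}}(X)\le\frac{\mathrm{cat}_{\mathrm{LS}}(u_X)+\dim X}{2}.$$
   Context: The (reduced) Lusternik-Schnirelmann category $\mathrm{cat}_{\mathrm{LS}}(X)$ of a space $X$ is the minimal $n$ such that $X$ has an open cover $\{U_0,\dots,U_n\}$ by $n+1$ sets each contractible in $X$ (i.e. each inclusion $U_i\hookrightarrow X$ is null-homotopic). The LS-category $\mathrm{cat}_{\mathrm{LS}}(f)$ of a continuous map $f:X\to Y$ is the smallest $k$ such that $X$ can be covered by $k+1$ open sets $U_0,\dots,U_k$ with each restriction $f|_{U_i}:U_i\to Y$ null-homotopic. $B\pi$ denotes any aspherical CW complex with fundamental group $\pi$. A map $u_X:X\to B\pi$ is a classifying map for the universal covering of $X$ if the universal covering of $X$ is the pull-back under $u_X$ of the universal covering $E\pi\to B\pi$; equivalently, $u_X$ induces an isomorphism of fundamental groups. If $\dim X=\infty$, the right-hand side is $\infty$ and the inequality holds trivially. *)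

theory Defs
  imports "HOL-Analysis.Analysis" "HOL-Algebra.Group"
begin

section \<open>Lusternik--Schnirelmann category\<close>

definition null_homotopic :: "'a topology \<Rightarrow> 'b topology \<Rightarrow> ('a \<Rightarrow> 'b) \<Rightarrow> bool" where
  "null_homotopic X Y f \<longleftrightarrow> (\<exists>c. homotopic_with (\<lambda>h. True) X Y f (\<lambda>x. c))"

text \<open>Both categories are reduced, with value \<open>\<infinity>\<close> (the infimum of the empty set) if there is no
  finite cover of the required kind.\<close>

definition LS_cat :: "'a topology \<Rightarrow> enat" where
  "LS_cat X = Inf {enat n | n. \<exists>U :: nat \<Rightarrow> 'a set.
      (\<forall>i\<le>n. openin X (U i) \<and> null_homotopic (subtopology X (U i)) X id) \<and>
      (\<Union>i\<le>n. U i) = topspace X}"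

definition LS_cat_map :: "'a topology \<Rightarrow> 'b topology \<Rightarrow> ('a \<Rightarrow> 'b) \<Rightarrow> enat" where
  "LS_cat_map X Y f = Inf {enat k | k. \<exists>U :: nat \<Rightarrow> 'a set.
      (\<forall>i\<le>k. openin X (U i) \<and> null_homotopic (subtopology X (U i)) Y f) \<and>
      (\<Union>i\<le>k. U i) = topspace X}"


section \<open>Simplicial complexes\<close>

definition abstract_simplicial_complex :: "'v set set \<Rightarrow> bool" where
  "abstract_simplicial_complex K \<longleftrightarrow>
     (\<forall>s\<in>K. finite s \<and> s \<noteq> {}) \<and> (\<forall>s\<in>K. \<forall>t. t \<subseteq> s \<and> t \<noteq> {} \<longrightarrow> t \<in> K)"

text \<open>Complexes may be infinite and infinite-dimensional; the dimension is \<open>\<infinity>\<close> if the dimensions of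
  the simplices are unbounded.\<close>

definition complex_dim :: "'v set set \<Rightarrow> enat" where
  "complex_dim K = (SUP s\<in>K. enat (card s - 1))"

text \<open>Points are given by their barycentric coordinates.\<close>

definition closed_simplex :: "'v set \<Rightarrow> ('v \<Rightarrow> real) set" where
  "closed_simplex s = {f. (\<forall>v. 0 \<le> f v) \<and> (\<forall>v. v \<notin> s \<longrightarrow> f v = 0) \<and> sum f s = 1}"

text \<open>The geometric realization carries the weak topology: a set is open iff its intersection with
  each closed simplex is open in that simplex, a simplex having its usual topology as a subset
  of a finite-dimensional coordinate space.\<close>

definition realization :: "'v set set \<Rightarrow> ('v \<Rightarrow> real) topology" where
  "realization K = topology (\<lambda>U. U \<subseteq> (\<Union>s\<in>K. closed_simplex s) \<and>
     (\<forall>s\<in>K. openin (subtopology (powertop_real UNIV) (closed_simplex s)) (U \<inter> closed_simplex s)))"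

lemma openin_realization:
  "openin (realization K) U \<longleftrightarrow> U \<subseteq> (\<Union>s\<in>K. closed_simplex s) \<and>
     (\<forall>s\<in>K. openin (subtopology (powertop_real UNIV) (closed_simplex s)) (U \<inter> closed_simplex s))"
proof -
  let ?T = "\<lambda>s. subtopology (powertop_real UNIV) (closed_simplex s)"
  have "istopology (\<lambda>U. U \<subseteq> (\<Union>s\<in>K. closed_simplex s) \<and>
          (\<forall>s\<in>K. openin (?T s) (U \<inter> closed_simplex s)))"
    unfolding istopology_def
  proof (intro conjI allI impI ballI)
    fix S T s
    assume S: "S \<subseteq> (\<Union>s\<in>K. closed_simplex s) \<and> (\<forall>s\<in>K. openin (?T s) (S \<inter> closed_simplex s))"
      and T: "T \<subseteq> (\<Union>s\<in>K. closed_simplex s) \<and> (\<forall>s\<in>K. openin (?T s) (T \<inter> closed_simplex s))"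
    show "S \<inter> T \<subseteq> (\<Union>s\<in>K. closed_simplex s)"
      using S by blast
    assume s: "s \<in> K"
    have "S \<inter> T \<inter> closed_simplex s = (S \<inter> closed_simplex s) \<inter> (T \<inter> closed_simplex s)"
      by blast
    then show "openin (?T s) (S \<inter> T \<inter> closed_simplex s)"
      using S T s by (metis openin_Int)
  next
    fix \<K> s
    assume A: "\<forall>U\<in>\<K>. U \<subseteq> (\<Union>s\<in>K. closed_simplex s) \<and>
                  (\<forall>s\<in>K. openin (?T s) (U \<inter> closed_simplex s))"
    show "\<Union>\<K> \<subseteq> (\<Union>s\<in>K. closed_simplex s)"
      using A by blast
    assume s: "s \<in> K"
    have "\<Union>\<K> \<inter> closed_simplex s = (\<Union>U\<in>\<K>. U \<inter> closed_simplex s)"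
      by blast
    moreover have "openin (?T s) (\<Union>U\<in>\<K>. U \<inter> closed_simplex s)"
      using A s by (intro openin_Union) auto
    ultimately show "openin (?T s) (\<Union>\<K> \<inter> closed_simplex s)"
      by simp
  qed
  then show ?thesis
    by (simp add: realization_def topology_inverse')
qed

lemma topspace_realization: "topspace (realization K) = (\<Union>s\<in>K. closed_simplex s)"
proof
  show "topspace (realization K) \<subseteq> (\<Union>s\<in>K. closed_simplex s)"
    using openin_realization openin_topspace by blast
  have "openin (subtopology (powertop_real UNIV) (closed_simplex s))
          ((\<Union>s\<in>K. closed_simplex s) \<inter> closed_simplex s)" if "s \<in> K" for s
  proof -
    have "(\<Union>s\<in>K. closed_simplex s) \<inter> closed_simplex s
            = topspace (subtopology (powertop_real UNIV) (closed_simplex s))"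
      using that by auto
    then show ?thesis
      by (metis openin_topspace)
  qed
  then have "openin (realization K) (\<Union>s\<in>K. closed_simplex s)"
    unfolding openin_realization by blast
  then show "(\<Union>s\<in>K. closed_simplex s) \<subseteq> topspace (realization K)"
    by (rule openin_subset)
qed


section \<open>The fundamental group\<close>

definition loop_in :: "'a topology \<Rightarrow> 'a \<Rightarrow> (real \<Rightarrow> 'a) \<Rightarrow> bool" where
  "loop_in X x g \<longleftrightarrow> pathin X g \<and> g 0 = x \<and> g 1 = x"

text \<open>Homotopy relative to the endpoints; the values outside the unit interval are irrelevant.\<close>

definition homotopic_loops_at :: "'a topology \<Rightarrow> 'a \<Rightarrow> (real \<Rightarrow> 'a) \<Rightarrow> (real \<Rightarrow> 'a) \<Rightarrow> bool" where
  "homotopic_loops_at X x g h \<longleftrightarrow>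
     homotopic_with (\<lambda>k. k 0 = x \<and> k 1 = x) (top_of_set {0..1}) X g h"

definition concat_loops :: "(real \<Rightarrow> 'a) \<Rightarrow> (real \<Rightarrow> 'a) \<Rightarrow> real \<Rightarrow> 'a" where
  "concat_loops g h = (\<lambda>t. if t \<le> 1/2 then g (2 * t) else h (2 * t - 1))"

definition loop_class :: "'a topology \<Rightarrow> 'a \<Rightarrow> (real \<Rightarrow> 'a) \<Rightarrow> (real \<Rightarrow> 'a) set" where
  "loop_class X x g = {h. loop_in X x h \<and> homotopic_loops_at X x g h}"

definition fundamental_group :: "'a topology \<Rightarrow> 'a \<Rightarrow> (real \<Rightarrow> 'a) set monoid" where
  "fundamental_group X x =
     \<lparr>carrier = loop_class X x ` {g. loop_in X x g},
      mult = (\<lambda>P Q. \<Union>g\<in>P. \<Union>h\<in>Q. loop_class X x (concat_loops g h)),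
      one = loop_class X x (\<lambda>t. x)\<rparr>"


section \<open>Covering spaces\<close>

definition covering_map :: "'e topology \<Rightarrow> ('e \<Rightarrow> 'b) \<Rightarrow> 'b topology \<Rightarrow> bool" where
  "covering_map E p B \<longleftrightarrow> continuous_map E B p \<and> p ` topspace E = topspace B \<and>
     (\<forall>b\<in>topspace B. \<exists>V. openin B V \<and> b \<in> V \<and>
        (\<exists>\<U>. \<Union>\<U> = {e \<in> topspace E. p e \<in> V} \<and> disjoint \<U> \<and>
             (\<forall>U\<in>\<U>. openin E U \<and> homeomorphic_map (subtopology E U) (subtopology B V) p)))"

definition simply_connected_topology :: "'a topology \<Rightarrow> bool" where
  "simply_connected_topology X \<longleftrightarrow> path_connected_space X \<and>
     (\<forall>x\<in>topspace X. \<forall>g. loop_in X x g \<longrightarrow> homotopic_loops_at X x g (\<lambda>t. x))"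

definition universal_covering :: "'e topology \<Rightarrow> ('e \<Rightarrow> 'b) \<Rightarrow> 'b topology \<Rightarrow> bool" where
  "universal_covering E p B \<longleftrightarrow> covering_map E p B \<and> simply_connected_topology E"

definition pullback :: "'a topology \<Rightarrow> ('a \<Rightarrow> 'b) \<Rightarrow> 'e topology \<Rightarrow> ('e \<Rightarrow> 'b) \<Rightarrow> ('a \<times> 'e) topology" where
  "pullback X u E p = subtopology (prod_topology X E) {(x, e). u x = p e}"

text \<open>The map \<open>u\<close> classifies the universal covering of \<open>X\<close>: the pull-back along \<open>u\<close> of the universal
  covering \<open>p\<close> of \<open>B\<close>, with its projection to \<open>X\<close>, is the universal covering of \<open>X\<close>.\<close>

definition classifying_map ::
  "'a topology \<Rightarrow> ('a \<Rightarrow> 'b) \<Rightarrow> 'e topology \<Rightarrow> ('e \<Rightarrow> 'b) \<Rightarrow> 'b topology \<Rightarrow> bool" where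
  "classifying_map X u E p B \<longleftrightarrow> continuous_map X B u \<and> universal_covering E p B \<and>
     universal_covering (pullback X u E p) fst X"


section \<open>Aspherical CW complexes\<close>

text \<open>The disc is realised inside \<^term>\<open>Euclidean_space n\<close>, so its elements vanish at all indices
  \<open>\<ge> n\<close>; for \<open>n = 0\<close> it is a point with empty boundary. The library's \<^term>\<open>nsphere n\<close> is the
  \<open>n\<close>-dimensional sphere.\<close>

definition disc :: "nat \<Rightarrow> (nat \<Rightarrow> real) set" where
  "disc n = {x \<in> topspace (Euclidean_space n). (\<Sum>i<n. (x i)\<^sup>2) \<le> 1}"

definition open_disc :: "nat \<Rightarrow> (nat \<Rightarrow> real) set" where
  "open_disc n = {x \<in> topspace (Euclidean_space n). (\<Sum>i<n. (x i)\<^sup>2) < 1}"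

text \<open>\<open>\<Phi> n\<close> is the set of characteristic maps of the \<open>n\<close>-cells; the cells are the images of the open
  discs. The last two conditions are closure-finiteness and the weak topology.\<close>

definition cw_structure :: "'b topology \<Rightarrow> (nat \<Rightarrow> ((nat \<Rightarrow> real) \<Rightarrow> 'b) set) \<Rightarrow> bool" where
  "cw_structure Y \<Phi> \<longleftrightarrow>
     Hausdorff_space Y \<and>
     (\<forall>n. \<forall>\<phi>\<in>\<Phi> n. continuous_map (subtopology (Euclidean_space n) (disc n)) Y \<phi> \<and>
        embedding_map (subtopology (Euclidean_space n) (open_disc n)) Y \<phi>) \<and>
     disjoint_family_on (\<lambda>(n, \<phi>). \<phi> ` open_disc n) (SIGMA n:UNIV. \<Phi> n) \<and>
     (\<Union>n. \<Union>\<phi>\<in>\<Phi> n. \<phi> ` open_disc n) = topspace Y \<and>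
     (\<forall>n. \<forall>\<phi>\<in>\<Phi> n. \<exists>F. finite F \<and> F \<subseteq> (SIGMA m:{..<n}. \<Phi> m) \<and>
        \<phi> ` (disc n - open_disc n) \<subseteq> (\<Union>(m, \<psi>)\<in>F. \<psi> ` open_disc m)) \<and>
     (\<forall>A. A \<subseteq> topspace Y \<longrightarrow> (\<forall>n. \<forall>\<phi>\<in>\<Phi> n. closedin Y (A \<inter> \<phi> ` disc n)) \<longrightarrow> closedin Y A)"

definition cw_complex :: "'b topology \<Rightarrow> bool" where
  "cw_complex Y \<longleftrightarrow> (\<exists>\<Phi>. cw_structure Y \<Phi>)"

text \<open>Vanishing of the homotopy groups in degrees \<open>\<ge> 2\<close>, at every base point.\<close>

definition aspherical :: "'b topology \<Rightarrow> bool" where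
  "aspherical Y \<longleftrightarrow> path_connected_space Y \<and>
     (\<forall>n\<ge>2. \<forall>f. continuous_map (nsphere n) Y f \<longrightarrow> null_homotopic (nsphere n) Y f)"

definition classifying_space :: "'b topology \<Rightarrow> 'g monoid \<Rightarrow> bool" where
  "classifying_space B G \<longleftrightarrow> cw_complex B \<and> aspherical B \<and>
     (\<exists>b\<in>topspace B. fundamental_group B b \<cong> G)"

end

(* Let k be the category of u and n the dimension of K. A member U_i of the categorical cover for u lifts
   to the universal covering P of X = |K|, because u composed with the inclusion of U_i is null-homotopic
   and homotopies lift. Suppose first that every simplex of K lies in some U_i. For a simplex s let N(s) be
   the set of those i with s not contained in U_i, and put rank(s) = dim s + card N(s), a number between 0
   and n + k. Rank is strictly monotone, and if it grows by exactly one from s to a coface t, then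
   N(s) = N(t). Hence the barycentres of the simplices of rank 2j and 2j+1 span a graph in the barycentric
   subdivision whose edges lift coherently to P. As P is simply connected, the lifted graph contracts in P,
   so an open neighbourhood of the graph contracts in X, and these (n+k) div 2 + 1 neighbourhoods cover X.

   Instead of subdividing K until its simplices are small, K is replaced by a small n-dimensional model:
   an abstract complex L with a map g from its vertices to X and a map f from X to |L|, such that g maps the
   vertices of each simplex into a convex part of some U_i, and such that x and the g-images of the vertices
   carrying f(x) lie in a common simplex of K. So X deforms linearly onto the image of L, and f need not be
   a homeomorphism. The model is built over one simplex of K at a time, by filling the model of the boundary
   with a cone that has been subdivided often enough, and joining the two by collars. *)

theory Submission
  imports Defs
begin

section \<open>Lifting homotopies to covering spaces\<close>

text \<open>Counting: a simplex misses at most \<open>k\<close> of the \<open>k + 1\<close> members,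
  so ranks fill an interval of n + k + 1 numbers, and pairing neighbours produces the division by 2.
  Two consecutive ranks are as many as simple connectivity can treat: a chain of simplices with
  these ranks has at most two members, so what must be contracted is one-dimensional and one filled
  loop per edge suffices. Sections over different members of the cover need not agree, so a vertex
  is lifted by the section with the least index outside N(s); equal N(s) puts the same section at
  both ends of an edge. Obstacle to subdividing \<open>K\<close>: on an infinite complex no fixed
  number of subdivisions need make all simplices small, and different numbers on neighbouring
  simplices do not match on common faces. A collar, a cylinder triangulated from a complex to its
  barycentric subdivision, passes from one number to the next and leaves the given boundary
  untouched. The barycentric subdivision of \<open>L\<close> is not formed: its coordinates are, up
  to a factor, differences of values of \<open>f x\<close> (\<open>gap\<close>), which makes the
  neighbourhoods and the contraction explicit.\<close>

definition sheets_over ::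
  "'e topology \<Rightarrow> ('e \<Rightarrow> 'b) \<Rightarrow> 'b topology \<Rightarrow> 'b set \<Rightarrow> 'e set set \<Rightarrow> ('e set \<Rightarrow> 'b \<Rightarrow> 'e) \<Rightarrow> bool" where
  "sheets_over E p B V \<U> r \<longleftrightarrow> openin B V \<and> \<Union>\<U> = {e \<in> topspace E. p e \<in> V} \<and> disjoint \<U> \<and>
     (\<forall>U\<in>\<U>. openin E U \<and> continuous_map (subtopology B V) E (r U) \<and>
        (\<forall>x\<in>V. r U x \<in> U \<and> p (r U x) = x) \<and> (\<forall>e\<in>U. r U (p e) = e))"

lemma covering_map_sheets:
  assumes "covering_map E p B" "b \<in> topspace B"
  obtains V \<U> r where "sheets_over E p B V \<U> r" "b \<in> V"
proof -
  obtain V \<U> where V: "openin B V" "b \<in> V" and U: "\<Union>\<U> = {e \<in> topspace E. p e \<in> V}" "disjoint \<U>"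
    and h': "\<forall>U\<in>\<U>. openin E U \<and> homeomorphic_map (subtopology E U) (subtopology B V) p"
    using bspec[OF conjunct2[OF conjunct2[OF assms(1)[unfolded covering_map_def]]] assms(2)]
    by (elim exE conjE)
  have h: "openin E U \<and> homeomorphic_map (subtopology E U) (subtopology B V) p" if "U \<in> \<U>" for U
    using h' that by blast
  have "\<exists>r. continuous_map (subtopology B V) E r \<and> (\<forall>x\<in>V. r x \<in> U \<and> p (r x) = x) \<and> (\<forall>e\<in>U. r (p e) = e)"
    if U: "U \<in> \<U>" for U
  proof -
    obtain r where r: "homeomorphic_maps (subtopology E U) (subtopology B V) p r"
      using h[OF U] homeomorphic_map_maps by blast
    have UE: "topspace E \<inter> U = U" and VB: "topspace B \<inter> V = V"
      using h that V openin_subset by fast+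
    show ?thesis
      using r UE VB unfolding homeomorphic_maps_def
      by (intro exI[of _ r]) (auto simp: continuous_map_in_subtopology)
  qed
  then obtain r where "\<And>U. U \<in> \<U> \<Longrightarrow> continuous_map (subtopology B V) E (r U) \<and>
      (\<forall>x\<in>V. r U x \<in> U \<and> p (r U x) = x) \<and> (\<forall>e\<in>U. r U (p e) = e)"
    by metis
  then show thesis
    using V U h by (intro that[of V \<U> r]) (auto simp: sheets_over_def)
qed

lemma connected_in_disjoint_open:
  assumes "connectedin E C" "C \<subseteq> \<Union>\<U>" "disjoint \<U>" "\<And>U. U \<in> \<U> \<Longrightarrow> openin E U"
    and "S \<in> \<U>" "x \<in> C" "x \<in> S"
  shows "C \<subseteq> S"
proof (rule ccontr)
  assume "\<not> C \<subseteq> S"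
  moreover have "openin E (\<Union>(\<U> - {S}))" "openin E S"
    using assms by auto
  moreover have "S \<inter> \<Union>(\<U> - {S}) = {}"
    using assms(3,5) unfolding disjoint_def by blast
  moreover have "C \<subseteq> S \<union> \<Union>(\<U> - {S})"
    using assms(2) by blast
  moreover have "S \<inter> C \<noteq> {}" "\<Union>(\<U> - {S}) \<inter> C \<noteq> {}"
    using assms(2,6,7) calculation(1) by auto
  ultimately show False
    using assms(1) unfolding connectedin by (metis inf_assoc inf_bot_left)
qed

text \<open>Agreement spreads: on a short interval the images of both lifts are connected and lie in
  one sheet, where \<open>p\<close> is injective. \<open>Bolzano\<close>, the bisection principle,
  carries this over the whole interval.\<close>

lemma path_lift_unique:
  assumes cov: "covering_map E p B"
    and f: "continuous_map (top_of_set {0..1::real}) E f" and g: "continuous_map (top_of_set {0..1}) E g"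
    and fg: "\<And>t. t \<in> {0..1} \<Longrightarrow> p (f t) = p (g t)" and "f 0 = g 0" and "t \<in> {0..1}"
  shows "f t = g t"
proof -
  \<comment> \<open>Clamping extends the paths to the whole line, so that short intervals around 0
    and 1 need no separate treatment.\<close>
  define c where "c = (\<lambda>t::real. max 0 (min 1 t))"
  have c: "c t \<in> {0..1}" "t \<in> {0..1} \<Longrightarrow> c t = t" for t
    by (auto simp: c_def)
  have contc: "continuous_map euclideanreal (top_of_set {0..1}) c"
    using c(1) by (auto simp: continuous_map_in_subtopology c_def intro!: continuous_intros)
  let ?P = "\<lambda>a b. f (c a) = g (c a) \<longrightarrow> f (c b) = g (c b)"
  have "?P 0 t"
  proof (rule Bolzano[of 0 t ?P])
    show "0 \<le> t" using assms by simp
    fix x :: real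
    have contp: "continuous_map E B p"
      using cov by (simp add: covering_map_def)
    have fc: "continuous_map euclideanreal E (f \<circ> c)" and gc: "continuous_map euclideanreal E (g \<circ> c)"
      using continuous_map_compose contc f g by blast+
    have pf: "continuous_map euclideanreal B (p \<circ> (f \<circ> c))"
      using continuous_map_compose contp fc by blast
    have xB: "(p \<circ> (f \<circ> c)) x \<in> topspace B"
      using continuous_map_image_subset_topspace[OF pf] by auto
    obtain V \<U> r where sh: "sheets_over E p B V \<U> r" and xV: "(p \<circ> (f \<circ> c)) x \<in> V"
      by (rule covering_map_sheets[OF cov xB])
    have V: "openin B V" "\<Union>\<U> = {e \<in> topspace E. p e \<in> V}" "disjoint \<U>"
      and oU: "\<And>U. U \<in> \<U> \<Longrightarrow> openin E U" and r: "\<And>U e. U \<in> \<U> \<Longrightarrow> e \<in> U \<Longrightarrow> r U (p e) = e"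
      using sh unfolding sheets_over_def by auto
    have "openin euclideanreal {t. (p \<circ> (f \<circ> c)) t \<in> V}"
      using openin_continuous_map_preimage[OF pf V(1)] by simp
    then obtain d where d: "d > 0" "\<And>y. \<bar>y - x\<bar> < d \<Longrightarrow> (p \<circ> (f \<circ> c)) y \<in> V"
      using xV by (auto simp: open_dist dist_real_def)
    show "\<exists>d>0. \<forall>a b. a \<le> x \<and> x \<le> b \<and> b - a < d \<longrightarrow> ?P a b"
    proof (intro exI conjI allI impI)
      fix a b assume ab: "a \<le> x \<and> x \<le> b \<and> b - a < d" and eq: "f (c a) = g (c a)"
      have inV: "p (f (c y)) \<in> V" "p (g (c y)) \<in> V" if "y \<in> {a..b}" for y
        using d(2)[of y] that ab fg[OF c(1)[of y]] by auto
      have "f (c y) \<in> topspace E" "g (c y) \<in> topspace E" for y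
        using continuous_map_image_subset_topspace[OF fc] continuous_map_image_subset_topspace[OF gc] by auto
      then have sub: "(f \<circ> c) ` {a..b} \<subseteq> \<Union>\<U>" "(g \<circ> c) ` {a..b} \<subseteq> \<Union>\<U>"
        using inV V(2) by auto
      have con: "connectedin E ((f \<circ> c) ` {a..b})" "connectedin E ((g \<circ> c) ` {a..b})"
        using connectedin_continuous_map_image[OF fc] connectedin_continuous_map_image[OF gc] by auto
      have ca: "f (c a) \<in> (f \<circ> c) ` {a..b}" "g (c a) \<in> (g \<circ> c) ` {a..b}"
        using ab by auto
      then obtain S where S: "S \<in> \<U>" "f (c a) \<in> S"
        using sub(1) by blast
      have "(f \<circ> c) ` {a..b} \<subseteq> S" "(g \<circ> c) ` {a..b} \<subseteq> S"
        using connected_in_disjoint_open[OF con(1) sub(1) V(3) oU S(1) ca(1) S(2)]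
          connected_in_disjoint_open[OF con(2) sub(2) V(3) oU S(1) ca(2)] S(2) eq by simp_all
      then have "f (c b) \<in> S" "g (c b) \<in> S"
        using ab by auto
      then show "f (c b) = g (c b)"
        using r[OF S(1)] fg[OF c(1)[of b]] by metis
    qed (rule d)
  qed auto
  then show ?thesis
    using assms c(2) by auto
qed

text \<open>Over a short interval the lift is one local inverse of \<open>p\<close> applied to
  \<open>H\<close>, on a neighbourhood of \<open>z0\<close> where the initial lift stays in that
  sheet. Longer intervals follow by \<open>Bolzano\<close>; each gluing may shrink the
  neighbourhood, which the existential \<open>N'\<close> absorbs.\<close>

lemma covering_homotopy_lift_local:
  fixes H :: "real \<times> 'z \<Rightarrow> 'b"
  assumes cov: "covering_map E p B" and H: "continuous_map (prod_topology euclideanreal Z) B H"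
    and z0: "z0 \<in> N" and N: "openin Z N" and e: "continuous_map (subtopology Z N) E e"
    and pe: "\<And>z. z \<in> N \<Longrightarrow> p (e z) = H (0, z)"
  shows "\<exists>N' G. openin Z N' \<and> z0 \<in> N' \<and> N' \<subseteq> N \<and>
    continuous_map (prod_topology (top_of_set {0..1}) (subtopology Z N')) E G \<and>
    (\<forall>z\<in>N'. G (0, z) = e z \<and> (\<forall>t\<in>{0..1}. p (G (t, z)) = H (t, z)))"
proof -
  define L where "L a b N e N' G \<longleftrightarrow> openin Z N' \<and> z0 \<in> N' \<and> N' \<subseteq> N \<and>
      continuous_map (prod_topology (top_of_set {a..b}) (subtopology Z N')) E G \<and>
      (\<forall>z\<in>N'. G (a, z) = e z \<and> (\<forall>t\<in>{a..b}. p (G (t, z)) = H (t, z)))" for a b :: real and N e N' G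
  \<comment> \<open>\<open>Q\<close> quantifies over all \<open>N\<close> and \<open>e\<close>
    because the second lift starts from the end of the first, on a smaller neighbourhood.\<close>
  define Q where "Q a b \<longleftrightarrow> (\<forall>N e. openin Z N \<and> z0 \<in> N \<and> continuous_map (subtopology Z N) E e \<and>
      (\<forall>z\<in>N. p (e z) = H (a, z)) \<longrightarrow> (\<exists>N' G. L a b N e N' G))" for a b
  have "Q 0 1"
  proof (rule Bolzano[of 0 1 Q])
    fix a b c assume Q: "Q a b" "Q b c" and ab: "a \<le> b" "b \<le> c"
    show "Q a c"
      unfolding Q_def
    proof (intro allI impI, elim conjE)
      fix N e assume N: "openin Z N" "z0 \<in> N" "continuous_map (subtopology Z N) E e" "\<forall>z\<in>N. p (e z) = H (a, z)"
      then obtain N1 G1 where "L a b N e N1 G1"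
        using Q(1) unfolding Q_def by blast
      then have N1: "openin Z N1" "z0 \<in> N1" "N1 \<subseteq> N"
        and G1: "continuous_map (prod_topology (top_of_set {a..b}) (subtopology Z N1)) E G1"
        "\<And>z. z \<in> N1 \<Longrightarrow> G1 (a, z) = e z" "\<And>z t. z \<in> N1 \<Longrightarrow> t \<in> {a..b} \<Longrightarrow> p (G1 (t, z)) = H (t, z)"
        unfolding L_def by auto
      have "continuous_map (subtopology Z N1) E (G1 \<circ> Pair b)"
        using ab by (intro continuous_map_o_Pair[OF G1(1)]) auto
      moreover have "\<forall>z\<in>N1. p ((G1 \<circ> Pair b) z) = H (b, z)"
        using G1(3) ab by auto
      ultimately obtain N2 G2 where "L b c N1 (G1 \<circ> Pair b) N2 G2"
        using Q(2) N1 unfolding Q_def by blast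
      then have N2: "openin Z N2" "z0 \<in> N2" "N2 \<subseteq> N1"
        and G2: "continuous_map (prod_topology (top_of_set {b..c}) (subtopology Z N2)) E G2"
        "\<And>z. z \<in> N2 \<Longrightarrow> G2 (b, z) = G1 (b, z)" "\<And>z t. z \<in> N2 \<Longrightarrow> t \<in> {b..c} \<Longrightarrow> p (G2 (t, z)) = H (t, z)"
        unfolding L_def by auto
      define G where "G = (\<lambda>x. if fst x \<le> b then G1 x else G2 x)"
      let ?X = "prod_topology (top_of_set {a..c}) (subtopology Z N2)"
      have f: "continuous_map (subtopology ?X S) euclideanreal fst" for S
        by (metis continuous_map_fst continuous_map_from_subtopology continuous_map_into_fulltopology)
      have s: "continuous_map (subtopology ?X S) (subtopology Z N2) snd" for S
        by (metis continuous_map_snd continuous_map_from_subtopology)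
      have s1: "continuous_map (subtopology ?X S) (subtopology Z N1) snd" for S
        using s[of S] N2(3) by (fastforce simp: continuous_map_in_subtopology)
      have "continuous_map ?X E G"
        unfolding G_def
      proof (rule continuous_map_cases_le)
        show "continuous_map ?X euclideanreal fst"
          using f[of UNIV] by simp
        have "continuous_map (subtopology ?X {x \<in> topspace ?X. fst x \<le> b})
            (prod_topology (top_of_set {a..b}) (subtopology Z N1)) (\<lambda>x. (fst x, snd x))"
          using f s1 by (intro continuous_map_pairedI) (auto simp: continuous_map_in_subtopology)
        from continuous_map_compose[OF this G1(1)]
        show "continuous_map (subtopology ?X {x \<in> topspace ?X. fst x \<le> b}) E G1"
          by (simp add: o_def)
        have "continuous_map (subtopology ?X {x \<in> topspace ?X. b \<le> fst x})
            (prod_topology (top_of_set {b..c}) (subtopology Z N2)) (\<lambda>x. (fst x, snd x))"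
          using f s by (intro continuous_map_pairedI) (auto simp: continuous_map_in_subtopology)
        from continuous_map_compose[OF this G2(1)]
        show "continuous_map (subtopology ?X {x \<in> topspace ?X. b \<le> fst x}) E G2"
          by (simp add: o_def)
      qed (use G2(2) in auto)
      moreover have "\<forall>z\<in>N2. G (a, z) = e z \<and> (\<forall>t\<in>{a..c}. p (G (t, z)) = H (t, z))"
        using G1(2,3) G2(3) N2(3) ab by (auto simp: G_def)
      ultimately have "L a c N e N2 G"
        unfolding L_def using N1 N2 by blast
      then show "\<exists>N' G. L a c N e N' G"
        by blast
    qed
  next
    fix x :: real
    have z0Z: "z0 \<in> topspace Z"
      using z0 N openin_subset by blast
    have xB: "H (x, z0) \<in> topspace B"
      using continuous_map_image_subset_topspace[OF H] z0Z by auto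
    obtain V \<U> r where sh: "sheets_over E p B V \<U> r" and xV: "H (x, z0) \<in> V"
      by (rule covering_map_sheets[OF cov xB])
    have V: "openin B V" "\<Union>\<U> = {e \<in> topspace E. p e \<in> V}" "disjoint \<U>"
      and oU: "\<And>U. U \<in> \<U> \<Longrightarrow> openin E U"
      and r: "\<And>U. U \<in> \<U> \<Longrightarrow> continuous_map (subtopology B V) E (r U)"
        "\<And>U x. U \<in> \<U> \<Longrightarrow> x \<in> V \<Longrightarrow> p (r U x) = x"
        "\<And>U e. U \<in> \<U> \<Longrightarrow> e \<in> U \<Longrightarrow> r U (p e) = e"
      using sh unfolding sheets_over_def by auto
    have "openin (prod_topology euclideanreal Z) {y \<in> topspace (prod_topology euclideanreal Z). H y \<in> V}"
      using openin_continuous_map_preimage[OF H V(1)] by simp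
    moreover have "(x, z0) \<in> {y \<in> topspace (prod_topology euclideanreal Z). H y \<in> V}"
      using xV z0Z by simp
    ultimately have "\<exists>I N1. openin euclideanreal I \<and> openin Z N1 \<and> x \<in> I \<and> z0 \<in> N1 \<and>
        I \<times> N1 \<subseteq> {y \<in> topspace (prod_topology euclideanreal Z). H y \<in> V}"
      unfolding openin_prod_topology_alt by (elim allE impE)
    then obtain I N1 where I: "open I" "x \<in> I" and N1: "openin Z N1" "z0 \<in> N1"
      and IN: "I \<times> N1 \<subseteq> {y \<in> topspace (prod_topology euclideanreal Z). H y \<in> V}"
      by (auto simp del: topspace_prod_topology)
    obtain d where d: "d > 0" "\<And>y. \<bar>y - x\<bar> < d \<Longrightarrow> y \<in> I"
      using I by (auto simp: open_dist dist_real_def)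
    show "\<exists>d>0. \<forall>a b. a \<le> x \<and> x \<le> b \<and> b - a < d \<longrightarrow> Q a b"
    proof (rule exI[of _ d], intro conjI allI impI)
      fix a b assume ab: "a \<le> x \<and> x \<le> b \<and> b - a < d"
      have abI: "{a..b} \<subseteq> I" "a \<in> {a..b}"
        using ab by (auto intro!: d(2))
      show "Q a b"
        unfolding Q_def
      proof (intro allI impI, elim conjE)
        fix N e assume N: "openin Z N" "z0 \<in> N" "continuous_map (subtopology Z N) E e" "\<forall>z\<in>N. p (e z) = H (a, z)"
        have NZ: "topspace Z \<inter> N = N"
          using N openin_subset by blast
        have eE: "e z \<in> topspace E" if "z \<in> N" for z
          using continuous_map_image_subset_topspace[OF N(3)] NZ that by auto
        have "H (a, z0) \<in> V"
          using IN abI N1 by blast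
        then have "e z0 \<in> \<Union>\<U>"
          unfolding V(2) using eE[OF N(2)] bspec[OF N(4) N(2)] by simp
        then obtain S where S: "S \<in> \<U>" "e z0 \<in> S"
          by blast
        define N' where "N' = {z \<in> N. e z \<in> S} \<inter> N1"
        have "openin (subtopology Z N) {z \<in> N. e z \<in> S}"
          using openin_continuous_map_preimage[OF N(3) oU[OF S(1)]] NZ by simp
        then have N': "openin Z N'" "z0 \<in> N'" "N' \<subseteq> N"
          using N N1 S by (auto simp: N'_def openin_open_subtopology)
        define G where "G = r S \<circ> H"
        have id: "continuous_map (prod_topology (top_of_set {a..b}) (subtopology Z N')) (prod_topology euclideanreal Z) id"
        proof -
          let ?X = "prod_topology (top_of_set {a..b}) (subtopology Z N')"
          have "continuous_map ?X euclideanreal fst" "continuous_map ?X Z snd"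
            by (metis continuous_map_fst continuous_map_into_fulltopology,
                metis continuous_map_snd continuous_map_into_fulltopology)
          then have "continuous_map ?X (prod_topology euclideanreal Z) (\<lambda>x. (fst x, snd x))"
            by (rule continuous_map_pairedI)
          then show ?thesis
            by (simp add: id_def)
        qed
        have "H \<in> topspace (prod_topology (top_of_set {a..b}) (subtopology Z N')) \<rightarrow> V"
          using IN abI by (auto simp: N'_def)
        then have "continuous_map (prod_topology (top_of_set {a..b}) (subtopology Z N')) (subtopology B V) H"
          using continuous_map_compose[OF id H] by (simp add: continuous_map_in_subtopology)
        then have "continuous_map (prod_topology (top_of_set {a..b}) (subtopology Z N')) E G"
          unfolding G_def using continuous_map_compose r(1)[OF S(1)] by blast
        moreover have "\<forall>z\<in>N'. G (a, z) = e z \<and> (\<forall>t\<in>{a..b}. p (G (t, z)) = H (t, z))"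
        proof (intro ballI conjI)
          fix z assume "z \<in> N'"
          then show "G (a, z) = e z"
            using r(3)[OF S(1), of "e z"] N(4) by (simp add: N'_def G_def)
          fix t assume "t \<in> {a..b}"
          then have "(t, z) \<in> I \<times> N1"
            using \<open>z \<in> N'\<close> abI(1) by (auto simp: N'_def)
          then show "p (G (t, z)) = H (t, z)"
            using r(2)[OF S(1)] IN by (auto simp: G_def)
        qed
        ultimately have "L a b N e N' G"
          unfolding L_def using N' by blast
        then show "\<exists>N' G. L a b N e N' G"
          by blast
      qed
    qed (rule d)
  qed simp
  then obtain N' G where "L 0 1 N e N' G"
    using assms unfolding Q_def by blast
  then show ?thesis
    unfolding L_def by blast
qed

text \<open>The local lifts agree on overlaps, since over each point they are lifts of one path with
  one starting point; pasting over the open sets \<open>N z\<close> makes them global.\<close>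

lemma covering_homotopy_lift:
  fixes H :: "real \<times> 'z \<Rightarrow> 'b"
  assumes cov: "covering_map E p B" and H: "continuous_map (prod_topology (top_of_set {0..1}) Z) B H"
    and e: "continuous_map Z E e" and pe: "\<And>z. z \<in> topspace Z \<Longrightarrow> p (e z) = H (0, z)"
  obtains G where "continuous_map (prod_topology (top_of_set {0..1}) Z) E G"
    "\<And>z. z \<in> topspace Z \<Longrightarrow> G (0, z) = e z"
    "\<And>z t. z \<in> topspace Z \<Longrightarrow> t \<in> {0..1} \<Longrightarrow> p (G (t, z)) = H (t, z)"
proof -
  define c where "c = (\<lambda>t::real. max 0 (min 1 t))"
  have c: "c t \<in> {0..1}" "t \<in> {0..1} \<Longrightarrow> c t = t" for t
    by (auto simp: c_def)
  have contc: "continuous_map euclideanreal (top_of_set {0..1}) c"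
    using c(1) by (auto simp: continuous_map_in_subtopology c_def intro!: continuous_intros)
  let ?H = "H \<circ> (\<lambda>(t, z). (c t, z))"
  have "continuous_map (prod_topology euclideanreal Z) (prod_topology (top_of_set {0..1}) Z) (\<lambda>(t, z). (c t, id z))"
    using contc by (subst continuous_map_prod_top) auto
  then have H': "continuous_map (prod_topology euclideanreal Z) B ?H"
    using continuous_map_compose H by fastforce
  have "\<exists>N' G. openin Z N' \<and> z \<in> N' \<and> N' \<subseteq> topspace Z \<and>
    continuous_map (prod_topology (top_of_set {0..1}) (subtopology Z N')) E G \<and>
    (\<forall>z\<in>N'. G (0, z) = e z \<and> (\<forall>t\<in>{0..1}. p (G (t, z)) = ?H (t, z)))" if "z \<in> topspace Z" for z
    using e pe c by (intro covering_homotopy_lift_local[OF cov H' that]) auto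
  then obtain N G where NG: "\<And>z. z \<in> topspace Z \<Longrightarrow> openin Z (N z) \<and> z \<in> N z \<and> N z \<subseteq> topspace Z \<and>
    continuous_map (prod_topology (top_of_set {0..1}) (subtopology Z (N z))) E (G z) \<and>
    (\<forall>z'\<in>N z. G z (0, z') = e z' \<and> (\<forall>t\<in>{0..1}. p (G z (t, z')) = ?H (t, z')))"
    by metis
  have agree: "G z (t, y) = G z' (t, y)"
    if "z \<in> topspace Z" "z' \<in> topspace Z" "y \<in> N z" "y \<in> N z'" "t \<in> {0..1}" for z z' y t
  proof -
    have cont: "continuous_map (top_of_set {0..1}) E (\<lambda>t. G w (t, y))" if "w \<in> topspace Z" "y \<in> N w" for w
    proof -
      have "continuous_map (top_of_set {0..1}) (prod_topology (top_of_set {0..1}) (subtopology Z (N w))) (\<lambda>t. (t, y))"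
        using that NG by (intro continuous_map_pairedI) auto
      then show ?thesis
        using NG[OF that(1)] continuous_map_compose by (fastforce simp: o_def)
    qed
    show ?thesis
      using path_lift_unique[OF cov cont[OF that(1,3)] cont[OF that(2,4)] _ _ that(5)] NG that by auto
  qed
  let ?X = "prod_topology (top_of_set {0..1::real}) Z"
  have "continuous_map ?X E (\<lambda>x. G (snd x) x)"
  proof (rule pasting_lemma[where I = "topspace Z" and T = "\<lambda>z. {0..1} \<times> N z" and f = G])
    fix z assume z: "z \<in> topspace Z"
    show "openin ?X ({0..1} \<times> N z)"
      using NG[OF z] by (auto simp: openin_prod_Times_iff)
    show "continuous_map (subtopology ?X ({0..1} \<times> N z)) E (G z)"
      using NG[OF z] by (simp add: subtopology_Times subtopology_subtopology)
  next
    fix z z' x assume "z \<in> topspace Z" "z' \<in> topspace Z" "x \<in> topspace ?X \<inter> {0..1} \<times> N z \<inter> {0..1} \<times> N z'"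
    then show "G z x = G z' x"
      using agree[of z z' "snd x" "fst x"] by auto
  next
    fix x assume "x \<in> topspace ?X"
    then show "\<exists>j. j \<in> topspace Z \<and> x \<in> {0..1} \<times> N j \<and> G (snd x) x = G j x"
      using NG by (intro exI[of _ "snd x"]) auto
  qed
  then show thesis
  proof (rule that)
    fix z assume z: "z \<in> topspace Z"
    show "G (snd (0, z)) (0, z) = e z"
      using NG[OF z] by simp
    fix t :: real assume "t \<in> {0..1}"
    then show "p (G (snd (t, z)) (t, z)) = H (t, z)"
      using NG[OF z] c(2) by simp
  qed
qed

section \<open>Sections of the pulled-back universal covering\<close>

text \<open>Read backwards, the null-homotopy starts at a constant map, which has a constant lift;
  the other end of the lifted homotopy lifts \<open>f\<close>.\<close>

lemma null_homotopic_lift: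
  assumes cov: "covering_map E p B" and null: "null_homotopic Z B f"
  obtains e where "continuous_map Z E e" "\<And>z. z \<in> topspace Z \<Longrightarrow> p (e z) = f z"
\<comment> \<open>Over an empty \<open>Z\<close> the constant of the null-homotopy may lie outside
  \<open>B\<close> and then has no point above it.\<close>
proof (cases "topspace Z = {}")
  case True
  then show thesis
    using that[of undefined] by (simp add: continuous_map_def)
next
  case False
  obtain c where hom: "homotopic_with (\<lambda>h. True) Z B f (\<lambda>x. c)"
    using null by (auto simp: null_homotopic_def)
  have "c \<in> topspace B"
    using homotopic_with_imp_continuous_maps[OF hom] False by (auto simp: continuous_map_def)
  then have "c \<in> p ` topspace E"
    using cov by (simp add: covering_map_def)
  then obtain e0 where e0: "e0 \<in> topspace E" "p e0 = c"
    by auto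
  obtain H where H: "continuous_map (prod_topology (top_of_set {0..1::real}) Z) B H"
    and H01: "\<forall>x. H (0, x) = c" "\<forall>x. H (1, x) = f x"
    using homotopic_with_symD[OF hom] by (auto simp: homotopic_with_def)
  obtain G where G: "continuous_map (prod_topology (top_of_set {0..1::real}) Z) E G"
    and "\<And>z. z \<in> topspace Z \<Longrightarrow> G (0, z) = e0"
    and pG: "\<And>z t. z \<in> topspace Z \<Longrightarrow> t \<in> {0..1} \<Longrightarrow> p (G (t, z)) = H (t, z)"
    using covering_homotopy_lift[OF cov H, of "\<lambda>x. e0"] e0 H01 by auto
  show thesis
  proof (rule that)
    show "continuous_map Z E (G \<circ> Pair 1)"
      by (rule continuous_map_o_Pair[OF G]) simp
    show "p ((G \<circ> Pair 1) z) = f z" if "z \<in> topspace Z" for z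
      using pG[OF that, of 1] H01 by simp
  qed
qed

text \<open>A lift of \<open>u\<close> to \<open>E\<close> over \<open>U\<close> is the second
  coordinate of a section of the pull-back. Through these sections the category of \<open>u\<close>
  enters the contraction of subsets of \<open>X\<close>.\<close>

lemma pullback_section:
  assumes cls: "classifying_map X u E p B" and U: "null_homotopic (subtopology X U) B u"
  obtains e where "continuous_map (subtopology X U) (pullback X u E p) e"
    "\<And>x. x \<in> topspace X \<inter> U \<Longrightarrow> fst (e x) = x"
proof -
  have cov: "covering_map E p B"
    using cls by (simp add: classifying_map_def universal_covering_def)
  obtain e where e: "continuous_map (subtopology X U) E e" "\<And>x. x \<in> topspace X \<inter> U \<Longrightarrow> p (e x) = u x"
    using null_homotopic_lift[OF cov U] by auto
  show thesis
  proof (rule that)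
    show "continuous_map (subtopology X U) (pullback X u E p) (\<lambda>x. (x, e x))"
      using e by (auto simp: pullback_def continuous_map_in_subtopology continuous_map_pairedI
          intro!: continuous_map_pairedI continuous_map_from_subtopology)
  qed simp
qed

section \<open>Squares in a simply connected space\<close>

text \<open>A null-homotopy of the loop "\<open>g\<close> reversed, \<open>a\<close>,
  \<open>h\<close>", reshaped into a square. The sides are prescribed by \<open>g\<close> and
  \<open>h\<close> alone, so that squares over edges with a common vertex fit along it. Their
  doubled speed leaves the upper half to the null-homotopy, which rests at \<open>q\<close> on both
  sides.\<close>

lemma simply_connected_fill:
  assumes sc: "simply_connected_topology P"
    and a: "pathin P a" and g: "pathin P g" "g 0 = a 0" "g 1 = q" and h: "pathin P h" "h 0 = a 1" "h 1 = q"
  obtains F where "continuous_map (prod_topology (top_of_set {0..1}) (top_of_set {0..1::real})) P F"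
    "\<And>s. s \<in> {0..1} \<Longrightarrow> F (s, 0) = a s" "\<And>s. s \<in> {0..1} \<Longrightarrow> F (s, 1) = q"
    "\<And>t. t \<in> {0..1} \<Longrightarrow> F (0, t) = g (min 1 (2 * t))" "\<And>t. t \<in> {0..1} \<Longrightarrow> F (1, t) = h (min 1 (2 * t))"
proof -
  let ?I = "top_of_set {0..1::real}"
  \<comment> \<open>\<open>a\<close> occupies the middle third of the loop, \<open>g\<close>
    reversed the first and \<open>h\<close> the last.\<close>
  define l where "l = (\<lambda>s. if s \<le> 1/3 then g (1 - 3 * s) else if s \<le> 2/3 then a (3 * s - 1) else h (3 * s - 2))"
  have comp: "continuous_map (subtopology euclideanreal S) P (\<lambda>s. k (\<phi> s))"
    if "pathin P k" "continuous_on S \<phi>" "\<phi> ` S \<subseteq> {0..1}" for k \<phi> S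
    using continuous_map_compose[of "subtopology euclideanreal S" ?I \<phi> P k] that
    by (auto simp: pathin_def o_def continuous_map_in_subtopology)
  have "pathin P l"
    unfolding pathin_def l_def
    apply (rule continuous_map_cases_le)
    subgoal by (simp add: continuous_map_from_subtopology)
    subgoal by simp
    subgoal unfolding subtopology_subtopology by (rule comp[OF g(1)]) (auto intro!: continuous_intros)
    subgoal
      apply (rule continuous_map_cases_le)
      subgoal by (simp add: continuous_map_from_subtopology)
      subgoal by simp
      subgoal unfolding subtopology_subtopology by (rule comp[OF a]) (auto intro!: continuous_intros)
      subgoal unfolding subtopology_subtopology by (rule comp[OF h(1)]) (auto intro!: continuous_intros)
      subgoal for x by (subgoal_tac "3 * x - 1 = 1 \<and> 3 * x - 2 = 0") (use h in auto)
      done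
    subgoal for x by (subgoal_tac "1 - 3 * x = 0 \<and> 3 * x - 1 = 0") (use g in auto)
    done
  moreover have "l 0 = q" "l 1 = q"
    using g h by (auto simp: l_def)
  ultimately have l: "loop_in P q l"
    by (simp add: loop_in_def)
  have qP: "q \<in> topspace P"
    using g by (fastforce simp: pathin_def continuous_map_def)
  have "homotopic_loops_at P q l (\<lambda>t. q)"
    using sc l qP unfolding simply_connected_topology_def by blast
  then obtain H where H: "continuous_map (prod_topology ?I ?I) P H"
    and H0: "\<And>s. H (0, s) = l s" and H1: "\<And>s. H (1, s) = q"
    and Hq: "\<And>t. t \<in> {0..1} \<Longrightarrow> H (t, 0) = q \<and> H (t, 1) = q"
    unfolding homotopic_loops_at_def homotopic_with_def by blast
  \<comment> \<open>The parameter range is the middle third of the loop at \<open>t = 0\<close> and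
    widens linearly to the whole loop at \<open>t = 1\<close>.\<close>
  define \<sigma> where "\<sigma> s t = (1 - t) / 3 + s * (1 + 2 * t) / 3" for s t :: real
  have \<sigma>: "\<sigma> s t \<in> {0..1}" if "s \<in> {0..1}" "t \<in> {0..1}" for s t
  proof -
    have "s * (1 + 2 * t) \<le> 1 * (1 + 2 * t)" "0 \<le> s * (1 + 2 * t)"
      using that by (intro mult_right_mono mult_nonneg_nonneg; simp)+
    moreover have "(1 - t) / 3 + m / 3 \<in> {0..1}" if "m \<le> 1 * (1 + 2 * t)" "0 \<le> m" for m
      using that \<open>t \<in> {0..1}\<close> by (auto simp: field_simps)
    ultimately show ?thesis
      unfolding \<sigma>_def by blast
  qed
  \<comment> \<open>The lower half of the square widens the range within the loop; the upper half
    runs the null-homotopy.\<close>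
  define \<Phi> where "\<Phi> = (\<lambda>(s, t). (max 0 (2 * t - 1), \<sigma> s (min 1 (2 * t))))"
  have "continuous_on ({0..1} \<times> {0..1}) \<Phi>"
    unfolding \<Phi>_def \<sigma>_def split_def by (intro continuous_intros) auto
  moreover have "\<Phi> ` ({0..1} \<times> {0..1}) \<subseteq> {0..1} \<times> {0..1}"
    using \<sigma> by (auto simp: \<Phi>_def simp del: atLeastAtMost_iff) (auto)
  ultimately have "continuous_map (prod_topology ?I ?I) (prod_topology ?I ?I) \<Phi>"
    by (simp add: subtopology_Times[symmetric] continuous_map_in_subtopology image_subset_iff_funcset)
  then have F: "continuous_map (prod_topology ?I ?I) P (H \<circ> \<Phi>)"
    using H continuous_map_compose by blast
  show thesis
  proof (rule that[OF F])
    fix s :: real assume s: "s \<in> {0..1}"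
    show "(H \<circ> \<Phi>) (s, 0) = a s"
      using s g h by (auto simp: \<Phi>_def \<sigma>_def H0 l_def field_simps)
    show "(H \<circ> \<Phi>) (s, 1) = q"
      by (simp add: \<Phi>_def H1)
  next
    fix t :: real assume t: "t \<in> {0..1}"
    have "g (min 1 (2 * t)) = q" "h (min 1 (2 * t)) = q" if "t > 1/2"
      using g h that by auto
    show "(H \<circ> \<Phi>) (0, t) = g (min 1 (2 * t))"
    proof (cases "t \<le> 1/2")
      case True
      then show ?thesis using t by (auto simp: \<Phi>_def \<sigma>_def H0 l_def field_simps)
    next
      case False
      then show ?thesis using t g Hq[of "2 * t - 1"] by (auto simp: \<Phi>_def \<sigma>_def)
    qed
    show "(H \<circ> \<Phi>) (1, t) = h (min 1 (2 * t))"
    proof (cases "t \<le> 1/2")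
      case True
      then show ?thesis using t h by (auto simp: \<Phi>_def \<sigma>_def H0 l_def field_simps)
    next
      case False
      then show ?thesis using t h Hq[of "2 * t - 1"] by (auto simp: \<Phi>_def \<sigma>_def)
    qed
  qed
qed

section \<open>Geometric realizations of abstract complexes\<close>

text \<open>Convexity, for sets of coordinate functions.\<close>

definition segment_closed :: "('v \<Rightarrow> real) set \<Rightarrow> bool" where
  "segment_closed Q \<longleftrightarrow> (\<forall>x\<in>Q. \<forall>y\<in>Q. \<forall>t\<in>{0..1}. (\<lambda>v. (1 - t) * x v + t * y v) \<in> Q)"

definition barycentre :: "('w \<Rightarrow> 'v \<Rightarrow> real) \<Rightarrow> 'w set \<Rightarrow> 'v \<Rightarrow> real" where
  "barycentre g s = (\<lambda>v. (\<Sum>w\<in>s. g w v) / real (card s))"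

lemma segment_closed_barycentre:
  assumes Q: "segment_closed Q" and "finite s" "s \<noteq> {}" "g ` s \<subseteq> Q"
  shows "barycentre g s \<in> Q"
  using assms(2-)
proof (induction s rule: finite_ne_induct)
  case (singleton a)
  then show ?case by (simp add: barycentre_def)
next
  case (insert a F)
  \<comment> \<open>The weight of the added point in the mean of \<open>card F + 1\<close>
    points.\<close>
  define t where "t = 1 / (real (card F) + 1)"
  have "t \<in> {0..1}"
    by (simp add: t_def)
  moreover have "barycentre g F \<in> Q" "g a \<in> Q"
    using insert by auto
  ultimately have "(\<lambda>v. (1 - t) * barycentre g F v + t * g a v) \<in> Q"
    using Q unfolding segment_closed_def by blast
  moreover have "barycentre g (insert a F) v = (1 - t) * barycentre g F v + t * g a v" for v
  proof -
    have n: "real (card F) \<noteq> 0"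
      using insert by auto
    have "(1 - t) * barycentre g F v = (\<Sum>w\<in>F. g w v) / (real (card F) + 1)"
      using n by (simp add: t_def barycentre_def divide_simps)
    then show ?thesis
      using insert by (simp add: barycentre_def t_def add_divide_distrib add.commute)
  qed
  ultimately show ?case
    by presburger
qed

lemma segment_closed_closed_simplex: "segment_closed (closed_simplex s)"
  unfolding segment_closed_def closed_simplex_def
  by (auto simp: sum.distrib simp flip: sum_distrib_left)

text \<open>A member of the cover need not be convex. The convex \<open>Q\<close> inside it keeps
  the barycentres of faces, and the segments between them, in the member, so that one section can
  lift them.\<close>

definition small :: "('v \<Rightarrow> real) set set \<Rightarrow> ('w \<Rightarrow> 'v \<Rightarrow> real) \<Rightarrow> 'w set \<Rightarrow> bool" where
  "small \<U> g s \<longleftrightarrow> (\<exists>U\<in>\<U>. \<exists>Q\<subseteq>U. segment_closed Q \<and> g ` s \<subseteq> Q)"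

lemma small_cong: "(\<And>w. w \<in> s \<Longrightarrow> g w = g' w) \<Longrightarrow> small \<U> g s \<longleftrightarrow> small \<U> g' s"
  unfolding small_def by (metis (no_types, lifting) image_cong)

lemma small_antimono: "small \<U> g s \<Longrightarrow> t \<subseteq> s \<Longrightarrow> small \<U> g t"
  unfolding small_def by (meson image_mono subset_trans)

section \<open>Coordinates with respect to the barycentric subdivision\<close>

text \<open>For a point \<open>y\<close> of a simplex this is, up to the factor
  \<open>card s\<close>, its coordinate at the barycentre of \<open>s\<close> in the barycentric
  subdivision. For finite non-empty \<open>s\<close> it is positive exactly when \<open>s\<close> is
  a superlevel set {v. y v > c} with c \<ge> 0. The inserted 0 keeps \<open>Max\<close> meaningful
  if \<open>s\<close> has empty complement, and forces c \<ge> 0.\<close>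

definition gap :: "'w set \<Rightarrow> ('w \<Rightarrow> real) \<Rightarrow> real" where
  "gap s y = max 0 (Min (y ` s) - Max (insert 0 (y ` (- s))))"

lemma gap_nonneg: "0 \<le> gap s y"
  by (simp add: gap_def)

lemma finite_range_of_finite_support: "finite {v. y v \<noteq> (0::real)} \<Longrightarrow> finite (y ` A)"
  by (rule finite_subset[of _ "insert 0 (y ` {v. y v \<noteq> 0})"]) auto

lemma gap_pos_iff:
  assumes "finite s" "s \<noteq> {}" "finite {v. y v \<noteq> 0}"
  shows "0 < gap s y \<longleftrightarrow> (\<forall>v\<in>s. 0 < y v \<and> (\<forall>w. w \<notin> s \<longrightarrow> y w < y v))"
proof -
  have fin: "finite (insert 0 (y ` (- s)))"
    using finite_range_of_finite_support[OF assms(3)] by blast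
  have "0 < gap s y \<longleftrightarrow> Max (insert 0 (y ` (- s))) < Min (y ` s)"
    by (auto simp: gap_def)
  also have "\<dots> \<longleftrightarrow> (\<forall>v\<in>s. Max (insert 0 (y ` (- s))) < y v)"
    using assms by (subst Min_gr_iff) auto
  also have "\<dots> \<longleftrightarrow> (\<forall>v\<in>s. 0 < y v \<and> (\<forall>w. w \<notin> s \<longrightarrow> y w < y v))"
    using fin by (subst Max_less_iff) auto
  finally show ?thesis .
qed

text \<open>Superlevel sets of one function are nested: a point of \<open>s - t\<close> and a point
  of \<open>t - s\<close> would each have the larger value.\<close>

lemma gap_pos_chain:
  assumes "finite s" "s \<noteq> {}" "finite t" "t \<noteq> {}" "finite {v. y v \<noteq> 0}" "0 < gap s y" "0 < gap t y"
  shows "s \<subseteq> t \<or> t \<subseteq> s"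
proof (rule ccontr)
  assume "\<not> (s \<subseteq> t \<or> t \<subseteq> s)"
  then obtain v w where "v \<in> s" "v \<notin> t" "w \<in> t" "w \<notin> s"
    by blast
  then show False
    using gap_pos_iff[of s y] gap_pos_iff[of t y] assms by (meson order_less_asym)
qed

lemma gap_pos_support: "finite s \<Longrightarrow> s \<noteq> {} \<Longrightarrow> finite {v. y v \<noteq> 0} \<Longrightarrow> 0 < gap s y \<Longrightarrow> s \<subseteq> {v. y v \<noteq> 0}"
  by (auto simp: gap_pos_iff)

text \<open>The maximum points form a superlevel set, so some gap is always positive. This keeps
  total masses away from zero and later makes the patches a cover.\<close>

lemma gap_pos_Max:
  assumes fin: "finite {v. y v \<noteq> 0}" and v: "0 < y v"
  defines "s \<equiv> {v. \<forall>w. y w \<le> y v}"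
  shows "finite s" "s \<noteq> {}" "0 < gap s y"
proof -
  have fr: "finite (range y)"
    using finite_range_of_finite_support[OF fin] .
  obtain u where u: "y u = Max (range y)"
    using Max_in[OF fr] by auto
  have ge: "y w \<le> y u" for w
    using fr by (simp add: u)
  have s: "v \<in> s \<longleftrightarrow> y v = y u" for v
    using ge by (auto simp: s_def intro: antisym)
  have pos: "0 < y u"
    using ge[of v] v by linarith
  then have "s \<subseteq> {v. y v \<noteq> 0}"
    using s by auto
  then show fs: "finite s"
    using fin finite_subset by blast
  show ns: "s \<noteq> {}"
    using s by blast
  show "0 < gap s y"
    unfolding gap_pos_iff[OF fs ns fin] using s pos ge by (auto simp: less_le)
qed

lemma continuous_map_Min:
  assumes "finite K" "K \<noteq> {}" "\<And>i. i \<in> K \<Longrightarrow> continuous_map T euclideanreal (\<lambda>z. f z i)"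
  shows "continuous_map T euclideanreal (\<lambda>z. Min (f z ` K))"
  using assms
proof (induction K rule: finite_ne_induct)
  case (insert i K)
  then have "(\<lambda>z. Min (f z ` insert i K)) = (\<lambda>z. min (f z i) (Min (f z ` K)))"
    by auto
  then show ?case
    using insert by (simp add: continuous_map_real_min)
qed auto

lemma continuous_map_Max0:
  assumes "finite K" "\<And>i. i \<in> K \<Longrightarrow> continuous_map T euclideanreal (\<lambda>z. f z i)"
  shows "continuous_map T euclideanreal (\<lambda>z. Max (insert 0 (f z ` K)))"
  using assms
proof (induction K rule: finite_induct)
  case (insert i K)
  have "(\<lambda>z. Max (insert 0 (f z ` insert i K))) = (\<lambda>z. max (f z i) (Max (insert 0 (f z ` K))))"
  proof
    fix z
    have "insert 0 (f z ` insert i K) = insert (f z i) (insert 0 (f z ` K))"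
      by blast
    then show "Max (insert 0 (f z ` insert i K)) = max (f z i) (Max (insert 0 (f z ` K)))"
      using Max_insert[of "insert 0 (f z ` K)" "f z i"] insert(1) by (simp del: Max_insert)
  qed
  then show ?case
    using insert by (simp add: continuous_map_real_max)
qed auto

text \<open>All supports lie in the finite \<open>V\<close>, so the possibly infinite complement of
  \<open>s\<close> may be replaced by \<open>V - s\<close>; minimum and maximum then run over fixed
  finite sets.\<close>

lemma continuous_map_gap:
  assumes "finite V" "\<And>z w. z \<in> topspace T \<Longrightarrow> w \<notin> V \<Longrightarrow> Y z w = 0"
    and c: "\<And>w. continuous_map T euclideanreal (\<lambda>z. Y z w)" and "finite s" "s \<noteq> {}"
  shows "continuous_map T euclideanreal (\<lambda>z. gap s (Y z))"
proof -
  have "continuous_map T euclideanreal (\<lambda>z. max 0 (Min (Y z ` s) - Max (insert 0 (Y z ` (V - s)))))"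
    using assms by (intro continuous_map_real_max continuous_map_diff continuous_map_Min continuous_map_Max0) auto
  moreover have "max 0 (Min (Y z ` s) - Max (insert 0 (Y z ` (V - s)))) = gap s (Y z)"
    if "z \<in> topspace T" for z
  proof -
    have "insert 0 (Y z ` (V - s)) = insert 0 (Y z ` (- s))"
      using assms(2)[OF that] by auto
    then show ?thesis
      by (simp add: gap_def)
  qed
  ultimately show ?thesis
    by (rule continuous_map_eq)
qed

section \<open>Normalised masses and bodies of complexes\<close>

text \<open>The total runs over the support because the vertex type may be infinite. For supports
  within one finite set it is a fixed finite sum, hence continuous.\<close>

definition unit_mass :: "('w \<Rightarrow> real) \<Rightarrow> 'w \<Rightarrow> real" where
  "unit_mass y = (\<lambda>v. y v / (\<Sum>w\<in>{w. y w \<noteq> 0}. y w))"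

lemma sum_support: "finite V \<Longrightarrow> {w. y w \<noteq> (0::real)} \<subseteq> V \<Longrightarrow> sum y {w. y w \<noteq> 0} = sum y V"
  by (intro sum.mono_neutral_left) auto

lemma unit_mass_in_closed_simplex:
  assumes "finite s" "{w. y w \<noteq> 0} \<subseteq> s" "\<And>w. 0 \<le> y w" "y v \<noteq> 0"
  shows "unit_mass y \<in> closed_simplex s"
proof -
  have "0 < sum y s"
    using assms by (intro sum_pos2[of s v]) (auto simp: less_le)
  then show ?thesis
    using assms sum_support[of s y] unfolding unit_mass_def closed_simplex_def
    by (auto simp flip: sum_divide_distrib)
qed

lemma unit_mass_id:
  assumes "finite s" "x \<in> closed_simplex s"
  shows "unit_mass x = x"
proof -
  have "{w. x w \<noteq> 0} \<subseteq> s"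
    using assms(2) by (auto simp: closed_simplex_def)
  then show ?thesis
    using sum_support[of s x] assms by (simp add: unit_mass_def closed_simplex_def)
qed

lemma continuous_map_unit_mass:
  assumes V: "finite V" "\<And>z w. z \<in> topspace T \<Longrightarrow> w \<notin> V \<Longrightarrow> Y z w = 0"
    and c: "\<And>w. w \<in> V \<Longrightarrow> continuous_map T euclideanreal (\<lambda>z. Y z w)"
    and pos: "\<And>z w. z \<in> topspace T \<Longrightarrow> 0 \<le> Y z w" "\<And>z. z \<in> topspace T \<Longrightarrow> \<exists>w. Y z w \<noteq> 0"
  shows "continuous_map T (powertop_real UNIV) (\<lambda>z. unit_mass (Y z))"
  unfolding continuous_map_componentwise_UNIV
proof
  fix w
  have cw: "continuous_map T euclideanreal (\<lambda>z. Y z w)"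
  proof (cases "w \<in> V")
    case False
    show ?thesis
      by (rule continuous_map_eq[of _ _ "\<lambda>z. 0"]) (use V False in auto)
  qed (rule c)
  have s: "sum (Y z) {w. Y z w \<noteq> 0} = sum (Y z) V" if "z \<in> topspace T" for z
    using V that by (intro sum_support) auto
  have "sum (Y z) V \<noteq> 0" if z: "z \<in> topspace T" for z
  proof -
    obtain w where "Y z w \<noteq> 0" using pos(2)[OF z] by blast
    then have "0 < sum (Y z) V"
      using V z pos(1)[OF z] by (intro sum_pos2[of V w]) (auto simp: less_le)
    then show ?thesis by simp
  qed
  then have "continuous_map T euclideanreal (\<lambda>z. Y z w / sum (Y z) V)"
    using c cw V(1) by (intro continuous_map_real_divide continuous_map_sum) auto
  then show "continuous_map T euclideanreal (\<lambda>z. unit_mass (Y z) w)"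
    by (rule continuous_map_eq) (simp add: unit_mass_def s)
qed

abbreviation simplex_topology :: "'w set \<Rightarrow> ('w \<Rightarrow> real) topology" where
  "simplex_topology s \<equiv> subtopology (powertop_real UNIV) (closed_simplex s)"

definition body :: "'w set set \<Rightarrow> ('w \<Rightarrow> real) set" where
  "body A = (\<Union>s\<in>A. closed_simplex s)"

text \<open>The coordinate topology, in contrast to the weak topology of \<open>realization\<close>:
  continuity into it is checked one coordinate at a time. The carriers of single simplices, which
  receive \<open>f\<close>, are finite complexes.\<close>

abbreviation body_topology :: "'w set set \<Rightarrow> ('w \<Rightarrow> real) topology" where
  "body_topology A \<equiv> subtopology (powertop_real UNIV) (body A)"

lemma simplexD: "abstract_simplicial_complex A \<Longrightarrow> s \<in> A \<Longrightarrow> finite s \<and> s \<noteq> {}"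
  by (simp add: abstract_simplicial_complex_def)

lemma simplex_face:
  assumes "abstract_simplicial_complex A" "s \<in> A" "t \<subseteq> s" "t \<noteq> {}"
  shows "t \<in> A"
proof -
  have "\<forall>t. t \<subseteq> s \<and> t \<noteq> {} \<longrightarrow> t \<in> A"
    using conjunct2[OF assms(1)[unfolded abstract_simplicial_complex_def]] assms(2) by (rule bspec)
  then show ?thesis
    using assms(3,4) by blast
qed

lemma closed_simplex_support:
  assumes "abstract_simplicial_complex A" "s \<in> A" "x \<in> closed_simplex s"
  shows "{v. x v \<noteq> 0} \<in> A" "x \<in> closed_simplex {v. x v \<noteq> 0}" "{v. x v \<noteq> 0} \<subseteq> s"
proof -
  show sub: "{v. x v \<noteq> 0} \<subseteq> s"
    using assms(3) by (auto simp: closed_simplex_def)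
  have "{v. x v \<noteq> 0} \<noteq> {}"
  proof
    assume "{v. x v \<noteq> 0} = {}"
    then have "sum x s = 0" by (intro sum.neutral) auto
    then show False using assms(3) by (simp add: closed_simplex_def)
  qed
  then show "{v. x v \<noteq> 0} \<in> A"
    using simplex_face[OF assms(1,2) sub] by simp
  have "finite s"
    using simplexD[OF assms(1,2)] by simp
  then show "x \<in> closed_simplex {v. x v \<noteq> 0}"
    using assms(3) sub sum_support[of s x] by (auto simp: closed_simplex_def)
qed

lemma closed_simplex_le_1:
  assumes "finite s" "x \<in> closed_simplex s"
  shows "x v \<le> 1"
proof (cases "v \<in> s")
  case True
  then have "x v \<le> sum x s"
    using assms by (intro member_le_sum) (auto simp: closed_simplex_def)
  then show ?thesis
    using assms(2) by (simp add: closed_simplex_def)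
qed (use assms in \<open>simp add: closed_simplex_def\<close>)

lemma body_mono: "A \<subseteq> B \<Longrightarrow> body A \<subseteq> body B"
  by (auto simp: body_def)

section \<open>Subdivision relative to a subcomplex\<close>

definition face_chain :: "'w set set \<Rightarrow> bool" where
  "face_chain ch \<longleftrightarrow> (\<forall>s\<in>ch. \<forall>t\<in>ch. s \<subseteq> t \<or> t \<subseteq> s)"

text \<open>\<open>\<nu> s\<close> is the name given to the barycentre of \<open>s\<close>. Names
  are explicit because old and new vertices meet in a collar and must be kept apart.\<close>

definition subdivision :: "('w set \<Rightarrow> 'w) \<Rightarrow> 'w set set \<Rightarrow> 'w set set" where
  "subdivision \<nu> C = {\<nu> ` ch | ch. ch \<noteq> {} \<and> ch \<subseteq> C \<and> face_chain ch}"

text \<open>A triangulated cylinder on \<open>A\<close>: taking \<open>ch\<close> empty gives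
  \<open>A\<close> at one end, taking \<open>b\<close> empty gives its barycentric subdivision at
  the other.\<close>

definition collar :: "('w set \<Rightarrow> 'w) \<Rightarrow> 'w set set \<Rightarrow> 'w set set" where
  "collar \<nu> A = {b \<union> \<nu> ` ch | b ch. b \<union> \<nu> ` ch \<noteq> {} \<and> (b \<in> A \<or> b = {}) \<and> ch \<subseteq> A \<and> face_chain ch \<and> (\<forall>s\<in>ch. b \<subseteq> s)}"

lemma subdivisionI: "ch \<noteq> {} \<Longrightarrow> ch \<subseteq> C \<Longrightarrow> face_chain ch \<Longrightarrow> \<nu> ` ch \<in> subdivision \<nu> C"
  unfolding subdivision_def by blast

lemma collarI:
  assumes "b \<noteq> {} \<or> ch \<noteq> {}" "b \<in> A \<or> b = {}" "ch \<subseteq> A" "face_chain ch" "\<forall>s\<in>ch. b \<subseteq> s"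
  shows "b \<union> \<nu> ` ch \<in> collar \<nu> A"
  unfolding collar_def by (rule CollectI, rule exI[of _ b], rule exI[of _ ch]) (use assms in simp)

lemma face_chain_subset: "face_chain ch \<Longrightarrow> ch' \<subseteq> ch \<Longrightarrow> face_chain ch'"
  unfolding face_chain_def by (meson subsetD)

text \<open>Members of a chain have different cardinalities, so the chain injects into
  \<open>{m..D}\<close>. The case \<open>m = 1\<close> bounds subdivisions,
  \<open>m = card b\<close> bounds collars.\<close>

lemma face_chain_card:
  assumes "face_chain ch" "finite ch" "\<And>s. s \<in> ch \<Longrightarrow> finite s \<and> m \<le> card s \<and> card s \<le> D" "m \<le> Suc D"
  shows "card ch + m \<le> Suc D"
proof -
  have "inj_on card ch"
  proof (rule inj_onI)
    fix s t assume st: "s \<in> ch" "t \<in> ch" "card s = card t"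
    then have "s \<subseteq> t \<or> t \<subseteq> s"
      using assms(1) by (simp add: face_chain_def)
    then show "s = t"
      using st assms(3)[of s] assms(3)[of t] by (metis card_subset_eq)
  qed
  moreover have "card ` ch \<subseteq> {m..D}"
    using assms(3) by auto
  ultimately have "card ch \<le> card {m..D}"
    using card_inj_on_le by blast
  then show ?thesis
    using assms(4) by simp
qed

lemma face_chain_top:
  assumes "face_chain ch" "finite ch" "ch \<noteq> {}"
  shows "\<exists>t\<in>ch. \<forall>s\<in>ch. s \<subseteq> t"
proof -
  obtain t where t: "t \<in> ch" "\<And>s. s \<in> ch \<Longrightarrow> t \<subseteq> s \<Longrightarrow> t = s"
    using finite_has_maximal[OF assms(2,3)] by blast
  have "s \<subseteq> t" if "s \<in> ch" for s
    using assms(1) t that unfolding face_chain_def by blast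
  then show ?thesis using t by blast
qed

lemma complex_subdivision:
  assumes "finite C"
  shows "abstract_simplicial_complex (subdivision \<nu> C)"
  unfolding abstract_simplicial_complex_def
proof (intro conjI ballI allI impI)
  fix s assume "s \<in> subdivision \<nu> C"
  then obtain ch where ch: "s = \<nu> ` ch" "ch \<noteq> {}" "ch \<subseteq> C" "face_chain ch"
    unfolding subdivision_def by blast
  then show "finite s" "s \<noteq> {}"
    using assms finite_subset by auto
  fix t assume t: "t \<subseteq> s \<and> t \<noteq> {}"
  let ?ch = "{r \<in> ch. \<nu> r \<in> t}"
  have "t = \<nu> ` ?ch"
    using t ch(1) by auto
  moreover have "\<nu> ` ?ch \<in> subdivision \<nu> C"
  proof (rule subdivisionI)
    show "?ch \<noteq> {}"
      using calculation t by (metis image_empty)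
    show "face_chain ?ch"
      by (rule face_chain_subset[OF ch(4)]) blast
  qed (use ch(3) in blast)
  ultimately show "t \<in> subdivision \<nu> C"
    by simp
qed

lemma complex_collar:
  assumes A: "abstract_simplicial_complex A" and "finite A"
  shows "abstract_simplicial_complex (collar \<nu> A)"
  unfolding abstract_simplicial_complex_def
proof (intro conjI ballI allI impI)
  fix s assume "s \<in> collar \<nu> A"
  then obtain b ch where ch: "s = b \<union> \<nu> ` ch" "s \<noteq> {}" "b \<in> A \<or> b = {}" "ch \<subseteq> A" "face_chain ch" "\<forall>s\<in>ch. b \<subseteq> s"
    unfolding collar_def by blast
  moreover have "finite ch" "finite b"
    using ch(3,4) assms(2) finite_subset[of ch A] simplexD[OF A, of b] by auto
  ultimately show "finite s" "s \<noteq> {}"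
    by simp_all
  fix t assume t: "t \<subseteq> s \<and> t \<noteq> {}"
  let ?ch = "{r \<in> ch. \<nu> r \<in> t}"
  have "t = (b \<inter> t) \<union> \<nu> ` ?ch"
    using t ch(1) by auto
  moreover have "(b \<inter> t) \<union> \<nu> ` ?ch \<in> collar \<nu> A"
  proof (rule collarI)
    show "b \<inter> t \<noteq> {} \<or> ?ch \<noteq> {}"
      using calculation t by (metis image_empty sup_bot_left)
    show "face_chain ?ch"
      by (rule face_chain_subset[OF ch(5)]) blast
    show "b \<inter> t \<in> A \<or> b \<inter> t = {}"
      using ch(3) simplex_face[OF A, of b "b \<inter> t"] by auto
    show "?ch \<subseteq> A" "\<forall>s\<in>?ch. b \<inter> t \<subseteq> s"
      using ch(4,6) by auto
  qed
  ultimately show "t \<in> collar \<nu> A"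
    by simp
qed

lemma subset_collar: "A \<subseteq> collar \<nu> A" if "abstract_simplicial_complex A"
proof
  fix s assume "s \<in> A"
  then show "s \<in> collar \<nu> A"
    using simplexD[OF that, of s] collarI[of s "{}" A \<nu>] by (simp add: face_chain_def)
qed

lemma subdivision_mono: "A \<subseteq> C \<Longrightarrow> subdivision \<nu> A \<subseteq> subdivision \<nu> C"
  unfolding subdivision_def by blast

lemma subdivision_subset_collar: "subdivision \<nu> A \<subseteq> collar \<nu> A"
proof
  fix s assume "s \<in> subdivision \<nu> A"
  then obtain ch where "s = \<nu> ` ch" "ch \<noteq> {}" "ch \<subseteq> A" "face_chain ch"
    unfolding subdivision_def by blast
  then show "s \<in> collar \<nu> A"
    using collarI[of "{}" ch A \<nu>] by simp
qed

lemma finite_subdivision: "finite C \<Longrightarrow> finite (subdivision \<nu> C)"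
  by (rule finite_subset[of _ "image \<nu> ` Pow C"]) (auto simp: subdivision_def)

lemma finite_collar:
  assumes "finite A" "abstract_simplicial_complex A"
  shows "finite (collar \<nu> A)"
proof (rule finite_subset)
  show "collar \<nu> A \<subseteq> Pow (\<Union>A \<union> \<nu> ` A)"
    unfolding collar_def by blast
  show "finite (Pow (\<Union>A \<union> \<nu> ` A))"
    using assms simplexD[OF assms(2)] by auto
qed

lemma card_subdivision:
  assumes C: "abstract_simplicial_complex C" "finite C" "\<And>s. s \<in> C \<Longrightarrow> card s \<le> D" and "s \<in> subdivision \<nu> C"
  shows "card s \<le> D"
proof -
  obtain ch where ch: "s = \<nu> ` ch" "ch \<subseteq> C" "face_chain ch"
    using assms(4) unfolding subdivision_def by blast
  have fin: "finite ch"
    using ch C finite_subset by blast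
  have "finite s \<and> 1 \<le> card s \<and> card s \<le> D" if "s \<in> ch" for s
    using simplexD[OF C(1), of s] C(3)[of s] ch(2) that by (auto simp: Suc_le_eq card_gt_0_iff)
  then have "card ch \<le> D"
    using face_chain_card[OF ch(3) fin, of 1 D] by simp
  then show ?thesis
    using ch(1) card_image_le[OF fin, of \<nu>] by simp
qed

text \<open>A collar costs one dimension. It is put only on the model of the boundary, which lies
  one dimension below the filling, so the dimension of the model does not rise.\<close>

lemma card_collar:
  assumes A: "abstract_simplicial_complex A" "finite A" "\<And>s. s \<in> A \<Longrightarrow> card s \<le> D" and "s \<in> collar \<nu> A"
  shows "card s \<le> Suc D"
proof -
  obtain b ch where ch: "s = b \<union> \<nu> ` ch" "b \<in> A \<or> b = {}" "ch \<subseteq> A" "face_chain ch" "\<forall>s\<in>ch. b \<subseteq> s"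
    using assms(4) unfolding collar_def by blast
  have fin: "finite ch"
    using ch A finite_subset by blast
  have "finite s \<and> card b \<le> card s \<and> card s \<le> D" if "s \<in> ch" for s
    using simplexD[OF A(1), of s] A(3)[of s] ch(3,5) that by (auto intro: card_mono)
  moreover have "card b \<le> Suc D"
    using ch(2) A(3)[of b] by auto
  ultimately have "card ch + card b \<le> Suc D"
    by (intro face_chain_card[OF ch(4) fin])
  moreover have "card s \<le> card b + card (\<nu> ` ch)"
    unfolding ch(1) by (rule card_Un_le)
  ultimately show ?thesis
    using card_image_le[OF fin, of \<nu>] by simp
qed

text \<open>At time \<open>\<theta>\<close> the part of the mass above level \<open>\<theta>\<close> still sits at the old vertices, while the part below has
  moved to the barycentres of the superlevel sets; the former are contained in the latter.\<close>

definition collar_mass :: "('w set \<Rightarrow> 'w) \<Rightarrow> 'w set set \<Rightarrow> real \<Rightarrow> ('w \<Rightarrow> real) \<Rightarrow> 'w \<Rightarrow> real" where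
  "collar_mass \<nu> C \<theta> x = (\<lambda>w. if w \<in> \<nu> ` C then gap (the_inv_into C \<nu> w) (\<lambda>v. min (x v) \<theta>) else max 0 (x w - \<theta>))"

text \<open>With a factor \<open>card s\<close> on each gap the total mass would stay 1; the gaps
  are used without it, hence the normalisation.\<close>

definition collar_map :: "('w set \<Rightarrow> 'w) \<Rightarrow> 'w set set \<Rightarrow> real \<Rightarrow> ('w \<Rightarrow> real) \<Rightarrow> 'w \<Rightarrow> real" where
  "collar_map \<nu> C \<theta> x = unit_mass (collar_mass \<nu> C \<theta> x)"

context
  fixes C :: "'w set set" and \<nu> :: "'w set \<Rightarrow> 'w"
  assumes C: "abstract_simplicial_complex C" "finite C" and inj: "inj_on \<nu> C" and fresh: "\<nu> ` C \<inter> \<Union>C = {}"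
begin

lemma collar_mass_nonneg: "0 \<le> collar_mass \<nu> C \<theta> x w"
  by (simp add: collar_mass_def gap_nonneg)

text \<open>The sets in \<open>ch\<close> are the superlevel sets of \<open>x\<close> truncated at
  \<theta>, so they form a chain. On \<open>b\<close> the truncated function takes its maximum
  \<theta>, so every such superlevel set contains \<open>b\<close>: exactly the shape of a collar
  simplex.\<close>

lemma collar_mass_support:
  assumes A: "abstract_simplicial_complex A" "A \<subseteq> C" and x: "x \<in> body A" and th: "0 \<le> \<theta>"
  obtains b ch where "{w. collar_mass \<nu> C \<theta> x w \<noteq> 0} = b \<union> \<nu> ` ch" "b = {v. x v > \<theta>}" "b \<in> A \<or> b = {}"
    "ch \<subseteq> A" "face_chain ch" "\<forall>s\<in>ch. b \<subseteq> s" "b \<noteq> {} \<or> ch \<noteq> {}"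
proof -
  obtain a where a: "a \<in> A" "x \<in> closed_simplex a"
    using x by (auto simp: body_def)
  note sup = closed_simplex_support[OF A(1) a]
  have fina: "finite {v. x v \<noteq> 0}"
    using simplexD[OF A(1) sup(1)] by simp
  have x0: "0 \<le> x v" for v
    using a(2) by (simp add: closed_simplex_def)
  let ?y = "\<lambda>v. min (x v) \<theta>"
  have finy: "finite {v. ?y v \<noteq> 0}"
    by (rule finite_subset[OF _ fina]) (use th in auto)
  define ch where "ch = {s \<in> C. 0 < gap s ?y}"
  define b where "b = {v. x v > \<theta>}"
  have sC: "finite s \<and> s \<noteq> {}" if "s \<in> ch" for s
    using that simplexD[OF C(1)] by (auto simp: ch_def)
  have chs: "s \<subseteq> {v. x v \<noteq> 0}" if "s \<in> ch" for s
    using gap_pos_support[OF conjunct1[OF sC[OF that]] conjunct2[OF sC[OF that]] finy] that th by (auto simp: ch_def)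
  have chA: "ch \<subseteq> A"
    using simplex_face[OF A(1) sup(1) chs] sC by blast
  have "b \<subseteq> {v. x v \<noteq> 0}"
    using th by (auto simp: b_def)
  then have bA: "b \<in> A \<or> b = {}"
    using simplex_face[OF A(1) sup(1)] by blast
  have fc: "face_chain ch"
    unfolding face_chain_def
  proof (intro ballI)
    fix s t assume "s \<in> ch" "t \<in> ch"
    then show "s \<subseteq> t \<or> t \<subseteq> s"
      using gap_pos_chain[of s t ?y] sC[of s] sC[of t] finy by (simp add: ch_def)
  qed
  have bch: "\<forall>s\<in>ch. b \<subseteq> s"
  proof (intro ballI subsetI)
    fix s v assume s: "s \<in> ch" and v: "v \<in> b"
    show "v \<in> s"
    proof (rule ccontr)
      assume vs: "v \<notin> s"
      obtain u where u: "u \<in> s" using sC[OF s] by blast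
      have "?y v < ?y u"
        using gap_pos_iff[of s ?y] sC[OF s] s finy u vs by (simp add: ch_def)
      then show False
        using v by (simp add: b_def)
    qed
  qed
  have ne: "b \<noteq> {} \<or> ch \<noteq> {}"
  \<comment> \<open>At level 0 all the mass is still on old vertices. At a positive level the
    maximum points of the truncated function belong to \<open>ch\<close>.\<close>
  proof (cases "\<theta> = 0")
    case True
    have "{v. x v \<noteq> 0} \<noteq> {}"
      using simplexD[OF A(1) sup(1)] by blast
    then obtain v where "x v \<noteq> 0" by blast
    then have "v \<in> b"
      using x0[of v] True by (simp add: b_def)
    then show ?thesis by blast
  next
    case False
    have "{v. x v \<noteq> 0} \<noteq> {}"
      using simplexD[OF A(1) sup(1)] by blast
    then obtain v where "x v \<noteq> 0" by blast
    then have v: "0 < ?y v"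
      using x0[of v] False th by simp
    define s where "s = {v. \<forall>w. ?y w \<le> ?y v}"
    have s: "finite s" "s \<noteq> {}" "0 < gap s ?y"
      unfolding s_def using gap_pos_Max[OF finy v] by blast+
    then have "s \<subseteq> {v. x v \<noteq> 0}"
      using gap_pos_support[OF s(1,2) finy s(3)] th by auto
    then have "s \<in> A"
      using simplex_face[OF A(1) sup(1) _ s(2)] by blast
    then show ?thesis
      using s A(2) by (auto simp: ch_def)
  qed
  have "collar_mass \<nu> C \<theta> x w \<noteq> 0 \<longleftrightarrow> w \<in> b \<union> \<nu> ` ch" for w
  proof (cases "w \<in> \<nu> ` C")
    case True
    then obtain s where s: "s \<in> C" "w = \<nu> s" by blast
    have "w \<notin> b"
    proof
      assume "w \<in> b"
      then have "w \<in> a"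
        using sup(3) th by (auto simp: b_def)
      then show False
        using True fresh a(1) A(2) by blast
    qed
    moreover have "w \<in> \<nu> ` ch \<longleftrightarrow> s \<in> ch"
      using inj s by (auto simp: ch_def inj_on_def)
    moreover have "collar_mass \<nu> C \<theta> x w = gap s ?y"
      using s inj by (simp add: collar_mass_def the_inv_into_f_f)
    ultimately show ?thesis
      using s(1) gap_nonneg[of s ?y] by (auto simp: ch_def)
  next
    case False
    then have "w \<notin> \<nu> ` ch"
      by (auto simp: ch_def)
    then show ?thesis
      using False by (auto simp: collar_mass_def b_def max_def)
  qed
  then have "{w. collar_mass \<nu> C \<theta> x w \<noteq> 0} = b \<union> \<nu> ` ch"
    by blast
  then show thesis
    using that[of b ch] b_def bA chA fc bch ne by blast
qed

lemma collar_map_in_collar: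
  assumes A: "abstract_simplicial_complex A" "A \<subseteq> C" and x: "x \<in> body A" and th: "0 \<le> \<theta>"
  shows "collar_map \<nu> C \<theta> x \<in> body (collar \<nu> A)"
proof -
  obtain b ch where b: "{w. collar_mass \<nu> C \<theta> x w \<noteq> 0} = b \<union> \<nu> ` ch" "b \<in> A \<or> b = {}"
    "ch \<subseteq> A" "face_chain ch" "\<forall>s\<in>ch. b \<subseteq> s" "b \<noteq> {} \<or> ch \<noteq> {}"
    using collar_mass_support[OF A x th] by metis
  have ne: "b \<union> \<nu> ` ch \<noteq> {}"
    using b(6) by blast
  then obtain w where "collar_mass \<nu> C \<theta> x w \<noteq> 0"
    using b(1) by blast
  moreover have mem: "b \<union> \<nu> ` ch \<in> collar \<nu> A"
    by (rule collarI[OF b(6) b(2-5)])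
  moreover have "finite A"
    using A C finite_subset by blast
  then have "finite (b \<union> \<nu> ` ch)"
    using simplexD[OF complex_collar[OF A(1)] mem] by blast
  ultimately show ?thesis
    unfolding body_def collar_map_def
    by (intro UN_I[OF mem] unit_mass_in_closed_simplex) (auto simp: b(1) collar_mass_nonneg)
qed

text \<open>Barycentric coordinates do not exceed 1, so at time 1 no mass is left on old
  vertices.\<close>

lemma collar_map_1_in_subdivision:
  assumes A: "abstract_simplicial_complex A" "A \<subseteq> C" and x: "x \<in> body A"
  shows "collar_map \<nu> C 1 x \<in> body (subdivision \<nu> A)"
proof -
  obtain b ch where b: "{w. collar_mass \<nu> C 1 x w \<noteq> 0} = b \<union> \<nu> ` ch" "b = {v. x v > 1}"
    "ch \<subseteq> A" "face_chain ch" "b \<noteq> {} \<or> ch \<noteq> {}"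
    using collar_mass_support[OF A x, of 1] by (metis zero_le_one)
  obtain a where a: "a \<in> A" "x \<in> closed_simplex a"
    using x by (auto simp: body_def)
  have b0: "b = {}"
    using closed_simplex_le_1[of a x] simplexD[OF A(1) a(1)] a(2) b(2) by (auto simp: not_less)
  then have mem: "\<nu> ` ch \<in> subdivision \<nu> A"
    using b(3-5) by (intro subdivisionI) simp_all
  have "finite A"
    using A C finite_subset by blast
  then have "finite (\<nu> ` ch)" "\<nu> ` ch \<noteq> {}"
    using simplexD[OF complex_subdivision mem] by blast+
  then obtain w where "collar_mass \<nu> C 1 x w \<noteq> 0"
    using b(1) by blast
  then show ?thesis
    unfolding body_def collar_map_def using \<open>finite (\<nu> ` ch)\<close>
    by (intro UN_I[OF mem] unit_mass_in_closed_simplex) (auto simp: b(1) b0 collar_mass_nonneg)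
qed

text \<open>At time 0 the truncated function vanishes, and so do all gaps.\<close>

lemma collar_map_0:
  assumes "x \<in> body C"
  shows "collar_map \<nu> C 0 x = x"
proof -
  obtain a where a: "a \<in> C" "x \<in> closed_simplex a"
    using assms by (auto simp: body_def)
  have x0: "0 \<le> x v" for v
    using a(2) by (simp add: closed_simplex_def)
  have "collar_mass \<nu> C 0 x w = x w" for w
  proof (cases "w \<in> \<nu> ` C")
    case True
    then obtain s where s: "s \<in> C" "w = \<nu> s" by blast
    have "w \<notin> a"
      using True fresh a(1) by blast
    moreover have "gap s (\<lambda>v. 0) = 0"
      using simplexD[OF C(1) s(1)] by (auto simp: gap_def image_constant_conv)
    ultimately show ?thesis
      using s inj a(2) x0 by (simp add: collar_mass_def the_inv_into_f_f closed_simplex_def min_absorb2)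
  qed (use x0 in \<open>simp add: collar_mass_def\<close>)
  then have "collar_mass \<nu> C 0 x = x"
    by blast
  then show ?thesis
    using unit_mass_id[of a x] simplexD[OF C(1) a(1)] a(2) by (simp add: collar_map_def)
qed

lemma continuous_map_collar_map:
  "continuous_map (prod_topology (top_of_set {0..1}) (body_topology C)) (powertop_real UNIV) (\<lambda>z. collar_map \<nu> C (fst z) (snd z))"
  unfolding collar_map_def
proof (rule continuous_map_unit_mass[where V = "\<Union>C \<union> \<nu> ` C"])
  let ?T = "prod_topology (top_of_set {0..1::real}) (body_topology C)"
  have fst: "continuous_map ?T euclideanreal fst"
    by (metis continuous_map_fst continuous_map_into_fulltopology)
  have snd: "continuous_map ?T euclideanreal (\<lambda>z. snd z w)" for w
    using continuous_map_snd[of "top_of_set {0..1::real}" "body_topology C"]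
    unfolding continuous_map_in_subtopology continuous_map_componentwise_UNIV by blast
  have out: "snd z w = 0" if "z \<in> topspace ?T" "w \<notin> \<Union>C" for z w
    using that by (auto simp: body_def closed_simplex_def)
  show "finite (\<Union>C \<union> \<nu> ` C)"
    using C simplexD[OF C(1)] by auto
  show "collar_mass \<nu> C (fst z) (snd z) w = 0" if z: "z \<in> topspace ?T" "w \<notin> \<Union>C \<union> \<nu> ` C" for z w
    using z out[OF z(1), of w] by (auto simp: collar_mass_def)
  show "continuous_map ?T euclideanreal (\<lambda>z. collar_mass \<nu> C (fst z) (snd z) w)" for w
  proof (cases "w \<in> \<nu> ` C")
    case True
    then have t: "the_inv_into C \<nu> w \<in> C"
      using inj the_inv_into_into by fastforce
    have "continuous_map ?T euclideanreal (\<lambda>z. gap (the_inv_into C \<nu> w) (\<lambda>v. min (snd z v) (fst z)))"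
    proof (rule continuous_map_gap[where V = "\<Union>C"])
      show "finite (\<Union>C)"
        using C simplexD[OF C(1)] by auto
      show "min (snd z w) (fst z) = 0" if z: "z \<in> topspace ?T" "w \<notin> \<Union>C" for z w
        using out[OF z] z(1) by auto
      show "continuous_map ?T euclideanreal (\<lambda>z. min (snd z v) (fst z))" for v
        by (intro continuous_map_real_min snd fst)
    qed (use simplexD[OF C(1) t] in auto)
    then show ?thesis
      using True by (simp add: collar_mass_def)
  next
    case False
    have "continuous_map ?T euclideanreal (\<lambda>z. max 0 (snd z w - fst z))"
      by (intro continuous_map_real_max continuous_map_diff snd fst) simp
    then show ?thesis
      using False by (simp add: collar_mass_def)
  qed
  show "0 \<le> collar_mass \<nu> C (fst z) (snd z) w" for z w
    by (rule collar_mass_nonneg)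
  show "\<exists>w. collar_mass \<nu> C (fst z) (snd z) w \<noteq> 0" if z: "z \<in> topspace ?T" for z
  proof -
    have "snd z \<in> body C" "0 \<le> fst z"
      using z by auto
    then obtain b ch where "{w. collar_mass \<nu> C (fst z) (snd z) w \<noteq> 0} = b \<union> \<nu> ` ch" "b \<noteq> {} \<or> ch \<noteq> {}"
      using collar_mass_support[OF C(1) order_refl] by metis
    then show ?thesis
      by blast
  qed
qed

end

section \<open>Mesh and smallness under subdivision\<close>

definition mesh_le :: "'w set set \<Rightarrow> ('w \<Rightarrow> 'v \<Rightarrow> real) \<Rightarrow> real \<Rightarrow> bool" where
  "mesh_le C g \<delta> \<longleftrightarrow> (\<forall>s\<in>C. \<forall>v\<in>s. \<forall>w\<in>s. \<forall>x. \<bar>g v x - g w x\<bar> \<le> \<delta>)"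

text \<open>Over \<open>s\<close> the deviations from the barycentre of \<open>s\<close> cancel. At
  most \<open>card t - 1\<close> of the \<open>card t\<close> deviations over \<open>t\<close>
  remain, each at most \<delta>.\<close>

lemma barycentre_diff:
  assumes t: "finite t" and s: "s \<subseteq> t" "s \<noteq> {}" and d: "\<And>v w. v \<in> t \<Longrightarrow> w \<in> t \<Longrightarrow> \<bar>g v x - g w x\<bar> \<le> \<delta>"
  shows "\<bar>barycentre g t x - barycentre g s x\<bar> \<le> \<delta> * (1 - 1 / real (card t))"
proof -
  let ?b = "barycentre g s x"
  have fs: "finite s"
    using s t finite_subset by blast
  have cs: "0 < real (card s)" and ct: "0 < real (card t)"
    using s t fs by (auto simp: card_gt_0_iff)
  have bs: "(\<Sum>w\<in>s. g w x) = real (card s) * ?b" and bt: "(\<Sum>w\<in>t. g w x) = real (card t) * barycentre g t x"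
    using cs ct by (auto simp: barycentre_def)
  have \<delta>: "0 \<le> \<delta>"
    using d s by fastforce
  have near: "\<bar>g w x - ?b\<bar> \<le> \<delta>" if "w \<in> t" for w
  proof -
    have "real (card s) * \<bar>g w x - ?b\<bar> = \<bar>\<Sum>u\<in>s. g w x - g u x\<bar>"
      using bs cs by (simp add: sum_subtractf abs_mult flip: right_diff_distrib)
    also have "\<dots> \<le> (\<Sum>u\<in>s. \<delta>)"
      by (rule sum_abs[THEN order_trans], rule sum_mono) (use d that s in auto)
    finally show ?thesis
      using cs by simp
  qed
  have "(\<Sum>w\<in>t. g w x - ?b) = (\<Sum>w\<in>t - s. g w x - ?b) + (\<Sum>w\<in>s. g w x - ?b)"
    by (rule sum.subset_diff[OF s(1) t])
  moreover have "(\<Sum>w\<in>s. g w x - ?b) = 0"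
    using bs by (simp add: sum_subtractf)
  ultimately have "real (card t) * (barycentre g t x - ?b) = (\<Sum>w\<in>t - s. g w x - ?b)"
    using bt by (simp add: sum_subtractf[of _ _ t] right_diff_distrib)
  then have "real (card t) * \<bar>barycentre g t x - ?b\<bar> = \<bar>\<Sum>w\<in>t - s. g w x - ?b\<bar>"
    by (metis abs_mult abs_of_nat)
  also have "\<dots> \<le> (\<Sum>w\<in>t - s. \<delta>)"
    by (rule sum_abs[THEN order_trans], rule sum_mono) (use near in auto)
  also have "\<dots> = real (card (t - s)) * \<delta>"
    by simp
  also have "\<dots> \<le> (real (card t) - 1) * \<delta>"
    using card_Diff_subset[OF fs s(1)] cs card_mono[OF t s(1)] \<delta> by (intro mult_right_mono) (auto simp: of_nat_diff)
  finally show ?thesis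
    using ct by (simp add: field_simps)
qed

text \<open>Two vertices of a new simplex are barycentres of nested old ones, so
  \<open>barycentre_diff\<close> applies; for at most \<open>D + 1\<close> vertices its factor is at
  most D / (D + 1).\<close>

lemma mesh_subdivision:
  assumes C: "abstract_simplicial_complex C" "finite C" and card: "\<And>s. s \<in> C \<Longrightarrow> card s \<le> Suc D"
    and g: "\<And>s. s \<in> C \<Longrightarrow> g' (\<nu> s) = barycentre g s" and mesh: "mesh_le C g \<delta>" and d: "0 \<le> \<delta>"
  shows "mesh_le (subdivision \<nu> C) g' (\<delta> * (real D / real (Suc D)))"
proof -
  have main: "\<bar>g' (\<nu> t) x - g' (\<nu> s) x\<bar> \<le> \<delta> * (real D / real (Suc D))" if st: "s \<in> C" "t \<in> C" "s \<subseteq> t" for s t x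
  proof -
    have "\<bar>g' (\<nu> t) x - g' (\<nu> s) x\<bar> \<le> \<delta> * (1 - 1 / real (card t))"
      unfolding g[OF st(1)] g[OF st(2)]
    proof (rule barycentre_diff[OF _ st(3)])
      show "finite t" "s \<noteq> {}"
        using simplexD[OF C(1)] st by auto
      show "\<bar>g v x - g w x\<bar> \<le> \<delta>" if "v \<in> t" "w \<in> t" for v w
        using mesh st(2) that unfolding mesh_le_def by blast
    qed
    also have "\<dots> \<le> \<delta> * (1 - 1 / real (Suc D))"
    proof (intro mult_left_mono d diff_left_mono)
      have "0 < card t"
        using simplexD[OF C(1) st(2)] by (simp add: card_gt_0_iff)
      then show "1 / real (Suc D) \<le> 1 / real (card t)"
        using card[OF st(2)] by (intro frac_le) auto
    qed
    also have "1 - 1 / real (Suc D) = real D / real (Suc D)"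
      by (simp add: field_simps)
    finally show ?thesis .
  qed
  show ?thesis
    unfolding mesh_le_def
  proof (intro ballI allI)
    fix a v w x assume a: "a \<in> subdivision \<nu> C" "v \<in> a" "w \<in> a"
    then obtain ch where ch: "a = \<nu> ` ch" "ch \<subseteq> C" "face_chain ch"
      unfolding subdivision_def by blast
    then obtain s t where "s \<in> ch" "v = \<nu> s" "t \<in> ch" "w = \<nu> t"
      using a by auto
    moreover from this have "s \<subseteq> t \<or> t \<subseteq> s" "s \<in> C" "t \<in> C"
      using ch unfolding face_chain_def by blast+
    ultimately show "\<bar>g' v x - g' w x\<bar> \<le> \<delta> * (real D / real (Suc D))"
      using main[of s t x] main[of t s x] by (auto simp: abs_minus_commute)
  qed
qed

text \<open>The vertices of a collar simplex are vertices of the largest simplex of its chain or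
  barycentres of faces of it, and so stay in the convex set belonging to that simplex. Subdivisions
  are included, being parts of collars.\<close>

lemma small_collar:
  assumes A: "abstract_simplicial_complex A" "finite A" and small: "\<And>s. s \<in> A \<Longrightarrow> small \<U> g s"
    and g: "\<And>w. w \<in> \<Union>A \<Longrightarrow> g' w = g w" "\<And>s. s \<in> A \<Longrightarrow> g' (\<nu> s) = barycentre g s"
    and s: "s \<in> collar \<nu> A"
  shows "small \<U> g' s"
proof -
  obtain b ch where ch: "s = b \<union> \<nu> ` ch" "s \<noteq> {}" "b \<in> A \<or> b = {}" "ch \<subseteq> A" "face_chain ch" "\<forall>s\<in>ch. b \<subseteq> s"
    using s unfolding collar_def by blast
  show ?thesis
  proof (cases "ch = {}")
    case True
    then have "s \<in> A"
      using ch by auto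
    then show ?thesis
      using small[of s] small_cong[of s g' g \<U>] g(1) by blast
  next
    case False
    have "finite ch"
      using ch(4) A(2) finite_subset by blast
    from face_chain_top[OF ch(5) this False] obtain t where t: "t \<in> ch" "\<forall>r\<in>ch. r \<subseteq> t" ..
    have tA: "t \<in> A"
      using t(1) ch(4) by blast
    obtain U Q where Q: "U \<in> \<U>" "Q \<subseteq> U" "segment_closed Q" "g ` t \<subseteq> Q"
      using small[OF tA] unfolding small_def by blast
    have "g' w \<in> Q" if "w \<in> s" for w
    proof (cases "w \<in> b")
      case True
      then have "w \<in> t"
        using ch(6) t(1) by blast
      moreover have "w \<in> \<Union>A"
        using calculation tA by blast
      ultimately show ?thesis
        using g(1)[of w] Q(4) by auto
    next
      case False
      then obtain r where r: "r \<in> ch" "w = \<nu> r"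
        using \<open>w \<in> s\<close> ch(1) by blast
      have rA: "r \<in> A" and rt: "r \<subseteq> t"
        using r ch(4) t(2) by blast+
      have "g ` r \<subseteq> Q"
        using rt Q(4) by blast
      then have "barycentre g r \<in> Q"
        using segment_closed_barycentre[OF Q(3)] simplexD[OF A(1) rA] by blast
      then show ?thesis
        using g(2)[OF rA] r(2) by simp
    qed
    then show ?thesis
      unfolding small_def using Q(1-3) by blast
  qed
qed

text \<open>The convex set is the \<epsilon>-cube around the image of one vertex, cut down to
  \<open>S\<close>; \<epsilon> acts as a Lebesgue number.\<close>

lemma small_of_mesh:
  assumes S: "segment_closed S" and leb: "\<And>x. x \<in> S \<Longrightarrow> \<exists>U\<in>\<U>. {y \<in> S. \<forall>v. \<bar>y v - x v\<bar> \<le> \<epsilon>} \<subseteq> U"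
    and s: "s \<in> C" "s \<noteq> {}" "g ` s \<subseteq> S" and mesh: "mesh_le C g \<epsilon>"
  shows "small \<U> g s"
proof -
  obtain u where u: "u \<in> s"
    using s by blast
  define Q where "Q = {y \<in> S. \<forall>v. \<bar>y v - g u v\<bar> \<le> \<epsilon>}"
  obtain U where U: "U \<in> \<U>" "Q \<subseteq> U"
    using leb[of "g u"] s u unfolding Q_def by blast
  have "segment_closed Q"
    unfolding segment_closed_def
  proof (intro ballI)
    fix x y t assume xy: "x \<in> Q" "y \<in> Q" and t: "t \<in> {0..1::real}"
    have "(\<lambda>v. (1 - t) * x v + t * y v) \<in> S"
      using S xy t unfolding segment_closed_def Q_def by blast
    moreover have "\<bar>(1 - t) * x v + t * y v - g u v\<bar> \<le> \<epsilon>" for v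
    proof -
      have "x v \<le> g u v + \<epsilon>" "y v \<le> g u v + \<epsilon>" "- x v \<le> \<epsilon> - g u v" "- y v \<le> \<epsilon> - g u v"
        using xy by (auto simp: Q_def abs_le_iff algebra_simps)
      then have "(1 - t) * x v + t * y v \<le> g u v + \<epsilon>" "(1 - t) * (- x v) + t * (- y v) \<le> \<epsilon> - g u v"
        using t by (intro convex_bound_le; simp)+
      then show ?thesis
        by (simp add: abs_le_iff)
    qed
    ultimately show "(\<lambda>v. (1 - t) * x v + t * y v) \<in> Q"
      by (simp add: Q_def)
  qed
  moreover have "g ` s \<subseteq> Q"
    using s mesh u unfolding Q_def mesh_le_def by blast
  ultimately show ?thesis
    unfolding small_def using U by blast
qed

section \<open>Pushing null-homotopies through collars\<close>

text \<open>The point \<open>c\<close> must lie in the body even if \<open>Z\<close> is empty: the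
  boundary of a 0-simplex is empty, and \<open>c\<close> then becomes the value of the
  extension.\<close>

definition null_in :: "'z topology \<Rightarrow> 'w set set \<Rightarrow> ('z \<Rightarrow> 'w \<Rightarrow> real) \<Rightarrow> bool" where
  "null_in Z A h \<longleftrightarrow> (\<exists>c\<in>body A. homotopic_with (\<lambda>h. True) Z (body_topology A) h (\<lambda>z. c))"

lemma continuous_map_body_mono: "A \<subseteq> B \<Longrightarrow> continuous_map Z (body_topology A) h \<Longrightarrow> continuous_map Z (body_topology B) h"
  using body_mono[of A B] by (auto simp: continuous_map_in_subtopology)

lemma homotopic_body_mono:
  assumes "A \<subseteq> B" "homotopic_with (\<lambda>h. True) Z (body_topology A) h k"
  shows "homotopic_with (\<lambda>h. True) Z (body_topology B) h k"
proof -
  have "continuous_map (body_topology A) (body_topology B) id"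
    using continuous_map_body_mono[OF assms(1) continuous_map_id] .
  from homotopic_with_compose_continuous_map_left[OF assms(2) this] show ?thesis
    by simp
qed

lemma infinite_inj_into:
  assumes "finite C" "infinite N"
  obtains \<nu> where "inj_on \<nu> C" "\<nu> ` C \<subseteq> N"
proof -
  obtain T where T: "finite T" "card T = card C" "T \<subseteq> N"
    using infinite_arbitrarily_large[OF assms(2)] by blast
  then obtain \<nu> where "bij_betw \<nu> C T"
    using finite_same_card_bij[OF assms(1) T(1)] by auto
  then show thesis
    using that T(3) by (auto simp: bij_betw_def)
qed

lemma complex_Union:
  assumes "\<And>A. A \<in> \<A> \<Longrightarrow> abstract_simplicial_complex A"
  shows "abstract_simplicial_complex (\<Union>\<A>)"
  unfolding abstract_simplicial_complex_def
proof (intro conjI ballI allI impI)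
  fix s assume "s \<in> \<Union>\<A>"
  then obtain A where A: "A \<in> \<A>" "s \<in> A" by blast
  show "finite s" "s \<noteq> {}"
    using simplexD[OF assms[OF A(1)] A(2)] by simp_all
  fix t assume "t \<subseteq> s \<and> t \<noteq> {}"
  then have "t \<in> A"
    using simplex_face[OF assms[OF A(1)] A(2)] by simp
  then show "t \<in> \<Union>\<A>"
    using A(1) by blast
qed

lemma complex_Un: "abstract_simplicial_complex A \<Longrightarrow> abstract_simplicial_complex B \<Longrightarrow> abstract_simplicial_complex (A \<union> B)"
  using complex_Union[of "{A, B}"] by auto

text \<open>The map is formed with all of \<open>C\<close> although only the collar on
  \<open>A\<close> is traversed. So one and the same map at time 1 sends \<open>h\<close> into the
  subdivision of \<open>A\<close> and a null-homotopy in \<open>C\<close> into the subdivision of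
  \<open>C\<close>.\<close>

lemma homotopic_collar_map:
  assumes C: "abstract_simplicial_complex C" "finite C" "inj_on \<nu> C" "\<nu> ` C \<inter> \<Union>C = {}"
    and A: "abstract_simplicial_complex A" "A \<subseteq> C"
    and h: "continuous_map Z (body_topology A) h"
  shows "homotopic_with (\<lambda>h. True) Z (body_topology (collar \<nu> A)) h (collar_map \<nu> C 1 \<circ> h)"
proof -
  let ?I = "top_of_set {0..1::real}"
  have hC: "continuous_map (prod_topology ?I Z) (body_topology C) (h \<circ> snd)"
    using continuous_map_body_mono[OF A(2) h] continuous_map_compose continuous_map_snd by blast
  then have "continuous_map (prod_topology ?I Z) (prod_topology ?I (body_topology C)) (\<lambda>z. (fst z, (h \<circ> snd) z))"
    by (intro continuous_map_pairedI continuous_map_fst)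
  from continuous_map_compose[OF this continuous_map_collar_map[OF C]]
  have "continuous_map (prod_topology ?I Z) (powertop_real UNIV) (\<lambda>z. collar_map \<nu> C (fst z) (h (snd z)))"
    by (simp add: o_def)
  moreover have "collar_map \<nu> C (fst z) (h (snd z)) \<in> body (collar \<nu> A)" if "z \<in> topspace (prod_topology ?I Z)" for z
  proof (rule collar_map_in_collar[OF C A])
    show "h (snd z) \<in> body A"
      using h that by (auto simp: continuous_map_in_subtopology)
  qed (use that in auto)
  ultimately have c: "continuous_map (prod_topology ?I Z) (body_topology (collar \<nu> A)) (\<lambda>z. collar_map \<nu> C (fst z) (h (snd z)))"
    by (auto simp: continuous_map_in_subtopology)
  have h0: "collar_map \<nu> C 0 (h z) = h z" if "z \<in> topspace Z" for z
  proof (rule collar_map_0[OF C])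
    show "h z \<in> body C"
      using h that body_mono[OF A(2)] by (auto simp: continuous_map_in_subtopology)
  qed
  show ?thesis
    by (subst homotopic_with) (use c h0 in \<open>auto intro!: exI[of _ "\<lambda>z. collar_map \<nu> C (fst z) (h (snd z))"]\<close>)
qed

lemma null_in_subdivision:
  assumes C: "abstract_simplicial_complex C" "finite C" "inj_on \<nu> C" "\<nu> ` C \<inter> \<Union>C = {}"
    and h: "null_in Z C h"
  shows "null_in Z (subdivision \<nu> C) (collar_map \<nu> C 1 \<circ> h)"
proof -
  let ?I = "top_of_set {0..1::real}"
  have "continuous_map (body_topology C) (prod_topology ?I (body_topology C)) (\<lambda>x. (1, x))"
    by (intro continuous_map_pairedI) auto
  from continuous_map_compose[OF this continuous_map_collar_map[OF C]]
  have cont: "continuous_map (body_topology C) (body_topology (subdivision \<nu> C)) (collar_map \<nu> C 1)"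
    using collar_map_1_in_subdivision[OF C C(1) order_refl] by (auto simp: continuous_map_in_subtopology o_def)
  obtain c where c: "c \<in> body C" "homotopic_with (\<lambda>h. True) Z (body_topology C) h (\<lambda>z. c)"
    using h unfolding null_in_def by blast
  have "homotopic_with (\<lambda>h. True) Z (body_topology (subdivision \<nu> C)) (collar_map \<nu> C 1 \<circ> h) (collar_map \<nu> C 1 \<circ> (\<lambda>z. c))"
    by (rule homotopic_with_compose_continuous_map_left[OF c(2) cont]) simp
  then show ?thesis
    using collar_map_1_in_subdivision[OF C C(1) order_refl c(1)] unfolding null_in_def o_def by blast
qed

text \<open>Repeatedly subdividing \<open>C\<close> while keeping \<open>A\<close> fixed by means of collars.\<close>

lemma small_filling:
  fixes Z :: "'z topology" and g :: "'w \<Rightarrow> 'v \<Rightarrow> real"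
  assumes S: "segment_closed S" and leb: "\<And>x. x \<in> S \<Longrightarrow> \<exists>U\<in>\<U>. {y \<in> S. \<forall>v. \<bar>y v - x v\<bar> \<le> \<epsilon>} \<subseteq> U"
  assumes "abstract_simplicial_complex C" "finite C" "abstract_simplicial_complex A" "A \<subseteq> C"
    and "\<And>s. s \<in> A \<Longrightarrow> card s \<le> D" "\<And>s. s \<in> C \<Longrightarrow> card s \<le> Suc D" "g ` \<Union>C \<subseteq> S"
    and "\<And>s. s \<in> A \<Longrightarrow> small \<U> g s" "mesh_le C g \<delta>" "0 \<le> \<delta>" "\<delta> * (real D / real (Suc D)) ^ r \<le> \<epsilon>" "infinite M"
  shows "\<exists>A' g'. abstract_simplicial_complex A' \<and> finite A' \<and> A \<subseteq> A' \<and> \<Union>A' \<subseteq> \<Union>C \<union> M \<and>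
    (\<forall>s\<in>A'. card s \<le> Suc D \<and> small \<U> g' s) \<and> g' ` \<Union>A' \<subseteq> S \<and> (\<forall>w\<in>\<Union>A. g' w = g w) \<and>
    (\<forall>h. continuous_map Z (body_topology A) h \<and> null_in Z C h \<longrightarrow> null_in Z A' h)"
  using assms(3-)
proof (induction r arbitrary: A C g \<delta> M)
  \<comment> \<open>The mesh is already within \<epsilon>, so all of \<open>C\<close> is small and
    serves as its own filling.\<close>
  case 0
  have "mesh_le C g \<epsilon>"
    unfolding mesh_le_def
  proof (intro ballI allI)
    fix s v w x assume "s \<in> C" "v \<in> s" "w \<in> s"
    then have "\<bar>g v x - g w x\<bar> \<le> \<delta>"
      using 0(9) unfolding mesh_le_def by blast
    then show "\<bar>g v x - g w x\<bar> \<le> \<epsilon>"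
      using 0(11) by simp
  qed
  have "small \<U> g s" if "s \<in> C" for s
  proof (rule small_of_mesh[OF S leb that])
    show "s \<noteq> {}"
      using simplexD[OF 0(1) that] by simp
    show "g ` s \<subseteq> S"
      using 0(7) that by blast
  qed (use \<open>mesh_le C g \<epsilon>\<close> in simp_all)
  then show ?case
    using 0 by (intro exI[of _ C] exI[of _ g]) auto
next
  case (Suc r)
  note C = Suc.prems(1,2) and A = Suc.prems(3,4) and small = Suc.prems(8)
  have finA: "finite A"
    using A C finite_subset by blast
  \<comment> \<open>The old vertices are removed from the supply of names, which stays infinite and
    can be passed on to the next subdivision.\<close>
  have "infinite (M - \<Union>C)"
    using Suc.prems(12) C simplexD[OF C(1)] by (intro Diff_infinite_finite) auto
  then obtain \<nu> where \<nu>: "inj_on \<nu> C" "\<nu> ` C \<subseteq> M - \<Union>C"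
    using infinite_inj_into[OF C(2)] by blast
  then have fresh: "\<nu> ` C \<inter> \<Union>C = {}"
    by blast
  define g1 where "g1 = (\<lambda>w. if w \<in> \<nu> ` C then barycentre g (the_inv_into C \<nu> w) else g w)"
  have g1: "g1 (\<nu> s) = barycentre g s" if "s \<in> C" for s
    using that \<nu>(1) by (simp add: g1_def the_inv_into_f_f)
  have g1A: "g1 w = g w" if "w \<in> \<Union>A" for w
    using that fresh A(2) by (auto simp: g1_def)
  have vC: "\<Union>(subdivision \<nu> C) \<subseteq> \<nu> ` C"
    unfolding subdivision_def by blast
  \<comment> \<open>The induction hypothesis is used for the pair of subdivisions, so
    \<open>A2\<close> extends the subdivided \<open>A\<close>, not \<open>A\<close> itself.\<close>
  obtain A2 g2 where A2: "abstract_simplicial_complex A2" "finite A2" "subdivision \<nu> A \<subseteq> A2"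
      "\<Union>A2 \<subseteq> \<Union>(subdivision \<nu> C) \<union> (M - \<Union>C)" "\<forall>s\<in>A2. card s \<le> Suc D \<and> small \<U> g2 s" "g2 ` \<Union>A2 \<subseteq> S"
      "\<forall>w\<in>\<Union>(subdivision \<nu> A). g2 w = g1 w"
      "\<forall>h. continuous_map Z (body_topology (subdivision \<nu> A)) h \<and> null_in Z (subdivision \<nu> C) h \<longrightarrow> null_in Z A2 h"
  proof (atomize_elim, rule Suc.IH)
    show "abstract_simplicial_complex (subdivision \<nu> C)" "abstract_simplicial_complex (subdivision \<nu> A)"
      "finite (subdivision \<nu> C)" "subdivision \<nu> A \<subseteq> subdivision \<nu> C"
      using complex_subdivision finite_subdivision subdivision_mono C finA A by blast+
    show "card s \<le> D" if "s \<in> subdivision \<nu> A" for s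
      using card_subdivision[OF A(1) finA Suc.prems(5) that] by blast
    show "card s \<le> Suc D" if "s \<in> subdivision \<nu> C" for s
      using card_subdivision[OF C Suc.prems(6) that] by blast
    show "g1 ` \<Union>(subdivision \<nu> C) \<subseteq> S"
    proof clarify
      fix w a assume "w \<in> a" "a \<in> subdivision \<nu> C"
      then obtain s where s: "s \<in> C" "w = \<nu> s"
        using vC by blast
      have "g ` s \<subseteq> S"
        using s(1) Suc.prems(7) by blast
      then show "g1 w \<in> S"
        using segment_closed_barycentre[OF S] simplexD[OF C(1) s(1)] g1[OF s(1)] s(2) by auto
    qed
    show "small \<U> g1 s" if "s \<in> subdivision \<nu> A" for s
      using small_collar[OF A(1) finA small g1A, of \<nu> s] g1 A(2) that subdivision_subset_collar by blast
    show "mesh_le (subdivision \<nu> C) g1 (\<delta> * (real D / real (Suc D)))"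
      by (rule mesh_subdivision[OF C Suc.prems(6) g1 Suc.prems(9,10)])
    show "0 \<le> \<delta> * (real D / real (Suc D))"
      using Suc.prems(10) by simp
    show "\<delta> * (real D / real (Suc D)) * (real D / real (Suc D)) ^ r \<le> \<epsilon>"
      using Suc.prems(11) by (simp add: mult.assoc)
    show "infinite (M - \<Union>C)" by fact
  qed
  \<comment> \<open>Nothing is known of \<open>g2\<close> on the vertices of \<open>A\<close>, so
    their values are restored; none of these vertices occurs in \<open>A2\<close>.\<close>
  define g' where "g' = (\<lambda>w. if w \<in> \<Union>A then g w else g2 w)"
  have disj: "\<Union>A2 \<inter> \<Union>A = {}"
    using A2(4) vC fresh A(2) by blast
  have g'2: "g' w = g2 w" if "w \<in> \<Union>A2" for w
    using that disj unfolding g'_def by auto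
  have g'\<nu>: "g' (\<nu> s) = barycentre g s" if "s \<in> A" for s
  proof -
    have "\<nu> ` {s} \<in> subdivision \<nu> A"
      using that by (intro subdivisionI) (auto simp: face_chain_def)
    then have "\<nu> s \<in> \<Union>(subdivision \<nu> A)"
      by auto
    moreover from this have "\<nu> s \<in> \<Union>A2"
      using A2(3) by blast
    ultimately show ?thesis
      using g'2 A2(7) g1[of s] A(2) that by auto
  qed
  have g'A: "g' w = g w" if "w \<in> \<Union>A" for w
    using that by (simp add: g'_def)
  \<comment> \<open>The collar leads from \<open>A\<close> to its subdivision, and there
    \<open>A2\<close> takes over.\<close>
  let ?A' = "collar \<nu> A \<union> A2"
  have col: "\<Union>(collar \<nu> A) \<subseteq> \<Union>A \<union> \<nu> ` A"
    unfolding collar_def by blast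
  show ?case
  proof (intro exI[of _ ?A'] exI[of _ g'] conjI)
    show "abstract_simplicial_complex ?A'"
      using complex_Un[OF complex_collar[OF A(1) finA] A2(1)] .
    show "finite ?A'"
      using finite_collar[OF finA A(1)] A2(2) by simp
    show "A \<subseteq> ?A'"
      using subset_collar[OF A(1)] by blast
    show "\<Union>?A' \<subseteq> \<Union>C \<union> M"
      using col A2(4) vC \<nu>(2) A(2) by blast
    show "\<forall>s\<in>?A'. card s \<le> Suc D \<and> small \<U> g' s"
    proof
      fix s assume "s \<in> ?A'"
      then consider "s \<in> collar \<nu> A" | "s \<in> A2" by blast
      then show "card s \<le> Suc D \<and> small \<U> g' s"
      proof cases
        case 1
        then show ?thesis
          using card_collar[OF A(1) finA Suc.prems(5) 1] small_collar[OF A(1) finA small g'A g'\<nu> 1] by blast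
      next
        case 2
        then have "small \<U> g' s \<longleftrightarrow> small \<U> g2 s"
          by (intro small_cong g'2) blast
        then show ?thesis
          using A2(5) 2 by blast
      qed
    qed
    show "g' ` \<Union>?A' \<subseteq> S"
    proof
      fix y assume "y \<in> g' ` \<Union>?A'"
      then obtain w where w: "y = g' w" "w \<in> \<Union>?A'" by blast
      then consider "w \<in> \<Union>A2" | "w \<in> \<Union>A" | "w \<in> \<nu> ` A"
        using col by blast
      then show "y \<in> S"
      proof cases
        case 1
        then show ?thesis using g'2 w(1) A2(6) by auto
      next
        case 2
        then have "w \<in> \<Union>C" using A(2) by blast
        then show ?thesis using g'A[OF 2] w(1) Suc.prems(7) by auto
      next
        case 3
        then obtain s where s: "s \<in> A" "w = \<nu> s" by blast
        have "g ` s \<subseteq> S"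
          using s(1) A(2) Suc.prems(7) by blast
        then show ?thesis
          using segment_closed_barycentre[OF S] simplexD[OF A(1) s(1)] g'\<nu>[OF s(1)] s(2) w(1) by auto
      qed
    qed
    show "\<forall>w\<in>\<Union>A. g' w = g w"
      using g'A by blast
    show "\<forall>h. continuous_map Z (body_topology A) h \<and> null_in Z C h \<longrightarrow> null_in Z ?A' h"
    proof (intro allI impI, elim conjE)
      fix h assume h: "continuous_map Z (body_topology A) h" and null: "null_in Z C h"
      \<comment> \<open>\<open>h\<close> slides through the collar into the subdivision of
        \<open>A\<close> and is then contracted within \<open>A2\<close>.\<close>
      let ?k = "collar_map \<nu> C 1 \<circ> h"
      have hom: "homotopic_with (\<lambda>h. True) Z (body_topology (collar \<nu> A)) h ?k"
        by (rule homotopic_collar_map[OF C \<nu>(1) fresh A h])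
      have "continuous_map Z (body_topology (collar \<nu> A)) ?k"
        using homotopic_with_imp_continuous_maps[OF hom] by blast
      moreover have "?k z \<in> body (subdivision \<nu> A)" if "z \<in> topspace Z" for z
        using collar_map_1_in_subdivision[OF C \<nu>(1) fresh A, of "h z"] h that
        by (auto simp: continuous_map_in_subtopology)
      ultimately have "continuous_map Z (body_topology (subdivision \<nu> A)) ?k"
        by (auto simp: continuous_map_in_subtopology)
      then have "null_in Z A2 ?k"
        using A2(8) null_in_subdivision[OF C \<nu>(1) fresh null] by blast
      then obtain c where c: "c \<in> body A2" "homotopic_with (\<lambda>h. True) Z (body_topology A2) ?k (\<lambda>z. c)"
        unfolding null_in_def by blast
      have "homotopic_with (\<lambda>h. True) Z (body_topology ?A') h (\<lambda>z. c)"
        using homotopic_with_trans[OF homotopic_body_mono[OF _ hom] homotopic_body_mono[OF _ c(2)], of ?A'] by blast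
      moreover have "c \<in> body ?A'"
        using c(1) body_mono[of A2 ?A'] by blast
      ultimately show "null_in Z ?A' h"
        unfolding null_in_def by blast
    qed
  qed
qed

section \<open>Filling a simplex\<close>

text \<open>A closed subset of a power of the unit interval, compact by Tychonoff's theorem.\<close>

lemma compactin_closed_simplex:
  assumes "finite \<sigma>"
  shows "compactin (powertop_real UNIV) (closed_simplex \<sigma>)"
proof (rule closed_compactin)
  show "compactin (powertop_real UNIV) (PiE UNIV (\<lambda>v. {0..1::real}))"
    by (simp add: compactin_PiE)
  show "closed_simplex \<sigma> \<subseteq> PiE UNIV (\<lambda>v. {0..1})"
    using closed_simplex_le_1[OF assms] by (auto simp: closed_simplex_def)
  have coord: "closedin (powertop_real UNIV) {f. f v \<in> S}" if "closed S" for v and S :: "real set"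
    using closedin_continuous_map_preimage[OF continuous_map_product_projection[of v UNIV "\<lambda>_. euclideanreal"], of S] that
    by simp
  have "continuous_map (powertop_real UNIV) euclideanreal (\<lambda>f. sum f \<sigma>)"
    by (intro continuous_map_sum assms continuous_map_product_projection) simp
  then have sum: "closedin (powertop_real UNIV) {f. sum f \<sigma> \<in> {1}}"
    using closedin_continuous_map_preimage[of "powertop_real UNIV" euclideanreal "\<lambda>f. sum f \<sigma>" "{1}"] by simp
  have "closedin (powertop_real UNIV) (\<Inter>v. {f. f v \<in> (if v \<in> \<sigma> then {0..} else {0})})"
    by (intro closedin_INT coord) auto
  then have "closedin (powertop_real UNIV) ((\<Inter>v. {f. f v \<in> (if v \<in> \<sigma> then {0..} else {0})}) \<inter> {f. sum f \<sigma> \<in> {1}})"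
    using sum by (rule closedin_Int)
  moreover have "(\<Inter>v. {f. f v \<in> (if v \<in> \<sigma> then {0..} else {0})}) \<inter> {f. sum f \<sigma> \<in> {1}} = closed_simplex \<sigma>"
    unfolding closed_simplex_def by (auto split: if_splits; metis order_refl)
  ultimately show "closedin (powertop_real UNIV) (closed_simplex \<sigma>)"
    by simp
qed

text \<open>A Lebesgue number for the supremum distance. Basic neighbourhoods in the product
  restrict finitely many coordinates, and closeness in all coordinates is stronger than closeness in
  those; the rest is the usual argument with halved radii and a finite subcover.\<close>

lemma lebesgue_closed_simplex:
  assumes \<sigma>: "finite \<sigma>" and U: "\<And>U. U \<in> \<U> \<Longrightarrow> openin (simplex_topology \<sigma>) (U \<inter> closed_simplex \<sigma>)"
    and cover: "closed_simplex \<sigma> \<subseteq> \<Union>\<U>"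
  obtains \<epsilon> where "0 < \<epsilon>" "\<And>x. x \<in> closed_simplex \<sigma> \<Longrightarrow> \<exists>U\<in>\<U>. {y \<in> closed_simplex \<sigma>. \<forall>v. \<bar>y v - x v\<bar> \<le> \<epsilon>} \<subseteq> U"
proof -
  let ?S = "closed_simplex \<sigma>"
  have "\<exists>F \<delta> U. finite F \<and> 0 < \<delta> \<and> U \<in> \<U> \<and> (\<forall>y\<in>?S. (\<forall>v\<in>F. \<bar>y v - x v\<bar> < 2 * \<delta>) \<longrightarrow> y \<in> U)" if x: "x \<in> ?S" for x
  proof -
    obtain U where U': "U \<in> \<U>" "x \<in> U"
      using cover x by blast
    obtain T where T: "openin (powertop_real UNIV) T" "U \<inter> ?S = T \<inter> ?S"
      using U[OF U'(1)] by (auto simp: openin_subtopology)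
    have xT: "x \<in> T"
      using T U' x by blast
    from bspec[OF T(1)[unfolded openin_product_topology_alt] xT] obtain X where
      X': "finite {i \<in> UNIV. X i \<noteq> topspace euclideanreal} \<and> (\<forall>i\<in>UNIV. openin euclideanreal (X i)) \<and>
        x \<in> PiE UNIV X \<and> PiE UNIV X \<subseteq> T" ..
    then have X: "x \<in> PiE UNIV X" "\<And>i. openin euclideanreal (X i)" "finite {i. X i \<noteq> UNIV}" "PiE UNIV X \<subseteq> T"
      by simp_all
    let ?F = "{i. X i \<noteq> UNIV}"
    have "\<exists>d>0. \<forall>r. \<bar>r - x i\<bar> < d \<longrightarrow> r \<in> X i" for i
      using X(1) X(2)[of i] by (auto simp: open_dist dist_real_def)
    then obtain d where d: "\<And>i. d i > 0" "\<And>i r. \<bar>r - x i\<bar> < d i \<Longrightarrow> r \<in> X i"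
      by metis
    \<comment> \<open>The inserted 1 covers the case that no coordinate is restricted; the factor
      1/2 prepares for the halved radii.\<close>
    define \<delta> where "\<delta> = Min (insert 1 (d ` ?F)) / 2"
    have finF: "finite ?F"
      using X(3) by simp
    have \<delta>: "0 < \<delta>" "2 * \<delta> \<le> d i" if "i \<in> ?F" for i
      using finF d(1) that by (auto simp: \<delta>_def)
    have \<delta>0: "0 < \<delta>"
      using finF d(1) by (auto simp: \<delta>_def)
    have "y \<in> U" if y: "y \<in> ?S" "\<forall>v\<in>?F. \<bar>y v - x v\<bar> < 2 * \<delta>" for y
    proof -
      have "y i \<in> X i" for i
        using y(2) \<delta>(2)[of i] d(2)[of "y i" i] by (cases "i \<in> ?F") fastforce+
      then have "y \<in> T"
        using X(4) by blast
      then show ?thesis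
        using T(2) y(1) by blast
    qed
    then show ?thesis
      using finF \<delta>0 U'(1) by blast
  qed
  then obtain F \<delta> U where FU: "\<And>x. x \<in> ?S \<Longrightarrow> finite (F x) \<and> 0 < \<delta> x \<and> U x \<in> \<U> \<and>
      (\<forall>y\<in>?S. (\<forall>v\<in>F x. \<bar>y v - x v\<bar> < 2 * \<delta> x) \<longrightarrow> y \<in> U x)"
    by metis
  \<comment> \<open>Half the admissible radius: a point \<epsilon>-close to a point of
    \<open>N p\<close> is still within \<open>2 * \<delta> p\<close> of \<open>p\<close>.\<close>
  define N where "N x = (\<Inter>v\<in>F x. {y. y v \<in> {x v - \<delta> x <..< x v + \<delta> x}})" for x
  have coord: "openin (powertop_real UNIV) {f. f v \<in> S}" if "open S" for v and S :: "real set"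
    using openin_continuous_map_preimage[OF continuous_map_product_projection[of v UNIV "\<lambda>_. euclideanreal"], of S] that
    by simp
  have opN: "openin (powertop_real UNIV) (N x)" if "x \<in> ?S" for x
  proof (cases "F x = {}")
    case True
    then have "N x = topspace (powertop_real UNIV)"
      by (simp add: N_def)
    then show ?thesis by (metis openin_topspace)
  next
    case False
    then show ?thesis
      unfolding N_def using FU[OF that] by (intro openin_INT2 coord) auto
  qed
  have "?S \<subseteq> \<Union>(N ` ?S)"
    using FU by (force simp: N_def)
  then obtain \<N> where "finite \<N>" "\<N> \<subseteq> N ` ?S" "?S \<subseteq> \<Union>\<N>"
    using compactinD[OF compactin_closed_simplex[OF \<sigma>], of "N ` ?S"] opN by blast
  then obtain P where P: "finite P" "P \<subseteq> ?S" "?S \<subseteq> \<Union>(N ` P)"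
    by (metis finite_subset_image)
  define \<epsilon> where "\<epsilon> = Min (insert 1 (\<delta> ` P))"
  have \<epsilon>: "0 < \<epsilon>" "\<And>x. x \<in> P \<Longrightarrow> \<epsilon> \<le> \<delta> x"
    using P(1,2) FU by (auto simp: \<epsilon>_def)
  show thesis
  proof (rule that[OF \<epsilon>(1)])
    fix x assume x: "x \<in> ?S"
    then obtain p where p: "p \<in> P" "x \<in> N p"
      using P(3) by blast
    have pS: "p \<in> ?S"
      using p P(2) by blast
    have "y \<in> U p" if y: "y \<in> ?S" "\<forall>v. \<bar>y v - x v\<bar> \<le> \<epsilon>" for y
    proof -
      have "\<bar>y v - p v\<bar> < 2 * \<delta> p" if v: "v \<in> F p" for v
      proof -
        have "x v \<in> {p v - \<delta> p <..< p v + \<delta> p}"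
          using p(2) v unfolding N_def by blast
        moreover have "\<bar>y v - x v\<bar> \<le> \<delta> p"
          using y(2) \<epsilon>(2)[OF p(1)] order_trans by blast
        ultimately show ?thesis
          by (simp add: abs_le_iff abs_less_iff)
      qed
      then show ?thesis
        using FU[OF pS] y(1) by blast
    qed
    then show "\<exists>U\<in>\<U>. {y \<in> ?S. \<forall>v. \<bar>y v - x v\<bar> \<le> \<epsilon>} \<subseteq> U"
      using FU[OF pS] by blast
  qed
qed

section \<open>Cones and extension from the boundary\<close>

definition simplicial_cone :: "'w \<Rightarrow> 'w set set \<Rightarrow> 'w set set" where
  "simplicial_cone c A = A \<union> insert c ` insert {} A"

lemma simplicial_coneE:
  assumes "s \<in> simplicial_cone c A"
  obtains "s \<in> A" | a where "a \<in> A \<or> a = {}" "s = insert c a"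
  using assms unfolding simplicial_cone_def by blast

lemma complex_cone:
  assumes A: "abstract_simplicial_complex A"
  shows "abstract_simplicial_complex (simplicial_cone c A)"
  unfolding abstract_simplicial_complex_def
proof (intro conjI ballI allI impI)
  fix s assume s: "s \<in> simplicial_cone c A"
  then consider "s \<in> A" | a where "a \<in> A \<or> a = {}" "s = insert c a"
    by (rule simplicial_coneE)
  note cases = this
  then show "finite s" "s \<noteq> {}"
    using simplexD[OF A] by (cases, auto)+
  fix t assume t: "t \<subseteq> s \<and> t \<noteq> {}"
  have "t - {c} \<in> A \<or> t - {c} = {}"
    using cases
  proof cases
    case 1
    then show ?thesis
      using simplex_face[OF A 1, of "t - {c}"] t by blast
  next
    case 2
    have "t - {c} \<subseteq> a"
      using 2(2) t by blast
    then show ?thesis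
      using simplex_face[OF A, of a "t - {c}"] 2(1) by blast
  qed
  moreover have "t = insert c (t - {c})" if "c \<in> t"
    using that by blast
  moreover have "t = t - {c}" if "c \<notin> t"
    using that by blast
  ultimately show "t \<in> simplicial_cone c A"
    using t unfolding simplicial_cone_def by (metis UnI1 UnI2 image_eqI insertCI)
qed

text \<open>Each point moves straight to the apex, within the simplex spanned by the apex and a
  simplex of \<open>A\<close>.\<close>

lemma null_in_cone:
  assumes A: "abstract_simplicial_complex A" and c: "c \<notin> \<Union>A" and h: "continuous_map Z (body_topology A) h"
  shows "null_in Z (simplicial_cone c A) h"
proof -
  let ?e = "\<lambda>w. if w = c then 1 else 0 :: real"
  let ?I = "top_of_set {0..1::real}"
  let ?H = "\<lambda>z w. (1 - fst z) * h (snd z) w + fst z * ?e w"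
  have e: "?e \<in> closed_simplex (insert c s)" if "finite s" for s
    using that by (auto simp: closed_simplex_def)
  have "continuous_map (prod_topology ?I Z) (powertop_real UNIV) ?H"
    unfolding continuous_map_componentwise_UNIV
  proof
    fix w
    have "continuous_map (prod_topology ?I Z) (powertop_real UNIV) (h \<circ> snd)"
      using h continuous_map_compose[OF continuous_map_snd] by (auto simp: continuous_map_in_subtopology)
    then have 1: "continuous_map (prod_topology ?I Z) euclideanreal (\<lambda>z. h (snd z) w)"
      by (auto simp: continuous_map_componentwise_UNIV)
    have 2: "continuous_map (prod_topology ?I Z) euclideanreal fst"
      by (metis continuous_map_fst continuous_map_into_fulltopology)
    show "continuous_map (prod_topology ?I Z) euclideanreal (\<lambda>z. ?H z w)"
      by (intro continuous_map_add continuous_map_real_mult continuous_map_diff 1 2 continuous_map_const[THEN iffD2]) auto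
  qed
  moreover have "?H z \<in> body (simplicial_cone c A)" if z: "z \<in> topspace (prod_topology ?I Z)" for z
  proof -
    have "h (snd z) \<in> body A"
      using h z by (auto simp: continuous_map_in_subtopology)
    then obtain a where a: "a \<in> A" "h (snd z) \<in> closed_simplex a"
      by (auto simp: body_def)
    have fa: "finite a"
      using simplexD[OF A a(1)] by simp
    have "c \<notin> a"
      using c a(1) by blast
    then have "h (snd z) \<in> closed_simplex (insert c a)"
      using a(2) fa by (auto simp: closed_simplex_def)
    then have "?H z \<in> closed_simplex (insert c a)"
      using segment_closed_closed_simplex[of "insert c a"] e[OF fa] z unfolding segment_closed_def by auto
    then show ?thesis
      using a(1) unfolding body_def simplicial_cone_def by blast
  qed
  ultimately have "continuous_map (prod_topology ?I Z) (body_topology (simplicial_cone c A)) ?H"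
    by (auto simp: continuous_map_in_subtopology)
  then have "homotopic_with (\<lambda>h. True) Z (body_topology (simplicial_cone c A)) h (\<lambda>z. ?e)"
    unfolding homotopic_with_def by (intro exI[of _ ?H]) auto
  moreover have "?e \<in> body (simplicial_cone c A)"
    using e[of "{}"] unfolding body_def simplicial_cone_def by auto
  ultimately show ?thesis
    unfolding null_in_def by blast
qed

definition simplex_boundary :: "'v set \<Rightarrow> ('v \<Rightarrow> real) set" where
  "simplex_boundary \<sigma> = {x \<in> closed_simplex \<sigma>. \<exists>v\<in>\<sigma>. x v = 0}"

text \<open>Polar coordinates around the barycentre: the homotopy is spread over the outer part of
  the simplex, the constant over the inner part. The hypothesis on \<open>c\<close> gives the value
  when the boundary is empty.\<close>

lemma extend_over_simplex:
  assumes \<sigma>: "finite \<sigma>" "\<sigma> \<noteq> {}" and c: "c \<in> topspace Y"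
    and hom: "homotopic_with (\<lambda>h. True) (subtopology (powertop_real UNIV) (simplex_boundary \<sigma>)) Y f (\<lambda>x. c)"
  obtains f' where "continuous_map (simplex_topology \<sigma>) Y f'"
    "\<And>x. x \<in> simplex_boundary \<sigma> \<Longrightarrow> f' x = f x"
proof -
  let ?I = "top_of_set {0..1::real}"
  let ?T = "simplex_topology \<sigma>"
  let ?B = "subtopology (powertop_real UNIV) (simplex_boundary \<sigma>)"
  obtain H where H: "continuous_map (prod_topology ?I ?B) Y H" "\<And>x. H (0, x) = f x" "\<And>x. H (1, x) = c"
    using hom unfolding homotopic_with_def by blast
  let ?n = "real (card \<sigma>)"
  \<comment> \<open>The depth \<open>card \<sigma> * m x\<close> is 0 on the boundary and 1 at the
    barycentre.\<close>
  define m where "m x = Min (x ` \<sigma>)" for x :: "'a \<Rightarrow> real"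
  \<comment> \<open>Radial projection to the boundary: \<open>x\<close> divides the segment from
    \<open>\<pi> x\<close> to the barycentre in proportion to its depth.\<close>
  define \<pi> where "\<pi> x = (\<lambda>v. if v \<in> \<sigma> then (x v - m x) / (1 - ?n * m x) else 0)" for x
  \<comment> \<open>Ending the homotopy at depth 1/2 keeps the denominator of \<pi> away from
    0.\<close>
  define f' where "f' x = (if ?n * m x \<le> 1/2 then H (2 * (?n * m x), \<pi> x) else c)" for x
  have n: "0 < ?n"
    using \<sigma> by (simp add: card_gt_0_iff)
  have m: "0 \<le> m x" "?n * m x \<le> 1" "\<And>v. v \<in> \<sigma> \<Longrightarrow> m x \<le> x v" "\<exists>v\<in>\<sigma>. x v = m x" if "x \<in> closed_simplex \<sigma>" for x
  proof -
    show le: "m x \<le> x v" if "v \<in> \<sigma>" for v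
      using \<sigma> that by (simp add: m_def)
    show ex: "\<exists>v\<in>\<sigma>. x v = m x"
      using Min_in[of "x ` \<sigma>"] \<sigma> unfolding m_def by fastforce
    then obtain v where "x v = m x" by blast
    moreover have "0 \<le> x v"
      using that by (simp add: closed_simplex_def)
    ultimately show "0 \<le> m x"
      by simp
    have "?n * m x \<le> sum x \<sigma>"
      using sum_bounded_below[of \<sigma> "m x" x] le by simp
    then show "?n * m x \<le> 1"
      using that by (simp add: closed_simplex_def)
  qed
  have \<pi>B: "\<pi> x \<in> simplex_boundary \<sigma>" if x: "x \<in> closed_simplex \<sigma>" "?n * m x \<le> 1/2" for x
  proof -
    have pos: "0 < 1 - ?n * m x"
      using x(2) by simp
    have "sum (\<pi> x) \<sigma> = (\<Sum>v\<in>\<sigma>. x v - m x) / (1 - ?n * m x)"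
      by (simp add: \<pi>_def sum_divide_distrib)
    also have "\<dots> = 1"
      using x(1) pos by (simp add: sum_subtractf closed_simplex_def)
    finally have "sum (\<pi> x) \<sigma> = 1" .
    moreover have "0 \<le> \<pi> x v" for v
      using m(3)[OF x(1)] pos by (simp add: \<pi>_def)
    moreover obtain v where "v \<in> \<sigma>" "x v = m x"
      using m(4)[OF x(1)] by blast
    then have "\<exists>v\<in>\<sigma>. \<pi> x v = 0"
      by (intro bexI[of _ v]) (simp add: \<pi>_def)
    ultimately show ?thesis
      by (simp add: simplex_boundary_def closed_simplex_def \<pi>_def)
  qed
  have cm: "continuous_map (powertop_real UNIV) euclideanreal m"
    unfolding m_def using \<sigma> by (intro continuous_map_Min continuous_map_product_projection) auto
  show thesis
  proof (rule that)
    show "continuous_map ?T Y f'"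
      unfolding f'_def
    proof (rule continuous_map_cases_le)
      show cn: "continuous_map ?T euclideanreal (\<lambda>x. ?n * m x)"
        using cm by (intro continuous_map_real_mult_left continuous_map_from_subtopology)
      let ?C = "subtopology ?T {x \<in> topspace ?T. ?n * m x \<le> 1 / 2}"
      have cmC: "continuous_map ?C euclideanreal m"
        using cm by (intro continuous_map_from_subtopology)
      have "continuous_map ?C ?I (\<lambda>x. 2 * (?n * m x))"
        using cmC m n by (auto simp: continuous_map_in_subtopology intro!: continuous_map_real_mult_left)
      moreover have "continuous_map ?C (powertop_real UNIV) \<pi>"
        unfolding continuous_map_componentwise_UNIV
      proof
        fix v
        show "continuous_map ?C euclideanreal (\<lambda>x. \<pi> x v)"
        proof (cases "v \<in> \<sigma>")
          case True
          have "continuous_map ?C euclideanreal (\<lambda>x. x v)"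
            by (intro continuous_map_from_subtopology continuous_map_product_projection) simp
          then have "continuous_map ?C euclideanreal (\<lambda>x. (x v - m x) / (1 - ?n * m x))"
            using cmC by (intro continuous_map_real_divide continuous_map_diff continuous_map_real_mult_left) auto
          then show ?thesis
            using True by (simp add: \<pi>_def)
        qed (simp add: \<pi>_def)
      qed
      then have "continuous_map ?C ?B \<pi>"
        using \<pi>B by (auto simp: continuous_map_in_subtopology)
      ultimately have "continuous_map ?C (prod_topology ?I ?B) (\<lambda>x. (2 * (?n * m x), \<pi> x))"
        by (rule continuous_map_pairedI)
      from continuous_map_compose[OF this H(1)]
      show "continuous_map ?C Y (\<lambda>x. H (2 * (?n * m x), \<pi> x))"
        by (simp add: o_def)
      show "H (2 * (?n * m x), \<pi> x) = c" if "?n * m x = 1 / 2" for x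
        using H(3) unfolding that by simp
    qed (use c in auto)
    fix x assume x: "x \<in> simplex_boundary \<sigma>"
    then obtain v where v: "x \<in> closed_simplex \<sigma>" "v \<in> \<sigma>" "x v = 0"
      by (auto simp: simplex_boundary_def)
    then have m0: "m x = 0"
      using m(1,3)[OF v(1)] by (metis order_antisym)
    have "\<pi> x = x"
      using v(1) by (auto simp: \<pi>_def m0 closed_simplex_def)
    then show "f' x = f x"
      by (simp add: f'_def m0 H)
  qed
qed

text \<open>In the cone over \<open>A\<close> the map \<open>f\<close> is null-homotopic,
  \<open>small_filling\<close> transfers this to a small complex, and a null-homotopy on the
  boundary amounts to an extension over the simplex.\<close>

lemma fill_simplex:
  fixes g :: "'w \<Rightarrow> 'v \<Rightarrow> real"
  assumes \<sigma>: "finite \<sigma>" "card \<sigma> = Suc D"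
    and U: "\<And>U. U \<in> \<U> \<Longrightarrow> openin (simplex_topology \<sigma>) (U \<inter> closed_simplex \<sigma>)"
    and cover: "closed_simplex \<sigma> \<subseteq> \<Union>\<U>"
    and A: "abstract_simplicial_complex A" "finite A" "\<And>s. s \<in> A \<Longrightarrow> card s \<le> D"
    and small: "\<And>s. s \<in> A \<Longrightarrow> small \<U> g s" and g: "g ` \<Union>A \<subseteq> closed_simplex \<sigma>"
    and M: "infinite M" "M \<inter> \<Union>A = {}"
    and f: "continuous_map (subtopology (powertop_real UNIV) (simplex_boundary \<sigma>)) (body_topology A) f"
  shows "\<exists>A' g' f'. abstract_simplicial_complex A' \<and> finite A' \<and> A \<subseteq> A' \<and> \<Union>A' \<subseteq> \<Union>A \<union> M \<and>
    (\<forall>s\<in>A'. card s \<le> Suc D \<and> small \<U> g' s) \<and> g' ` \<Union>A' \<subseteq> closed_simplex \<sigma> \<and> (\<forall>w\<in>\<Union>A. g' w = g w) \<and>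
    continuous_map (simplex_topology \<sigma>) (body_topology A') f' \<and>
    (\<forall>x\<in>simplex_boundary \<sigma>. f' x = f x)"
proof -
  let ?S = "closed_simplex \<sigma>"
  obtain v where v: "v \<in> \<sigma>"
    using \<sigma> by fastforce
  \<comment> \<open>The image of the apex; any other point of the closed simplex would serve as
    well.\<close>
  define y where "y = (\<lambda>w. if w = v then 1 else 0 :: real)"
  have y: "y \<in> ?S"
    using v \<sigma> by (auto simp: y_def closed_simplex_def)
  obtain c where c: "c \<in> M"
    using M(1) by (metis ex_in_conv finite.emptyI)
  have cA: "c \<notin> \<Union>A"
    using c M(2) by blast
  define g0 where "g0 = g(c := y)"
  have g0: "g0 w = g w" if "w \<in> \<Union>A" for w
    using that cA by (auto simp: g0_def)
  have VC: "\<Union>(simplicial_cone c A) \<subseteq> insert c (\<Union>A)"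
    unfolding simplicial_cone_def by blast
  have g0S: "g0 ` \<Union>(simplicial_cone c A) \<subseteq> ?S"
  proof
    fix z assume "z \<in> g0 ` \<Union>(simplicial_cone c A)"
    then obtain w where w: "z = g0 w" "w \<in> insert c (\<Union>A)"
      using VC by blast
    then show "z \<in> ?S"
      using g y g0[of w] by (cases "w = c") (auto simp: g0_def)
  qed
  obtain \<epsilon> where \<epsilon>: "0 < \<epsilon>" "\<And>x. x \<in> ?S \<Longrightarrow> \<exists>U\<in>\<U>. {y \<in> ?S. \<forall>v. \<bar>y v - x v\<bar> \<le> \<epsilon>} \<subseteq> U"
    using lebesgue_closed_simplex[OF \<sigma>(1) U cover] by blast
  \<comment> \<open>The cone has mesh at most 1 because coordinates lie between 0 and 1;
    \<open>r\<close> subdivisions bring this below \<epsilon>.\<close>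
  obtain r where r: "(real D / real (Suc D)) ^ r < \<epsilon>"
    using real_arch_pow_inv[OF \<epsilon>(1), of "real D / real (Suc D)"] by (auto simp: field_simps)
  let ?Z = "subtopology (powertop_real UNIV) (simplex_boundary \<sigma>)"
  have "\<exists>A' g'. abstract_simplicial_complex A' \<and> finite A' \<and> A \<subseteq> A' \<and> \<Union>A' \<subseteq> \<Union>(simplicial_cone c A) \<union> M \<and>
    (\<forall>s\<in>A'. card s \<le> Suc D \<and> small \<U> g' s) \<and> g' ` \<Union>A' \<subseteq> ?S \<and> (\<forall>w\<in>\<Union>A. g' w = g0 w) \<and>
    (\<forall>h. continuous_map ?Z (body_topology A) h \<and> null_in ?Z (simplicial_cone c A) h \<longrightarrow> null_in ?Z A' h)"
  proof (rule small_filling[OF segment_closed_closed_simplex \<epsilon>(2), where \<delta> = 1 and r = r])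
    show "abstract_simplicial_complex (simplicial_cone c A)"
      by (rule complex_cone[OF A(1)])
    show "finite (simplicial_cone c A)" "A \<subseteq> simplicial_cone c A"
      using A(2) by (auto simp: simplicial_cone_def)
    show "card s \<le> Suc D" if "s \<in> simplicial_cone c A" for s
    proof -
      show ?thesis
        using that
      proof (cases rule: simplicial_coneE)
        case 1
        then show ?thesis using A(3)[of s] by simp
      next
        case (2 a)
        have "card a \<le> D"
          using 2(1) A(3)[of a] by (elim disjE) simp_all
        moreover have "card s \<le> Suc (card a)"
          unfolding 2(2) by (metis card_insert_if card.infinite finite_insert le_SucI order_refl zero_le)
        ultimately show ?thesis by simp
      qed
    qed
    show "small \<U> g0 s" if "s \<in> A" for s
      using small[OF that] small_cong[of s g0 g \<U>] g0 that by blast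
    show "mesh_le (simplicial_cone c A) g0 1"
      unfolding mesh_le_def
    proof (intro ballI allI)
      fix s v w x assume "s \<in> simplicial_cone c A" "v \<in> s" "w \<in> s"
      then have "g0 v \<in> ?S" "g0 w \<in> ?S"
        using g0S by blast+
      then have "0 \<le> g0 v x" "g0 v x \<le> 1" "0 \<le> g0 w x" "g0 w x \<le> 1"
        using closed_simplex_le_1[OF \<sigma>(1)] by (auto simp: closed_simplex_def)
      then show "\<bar>g0 v x - g0 w x\<bar> \<le> 1"
        by linarith
    qed
  qed (use A g0S r M in auto)
  then obtain A' g' where A': "abstract_simplicial_complex A'" "finite A'" "A \<subseteq> A'" "\<Union>A' \<subseteq> \<Union>(simplicial_cone c A) \<union> M"
    "\<forall>s\<in>A'. card s \<le> Suc D \<and> small \<U> g' s" "g' ` \<Union>A' \<subseteq> ?S" "\<forall>w\<in>\<Union>A. g' w = g0 w"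
    "\<forall>h. continuous_map ?Z (body_topology A) h \<and> null_in ?Z (simplicial_cone c A) h \<longrightarrow> null_in ?Z A' h"
    by (elim exE conjE)
  have "null_in ?Z A' f"
    using A'(8) f null_in_cone[OF A(1) cA f] by blast
  then obtain b where b: "b \<in> body A'" "homotopic_with (\<lambda>h. True) ?Z (body_topology A') f (\<lambda>z. b)"
    unfolding null_in_def by blast
  have "\<sigma> \<noteq> {}"
    using v by blast
  moreover have "b \<in> topspace (body_topology A')"
    using b(1) by simp
  ultimately obtain f' where f': "continuous_map (subtopology (powertop_real UNIV) ?S) (body_topology A') f'"
    "\<And>x. x \<in> simplex_boundary \<sigma> \<Longrightarrow> f' x = f x"
    using extend_over_simplex[OF \<sigma>(1) _ _ b(2)] by blast
  have "\<Union>A' \<subseteq> \<Union>A \<union> M"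
    using A'(4) VC c by blast
  moreover have "\<forall>w\<in>\<Union>A. g' w = g w"
    using A'(7) g0 by simp
  ultimately show ?thesis
    using A' f' by (intro exI[of _ A'] exI[of _ g'] exI[of _ f']) simp
qed

section \<open>Small models of a complex\<close>

text \<open>Vertices over a simplex \<open>\<sigma>\<close> of \<open>K\<close> are tagged with \<open>\<sigma>\<close>, so that the fillings of different simplices
  have no vertices in common.\<close>

definition carrier_over ::
  "('v set \<times> nat) set set \<Rightarrow> (('v \<Rightarrow> real) \<Rightarrow> 'v set \<times> nat \<Rightarrow> real) \<Rightarrow> ('v set \<times> nat \<Rightarrow> 'v \<Rightarrow> real) \<Rightarrow>
   'v set \<Rightarrow> ('v set \<times> nat) set set \<Rightarrow> bool" where
  "carrier_over L f g \<sigma> A \<longleftrightarrow> A \<subseteq> L \<and> finite A \<and> abstract_simplicial_complex A \<and> (\<forall>w\<in>\<Union>A. fst w \<subseteq> \<sigma>) \<and>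
     g ` \<Union>A \<subseteq> closed_simplex \<sigma> \<and>
     continuous_map (simplex_topology \<sigma>) (body_topology A) f"

text \<open>\<open>d\<close> counts vertices, so it is one more than a dimension and stage 0 is
  empty. The bound on the tags guarantees that tags with \<open>d + 1\<close> elements are new at
  the next stage.\<close>

definition small_model ::
  "'v set set \<Rightarrow> ('v \<Rightarrow> real) set set \<Rightarrow> nat \<Rightarrow> ('v set \<times> nat) set set \<Rightarrow>
   (('v \<Rightarrow> real) \<Rightarrow> 'v set \<times> nat \<Rightarrow> real) \<Rightarrow> ('v set \<times> nat \<Rightarrow> 'v \<Rightarrow> real) \<Rightarrow> bool" where
  "small_model K \<U> d L f g \<longleftrightarrow> abstract_simplicial_complex L \<and> (\<forall>s\<in>L. card s \<le> d \<and> small \<U> g s) \<and>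
     (\<forall>w\<in>\<Union>L. card (fst w) \<le> d) \<and> (\<forall>\<sigma>\<in>K. card \<sigma> \<le> d \<longrightarrow> (\<exists>A. carrier_over L f g \<sigma> A))"

lemma closed_simplex_mono: "finite \<sigma> \<Longrightarrow> \<tau> \<subseteq> \<sigma> \<Longrightarrow> closed_simplex \<tau> \<subseteq> closed_simplex \<sigma>"
proof
  fix x assume "finite \<sigma>" "\<tau> \<subseteq> \<sigma>" and x: "x \<in> closed_simplex \<tau>"
  moreover have "sum x \<sigma> = sum x \<tau>"
    using calculation by (intro sum.mono_neutral_right) (auto simp: closed_simplex_def)
  ultimately show "x \<in> closed_simplex \<sigma>"
    by (auto simp: closed_simplex_def)
qed

lemma closedin_closed_simplex: "finite \<sigma> \<Longrightarrow> closedin (powertop_real UNIV) (closed_simplex \<sigma>)"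
  by (rule compactin_imp_closedin[OF _ compactin_closed_simplex]) (simp_all add: Hausdorff_space_product_topology)

lemma simplex_boundaryE:
  assumes K: "abstract_simplicial_complex K" "\<sigma> \<in> K" and x: "x \<in> simplex_boundary \<sigma>"
  obtains \<tau> where "\<tau> \<in> K" "\<tau> \<subset> \<sigma>" "x \<in> closed_simplex \<tau>"
proof (rule that[of "{v. x v \<noteq> 0}"])
  have cs: "x \<in> closed_simplex \<sigma>"
    using x by (simp add: simplex_boundary_def)
  note sup = closed_simplex_support[OF K cs]
  show "{v. x v \<noteq> 0} \<in> K" "x \<in> closed_simplex {v. x v \<noteq> 0}"
    using sup by blast+
  show "{v. x v \<noteq> 0} \<subset> \<sigma>"
    using sup(3) x by (auto simp: simplex_boundary_def)
qed

text \<open>The boundary is a union of finitely many closed faces, so continuity on the faces can be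
  pasted.\<close>

lemma continuous_map_boundary:
  assumes K: "abstract_simplicial_complex K" "\<sigma> \<in> K"
    and f: "\<And>\<tau>. \<tau> \<in> K \<Longrightarrow> \<tau> \<subset> \<sigma> \<Longrightarrow> continuous_map (simplex_topology \<tau>) Y f"
  shows "continuous_map (subtopology (powertop_real UNIV) (simplex_boundary \<sigma>)) Y f"
proof (rule pasting_lemma_closed[where I = "{\<tau> \<in> K. \<tau> \<subset> \<sigma>}" and T = closed_simplex and f = "\<lambda>_. f"])
  have fin: "finite \<sigma>"
    using simplexD[OF K] by simp
  then show "finite {\<tau> \<in> K. \<tau> \<subset> \<sigma>}"
    by (rule_tac finite_subset[of _ "Pow \<sigma>"]) auto
  fix \<tau> assume \<tau>: "\<tau> \<in> {\<tau> \<in> K. \<tau> \<subset> \<sigma>}"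
  have "closed_simplex \<tau> \<subseteq> simplex_boundary \<sigma>"
  proof
    fix x assume x: "x \<in> closed_simplex \<tau>"
    then have "x \<in> closed_simplex \<sigma>"
      using closed_simplex_mono[OF fin, of \<tau>] \<tau> by blast
    moreover obtain v where "v \<in> \<sigma>" "v \<notin> \<tau>"
      using \<tau> by blast
    ultimately show "x \<in> simplex_boundary \<sigma>"
      using x by (auto simp: simplex_boundary_def closed_simplex_def)
  qed
  moreover have "finite \<tau>"
    using simplexD[OF K(1)] \<tau> by blast
  ultimately show "closedin (subtopology (powertop_real UNIV) (simplex_boundary \<sigma>)) (closed_simplex \<tau>)"
    by (intro closedin_subset_topspace closedin_closed_simplex)
  have "simplex_boundary \<sigma> \<inter> closed_simplex \<tau> = closed_simplex \<tau>"
    using \<open>closed_simplex \<tau> \<subseteq> _\<close> by blast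
  then show "continuous_map (subtopology (subtopology (powertop_real UNIV) (simplex_boundary \<sigma>)) (closed_simplex \<tau>)) Y f"
    using f[of \<tau>] \<tau> by (simp add: subtopology_subtopology)
next
  fix x assume "x \<in> topspace (subtopology (powertop_real UNIV) (simplex_boundary \<sigma>))"
  then have "x \<in> simplex_boundary \<sigma>"
    by simp
  then obtain \<tau> where "\<tau> \<in> K" "\<tau> \<subset> \<sigma>" "x \<in> closed_simplex \<tau>"
    by (rule simplex_boundaryE[OF K])
  then show "\<exists>j. j \<in> {\<tau> \<in> K. \<tau> \<subset> \<sigma>} \<and> x \<in> closed_simplex j \<and> f x = f x"
    by blast
qed simp

section \<open>Induction over the dimension\<close>

text \<open>The model of the boundary is the union of the carriers of the proper faces. Its tags are
  strictly contained in \<sigma>, so vertices tagged with \<sigma> are fresh. The alternative for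
  each \<open>w\<close> is what allows the fillings over different simplices to be merged.\<close>

lemma fill_over_simplex:
  assumes K: "abstract_simplicial_complex K" and \<sigma>: "\<sigma> \<in> K" "card \<sigma> = Suc d"
    and U: "\<And>U. U \<in> \<U> \<Longrightarrow> openin (realization K) U" and cover: "topspace (realization K) \<subseteq> \<Union>\<U>"
    and sm: "small_model K \<U> d L f g"
  shows "\<exists>A' g' f'. abstract_simplicial_complex A' \<and> finite A' \<and> (\<forall>w\<in>\<Union>A'. w \<in> \<Union>L \<and> g' w = g w \<or> fst w = \<sigma>) \<and>
    (\<forall>w\<in>\<Union>A'. fst w \<subseteq> \<sigma>) \<and> (\<forall>s\<in>A'. card s \<le> Suc d \<and> small \<U> g' s) \<and> g' ` \<Union>A' \<subseteq> closed_simplex \<sigma> \<and>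
    continuous_map (simplex_topology \<sigma>) (body_topology A') f' \<and>
    (\<forall>x\<in>simplex_boundary \<sigma>. f' x = f x)"
proof -
  have L: "abstract_simplicial_complex L" "\<And>s. s \<in> L \<Longrightarrow> card s \<le> d" "\<And>s. s \<in> L \<Longrightarrow> small \<U> g s"
    and car: "\<And>\<tau>. \<tau> \<in> K \<Longrightarrow> card \<tau> \<le> d \<Longrightarrow> \<exists>A. carrier_over L f g \<tau> A"
    using sm unfolding small_model_def by blast+
  have fin: "finite \<sigma>"
    using simplexD[OF K \<sigma>(1)] by simp
  define I where "I = {\<tau> \<in> K. \<tau> \<subset> \<sigma>}"
  have finI: "finite I"
    by (rule finite_subset[of _ "Pow \<sigma>"]) (auto simp: I_def fin)
  have "\<exists>A. carrier_over L f g \<tau> A" if "\<tau> \<in> I" for \<tau>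
  proof (rule car)
    show "\<tau> \<in> K" using that by (simp add: I_def)
    have "card \<tau> < card \<sigma>"
      using that fin by (intro psubset_card_mono) (auto simp: I_def)
    then show "card \<tau> \<le> d" using \<sigma>(2) by simp
  qed
  then obtain Ac where Ac: "\<And>\<tau>. \<tau> \<in> I \<Longrightarrow> carrier_over L f g \<tau> (Ac \<tau>)"
    by metis
  define A where "A = \<Union>(Ac ` I)"
  have AL: "A \<subseteq> L"
    using Ac unfolding A_def carrier_over_def by blast
  have Aw: "fst w \<subset> \<sigma>" if wA: "w \<in> \<Union>A" for w
  proof -
    obtain \<tau> where "\<tau> \<in> I" "w \<in> \<Union>(Ac \<tau>)"
      using wA unfolding A_def by blast
    then have "fst w \<subseteq> \<tau>" "\<tau> \<subset> \<sigma>"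
      using Ac[of \<tau>] unfolding carrier_over_def I_def by blast+
    then show ?thesis by blast
  qed
  have "\<exists>A' g' f'. abstract_simplicial_complex A' \<and> finite A' \<and> A \<subseteq> A' \<and> \<Union>A' \<subseteq> \<Union>A \<union> {\<sigma>} \<times> UNIV \<and>
    (\<forall>s\<in>A'. card s \<le> Suc d \<and> small \<U> g' s) \<and> g' ` \<Union>A' \<subseteq> closed_simplex \<sigma> \<and> (\<forall>w\<in>\<Union>A. g' w = g w) \<and>
    continuous_map (simplex_topology \<sigma>) (body_topology A') f' \<and>
    (\<forall>x\<in>simplex_boundary \<sigma>. f' x = f x)"
  proof (rule fill_simplex[OF fin \<sigma>(2)])
    show "openin (simplex_topology \<sigma>) (U \<inter> closed_simplex \<sigma>)" if "U \<in> \<U>" for U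
      using U[OF that] \<sigma>(1) by (simp add: openin_realization)
    show "closed_simplex \<sigma> \<subseteq> \<Union>\<U>"
      using cover \<sigma>(1) unfolding topspace_realization by blast
    show "abstract_simplicial_complex A"
      unfolding A_def using Ac by (intro complex_Union) (auto simp: carrier_over_def)
    show "finite A"
      unfolding A_def using Ac finI by (auto simp: carrier_over_def)
    show "card s \<le> d" "small \<U> g s" if "s \<in> A" for s
      using L(2,3) that AL by blast+
    show "g ` \<Union>A \<subseteq> closed_simplex \<sigma>"
    proof
      fix y assume "y \<in> g ` \<Union>A"
      then obtain \<tau> where \<tau>: "\<tau> \<in> I" "y \<in> g ` \<Union>(Ac \<tau>)"
        unfolding A_def by blast
      then have "y \<in> closed_simplex \<tau>"
        using Ac[OF \<tau>(1)] unfolding carrier_over_def by blast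
      then show "y \<in> closed_simplex \<sigma>"
        using closed_simplex_mono[OF fin, of \<tau>] \<tau>(1) unfolding I_def by blast
    qed
    show "infinite ({\<sigma>} \<times> (UNIV :: nat set))"
      by (simp add: finite_cartesian_product_iff)
    show "{\<sigma>} \<times> UNIV \<inter> \<Union>A = {}"
      using Aw by fastforce
    show "continuous_map (subtopology (powertop_real UNIV) (simplex_boundary \<sigma>)) (body_topology A) f"
    proof (rule continuous_map_boundary[OF K \<sigma>(1)])
      fix \<tau> assume "\<tau> \<in> K" "\<tau> \<subset> \<sigma>"
      then have "\<tau> \<in> I" by (simp add: I_def)
      then have "continuous_map (simplex_topology \<tau>) (body_topology (Ac \<tau>)) f" "Ac \<tau> \<subseteq> A"
        using Ac[of \<tau>] unfolding carrier_over_def A_def by blast+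
      then show "continuous_map (simplex_topology \<tau>) (body_topology A) f"
        using continuous_map_body_mono by blast
    qed
  qed
  then obtain A' g' f' where A': "abstract_simplicial_complex A'" "finite A'" "A \<subseteq> A'" "\<Union>A' \<subseteq> \<Union>A \<union> {\<sigma>} \<times> UNIV"
    "\<forall>s\<in>A'. card s \<le> Suc d \<and> small \<U> g' s" "g' ` \<Union>A' \<subseteq> closed_simplex \<sigma>" "\<forall>w\<in>\<Union>A. g' w = g w"
    "continuous_map (simplex_topology \<sigma>) (body_topology A') f'"
    "\<forall>x\<in>simplex_boundary \<sigma>. f' x = f x"
    by (elim exE conjE)
  have w: "(w \<in> \<Union>L \<and> g' w = g w \<or> fst w = \<sigma>) \<and> fst w \<subseteq> \<sigma>" if "w \<in> \<Union>A'" for w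
  proof -
    have "w \<in> \<Union>A \<union> {\<sigma>} \<times> UNIV"
      using A'(4) that by (rule subsetD)
    then consider "w \<in> \<Union>A" | "fst w = \<sigma>"
      by (metis UnE mem_Times_iff singletonD)
    then show ?thesis
    proof cases
      case 1
      then have "w \<in> \<Union>L" using AL by blast
      then show ?thesis using 1 Aw[OF 1] A'(7) by blast
    qed simp
  qed
  show ?thesis
    using A' w by (intro exI[of _ A'] exI[of _ g'] exI[of _ f']) blast
qed

lemma small_model_Suc:
  assumes K: "abstract_simplicial_complex K"
    and U: "\<And>U. U \<in> \<U> \<Longrightarrow> openin (realization K) U" and cover: "topspace (realization K) \<subseteq> \<Union>\<U>"
    and sm: "small_model K \<U> d L f g"
  shows "\<exists>L' f' g'. small_model K \<U> (Suc d) L' f' g'"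
proof -
  have L: "abstract_simplicial_complex L" "\<And>s. s \<in> L \<Longrightarrow> card s \<le> d" "\<And>s. s \<in> L \<Longrightarrow> small \<U> g s"
    "\<And>w. w \<in> \<Union>L \<Longrightarrow> card (fst w) \<le> d"
    and car: "\<And>\<tau>. \<tau> \<in> K \<Longrightarrow> card \<tau> \<le> d \<Longrightarrow> \<exists>A. carrier_over L f g \<tau> A"
    using sm unfolding small_model_def by blast+
  define J where "J = {\<sigma> \<in> K. card \<sigma> = Suc d}"
  have finJ: "finite \<sigma>" "card \<sigma> = Suc d" "\<sigma> \<in> K" if "\<sigma> \<in> J" for \<sigma>
    using simplexD[OF K] that by (auto simp: J_def)
  let ?P = "\<lambda>\<sigma> A' g' f'. abstract_simplicial_complex A' \<and> finite A' \<and> (\<forall>w\<in>\<Union>A'. w \<in> \<Union>L \<and> g' w = g w \<or> fst w = \<sigma>) \<and>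
    (\<forall>w\<in>\<Union>A'. fst w \<subseteq> \<sigma>) \<and> (\<forall>s\<in>A'. card s \<le> Suc d \<and> small \<U> g' s) \<and> g' ` \<Union>A' \<subseteq> closed_simplex \<sigma> \<and>
    continuous_map (simplex_topology \<sigma>) (body_topology A') f' \<and>
    (\<forall>x\<in>simplex_boundary \<sigma>. f' x = f x)"
  have "\<forall>\<sigma>. \<exists>A' g' f'. \<sigma> \<in> J \<longrightarrow> ?P \<sigma> A' g' f'"
  proof
    fix \<sigma>
    show "\<exists>A' g' f'. \<sigma> \<in> J \<longrightarrow> ?P \<sigma> A' g' f'"
    proof (cases "\<sigma> \<in> J")
      case True
      have "\<exists>A' g' f'. ?P \<sigma> A' g' f'"
        by (rule fill_over_simplex[OF K finJ(3)[OF True] finJ(2)[OF True] U cover sm])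
      then obtain A' g' f' where "?P \<sigma> A' g' f'" by (elim exE)
      then have "\<sigma> \<in> J \<longrightarrow> ?P \<sigma> A' g' f'" ..
      then show ?thesis by (rule_tac exI)+
    qed simp
  qed
  from choice[OF this] obtain As where "\<forall>\<sigma>. \<exists>g' f'. \<sigma> \<in> J \<longrightarrow> ?P \<sigma> (As \<sigma>) g' f'" ..
  from choice[OF this] obtain gs where "\<forall>\<sigma>. \<exists>f'. \<sigma> \<in> J \<longrightarrow> ?P \<sigma> (As \<sigma>) (gs \<sigma>) f'" ..
  from choice[OF this] obtain fs where fs: "\<forall>\<sigma>. \<sigma> \<in> J \<longrightarrow> ?P \<sigma> (As \<sigma>) (gs \<sigma>) (fs \<sigma>)" ..
  have As: "abstract_simplicial_complex (As \<sigma>)" "finite (As \<sigma>)"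
      "\<And>w. w \<in> \<Union>(As \<sigma>) \<Longrightarrow> w \<in> \<Union>L \<and> gs \<sigma> w = g w \<or> fst w = \<sigma>" "\<And>w. w \<in> \<Union>(As \<sigma>) \<Longrightarrow> fst w \<subseteq> \<sigma>"
      "\<And>s. s \<in> As \<sigma> \<Longrightarrow> card s \<le> Suc d \<and> small \<U> (gs \<sigma>) s" "gs \<sigma> ` \<Union>(As \<sigma>) \<subseteq> closed_simplex \<sigma>"
      "continuous_map (simplex_topology \<sigma>) (body_topology (As \<sigma>)) (fs \<sigma>)"
      "\<And>x. x \<in> simplex_boundary \<sigma> \<Longrightarrow> fs \<sigma> x = f x" if "\<sigma> \<in> J" for \<sigma>
    using spec[OF fs, of \<sigma>] that by blast+
  define L' where "L' = \<Union>(insert L (As ` J))"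
  \<comment> \<open>A vertex is either old or tagged with one new simplex, so its tag tells which
    filling determines its value.\<close>
  define g' where "g' w = (if fst w \<in> J then gs (fst w) w else g w)" for w
  \<comment> \<open>A support in \<open>J\<close> marks an interior point of a new simplex. Boundary
    points have smaller support, where \<open>f\<close> is kept and every filling agrees with
    it.\<close>
  define f' where "f' x = (if {v. x v \<noteq> 0} \<in> J then fs {v. x v \<noteq> 0} x else f x)" for x
  have g'L: "g' w = g w" if "w \<in> \<Union>L" for w
    using L(4)[OF that] by (simp add: g'_def J_def)
  have g'A: "g' w = gs \<sigma> w" if "\<sigma> \<in> J" "w \<in> \<Union>(As \<sigma>)" for \<sigma> w
    using As(3)[OF that]
  proof (elim disjE conjE)
    assume "w \<in> \<Union>L" "gs \<sigma> w = g w"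
    then show ?thesis using g'L by simp
  qed (use that(1) in \<open>simp add: g'_def\<close>)
  have "small_model K \<U> (Suc d) L' f' g'"
    unfolding small_model_def
  proof (intro conjI ballI impI)
    show "abstract_simplicial_complex L'"
      unfolding L'_def using L(1) As(1) by (intro complex_Union) auto
  next
    fix s assume "s \<in> L'"
    then consider "s \<in> L" | \<sigma> where "\<sigma> \<in> J" "s \<in> As \<sigma>"
      unfolding L'_def by blast
    then have "card s \<le> Suc d \<and> small \<U> g' s"
    proof cases
      case 1
      then have "small \<U> g' s \<longleftrightarrow> small \<U> g s"
        by (intro small_cong g'L) blast
      then show ?thesis using L(2,3)[OF 1] by simp
    next
      case 2
      then have "small \<U> g' s \<longleftrightarrow> small \<U> (gs \<sigma>) s"
        by (intro small_cong g'A; blast)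
      then show ?thesis using As(5)[OF 2] by simp
    qed
    then show "card s \<le> Suc d" "small \<U> g' s" by blast+
  next
    fix w assume "w \<in> \<Union>L'"
    then consider "w \<in> \<Union>L" | \<sigma> where "\<sigma> \<in> J" "w \<in> \<Union>(As \<sigma>)"
      unfolding L'_def by blast
    then show "card (fst w) \<le> Suc d"
    proof cases
      case 1
      then show ?thesis using L(4)[OF 1] by simp
    next
      case 2
      then show ?thesis using card_mono[OF finJ(1)[OF 2(1)] As(4)[OF 2]] finJ(2)[OF 2(1)] by simp
    qed
  next
    fix \<sigma> assume \<sigma>: "\<sigma> \<in> K" "card \<sigma> \<le> Suc d"
    have fin: "finite \<sigma>"
      using simplexD[OF K \<sigma>(1)] by simp
    show "\<exists>A. carrier_over L' f' g' \<sigma> A"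
    proof (cases "card \<sigma> = Suc d")
      case True
      then have J: "\<sigma> \<in> J"
        using \<sigma> by (simp add: J_def)
      have "fs \<sigma> x = f' x" if x: "x \<in> closed_simplex \<sigma>" for x
      proof (cases "{v. x v \<noteq> 0} = \<sigma>")
        case True
        then show ?thesis using J by (simp add: f'_def)
      next
        case False
        then have sub: "{v. x v \<noteq> 0} \<subset> \<sigma>"
          using closed_simplex_support(3)[OF K \<sigma>(1) x] by blast
        then have "card {v. x v \<noteq> 0} < card \<sigma>"
          by (rule psubset_card_mono[OF fin])
        then have "{v. x v \<noteq> 0} \<notin> J"
          using True by (auto simp: J_def)
        moreover have "x \<in> simplex_boundary \<sigma>"
          using sub x by (auto simp: simplex_boundary_def)
        ultimately show ?thesis
          using As(8)[OF J] by (simp add: f'_def)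
      qed
      then have "continuous_map (simplex_topology \<sigma>) (body_topology (As \<sigma>)) f'"
        by (intro continuous_map_eq[OF As(7)[OF J]]) simp
      moreover have "g' ` \<Union>(As \<sigma>) = gs \<sigma> ` \<Union>(As \<sigma>)"
        by (intro image_cong g'A J refl)
      moreover have "As \<sigma> \<subseteq> L'"
        using J unfolding L'_def by blast
      ultimately have "carrier_over L' f' g' \<sigma> (As \<sigma>)"
        unfolding carrier_over_def using As(1,2,4,6)[OF J] by simp
      then show ?thesis by blast
    next
      case False
      then have "card \<sigma> \<le> d"
        using \<sigma>(2) by simp
      then obtain A where A: "carrier_over L f g \<sigma> A"
        using car[OF \<sigma>(1)] by blast
      have A': "A \<subseteq> L" "finite A" "abstract_simplicial_complex A" "\<forall>w\<in>\<Union>A. fst w \<subseteq> \<sigma>" "g ` \<Union>A \<subseteq> closed_simplex \<sigma>"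
        "continuous_map (simplex_topology \<sigma>) (body_topology A) f"
        using A unfolding carrier_over_def by simp_all
      have "f x = f' x" if x: "x \<in> closed_simplex \<sigma>" for x
      proof -
        have "card {v. x v \<noteq> 0} \<le> card \<sigma>"
          using closed_simplex_support(3)[OF K \<sigma>(1) x] fin by (rule card_mono[rotated])
        then have "{v. x v \<noteq> 0} \<notin> J"
          using \<open>card \<sigma> \<le> d\<close> by (auto simp: J_def)
        then show ?thesis by (simp add: f'_def)
      qed
      then have "continuous_map (simplex_topology \<sigma>) (body_topology A) f'"
        by (intro continuous_map_eq[OF A'(6)]) simp
      moreover have "g' ` \<Union>A = g ` \<Union>A"
      proof (rule image_cong[OF refl])
        show "g' w = g w" if "w \<in> \<Union>A" for w
          using g'L[of w] A'(1) that by blast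
      qed
      moreover have "A \<subseteq> L'"
        using A'(1) unfolding L'_def by blast
      ultimately have "carrier_over L' f' g' \<sigma> A"
        unfolding carrier_over_def using A'(2-5) by simp
      then show ?thesis by blast
    qed
  qed
  then show ?thesis by blast
qed

lemma ex_small_model:
  assumes K: "abstract_simplicial_complex K"
    and U: "\<And>U. U \<in> \<U> \<Longrightarrow> openin (realization K) U" and cover: "topspace (realization K) \<subseteq> \<Union>\<U>"
  shows "\<exists>L f g. small_model K \<U> d L f g"
proof (induction d)
  case 0
  \<comment> \<open>Simplices are non-empty, so at stage 0 none of them requires a carrier.\<close>
  have "small_model K \<U> 0 {} f g" for f g
    using simplexD[OF K] by (auto simp: small_model_def abstract_simplicial_complex_def)
  then show ?case by blast
next
  case (Suc d)
  then show ?case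
    using small_model_Suc[OF K U cover] by blast
qed

section \<open>Homotopies on the realization\<close>

lemma continuous_map_closed_simplex_realization:
  assumes "\<sigma> \<in> K"
  shows "continuous_map (simplex_topology \<sigma>) (realization K) id"
  unfolding continuous_map_def
proof (intro conjI allI impI)
  show "id \<in> topspace (simplex_topology \<sigma>) \<rightarrow> topspace (realization K)"
    using assms by (auto simp: topspace_realization)
  fix U assume "openin (realization K) U"
  then have "openin (simplex_topology \<sigma>) (U \<inter> closed_simplex \<sigma>)"
    using assms by (simp add: openin_realization)
  moreover have "{x \<in> topspace (simplex_topology \<sigma>). id x \<in> U} = U \<inter> closed_simplex \<sigma>"
    by auto
  ultimately show "openin (simplex_topology \<sigma>)
      {x \<in> topspace (simplex_topology \<sigma>). id x \<in> U}"
    by simp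
qed

text \<open>Maps out of a weak topology are tested on simplices, but this does not pass to products
  in general. Here the other factor is an interval, and its local compactness helps through the tube
  lemma.\<close>

lemma continuous_map_realization_homotopy:
  fixes h :: "real \<times> ('v \<Rightarrow> real) \<Rightarrow> 'y"
  assumes W: "openin (realization K) W"
    and h: "\<And>\<sigma>. \<sigma> \<in> K \<Longrightarrow> continuous_map (prod_topology (top_of_set {0..1})
        (subtopology (powertop_real UNIV) (W \<inter> closed_simplex \<sigma>))) Y h"
  shows "continuous_map (prod_topology (top_of_set {0..1}) (subtopology (realization K) W)) Y h"
proof -
  let ?I = "top_of_set {0..1::real}"
  let ?T = simplex_topology
  let ?TW = "\<lambda>\<sigma>. subtopology (powertop_real UNIV) (W \<inter> closed_simplex \<sigma>)"
  have W\<sigma>: "openin (?T \<sigma>) (W \<inter> closed_simplex \<sigma>)" if "\<sigma> \<in> K" for \<sigma>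
    using W that by (simp add: openin_realization)
  have WK: "\<exists>\<sigma>\<in>K. x \<in> closed_simplex \<sigma>" if "x \<in> W" for x
    using openin_subset[OF W] that by (auto simp: topspace_realization)
  have "topspace (subtopology (realization K) W) = W"
    using openin_subset[OF W] by auto
  then have tX: "topspace (prod_topology ?I (subtopology (realization K) W)) = {0..1} \<times> W"
    by (simp only: topspace_prod_topology) simp
  show ?thesis
    unfolding continuous_map_def
  proof (intro conjI allI impI)
    show "h \<in> topspace (prod_topology ?I (subtopology (realization K) W)) \<rightarrow> topspace Y"
    proof
      fix z assume "z \<in> topspace (prod_topology ?I (subtopology (realization K) W))"
      then have z: "fst z \<in> {0..1}" "snd z \<in> W"
        unfolding tX by (simp_all add: mem_Times_iff)
      obtain \<sigma> where "\<sigma> \<in> K" "snd z \<in> closed_simplex \<sigma>"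
        using WK[OF z(2)] by blast
      then have "z \<in> topspace (prod_topology ?I (?TW \<sigma>))"
        using z by (simp add: mem_Times_iff)
      then show "h z \<in> topspace Y"
        using continuous_map_funspace[OF h[OF \<open>\<sigma> \<in> K\<close>]] by (rule funcset_mem[rotated])
    qed
    fix V assume V: "openin Y V"
    let ?S = "{z \<in> topspace (prod_topology ?I (subtopology (realization K) W)). h z \<in> V}"
    have S\<sigma>: "openin (prod_topology ?I (?TW \<sigma>)) {z \<in> {0..1} \<times> (W \<inter> closed_simplex \<sigma>). h z \<in> V}" if "\<sigma> \<in> K" for \<sigma>
      using openin_continuous_map_preimage[OF h[OF that] V] by simp
    have S: "?S = {z \<in> {0..1} \<times> W. h z \<in> V}"
      unfolding tX ..
    have "\<exists>J O'. openin ?I J \<and> openin (subtopology (realization K) W) O' \<and> t \<in> J \<and> x \<in> O' \<and> J \<times> O' \<subseteq> ?S"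
      if tx: "(t, x) \<in> ?S" for t x
    proof -
      have t: "t \<in> {0..1}" and x: "x \<in> W" and hV: "h (t, x) \<in> V"
        using tx unfolding S by auto
      obtain \<sigma>0 where \<sigma>0: "\<sigma>0 \<in> K" "x \<in> closed_simplex \<sigma>0"
        using WK[OF x] by blast
      have "continuous_map ?I (prod_topology ?I (?TW \<sigma>0)) (\<lambda>s. (s, x))"
        using x \<sigma>0 by (intro continuous_map_pairedI) auto
      from openin_continuous_map_preimage[OF continuous_map_compose[OF this h[OF \<sigma>0(1)]] V]
      have "openin ?I {s \<in> {0..1}. h (s, x) \<in> V}"
        by simp
      then obtain d where d: "d > 0" "\<And>s. s \<in> {0..1} \<Longrightarrow> \<bar>s - t\<bar> < d \<Longrightarrow> h (s, x) \<in> V"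
        using t hV unfolding openin_euclidean_subtopology_iff by (auto simp: dist_real_def)
      \<comment> \<open>Closed, hence compact for the tube lemma, and of radius d/2 to stay within
        distance \<open>d\<close>; its open core becomes the neighbourhood of
        \<open>t\<close>.\<close>
      define J where "J = {0..1} \<inter> {t - d/2 .. t + d/2}"
      \<comment> \<open>All points over which the whole of \<open>J\<close> is mapped into
        \<open>V\<close>; its openness can be tested in one simplex at a time.\<close>
      define O' where "O' = {y \<in> W. \<forall>s\<in>J. h (s, y) \<in> V}"
      have J: "compactin ?I J"
        by (simp add: compactin_subtopology J_def)
      have hJ: "h (s, x) \<in> V" if s: "s \<in> J" for s
      proof (rule d(2))
        show "\<bar>s - t\<bar> < d"
          using s d(1) by (auto simp: J_def abs_less_iff)
      qed (use s in \<open>simp add: J_def\<close>)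
      have "openin (realization K) O'"
        unfolding openin_realization
      proof (intro conjI ballI)
        show "O' \<subseteq> (\<Union>s\<in>K. closed_simplex s)"
          using WK by (auto simp: O'_def)
        fix \<sigma> assume \<sigma>: "\<sigma> \<in> K"
        show "openin (?T \<sigma>) (O' \<inter> closed_simplex \<sigma>)"
        proof (subst openin_subopen, intro ballI)
          fix y assume y: "y \<in> O' \<inter> closed_simplex \<sigma>"
          have "\<exists>A B. openin ?I A \<and> openin (?TW \<sigma>) B \<and> J \<subseteq> A \<and> y \<in> B \<and> A \<times> B \<subseteq> {z \<in> {0..1} \<times> (W \<inter> closed_simplex \<sigma>). h z \<in> V}"
          proof (rule tube_lemma_left[OF S\<sigma>[OF \<sigma>] J])
            show "y \<in> topspace (?TW \<sigma>)"
              using y by (simp add: O'_def)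
            show "J \<times> {y} \<subseteq> {z \<in> {0..1} \<times> (W \<inter> closed_simplex \<sigma>). h z \<in> V}"
              using y by (auto simp: O'_def J_def)
          qed
          then obtain A B where AB: "openin (?TW \<sigma>) B" "J \<subseteq> A" "y \<in> B" "A \<times> B \<subseteq> {z \<in> {0..1} \<times> (W \<inter> closed_simplex \<sigma>). h z \<in> V}"
            by blast
          have "openin (subtopology (?T \<sigma>) (W \<inter> closed_simplex \<sigma>)) B"
            using AB(1) by (simp add: subtopology_subtopology inf.absorb2)
          then have "openin (?T \<sigma>) B"
            using W\<sigma>[OF \<sigma>] openin_trans_full by blast
          moreover have "B \<subseteq> O' \<inter> closed_simplex \<sigma>"
          proof
            fix y' assume y': "y' \<in> B"
            have "B \<subseteq> W \<inter> closed_simplex \<sigma>"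
              using openin_subset[OF AB(1)] by simp
            moreover have "h (s, y') \<in> V" if "s \<in> J" for s
              using AB(2,4) that y' by blast
            ultimately show "y' \<in> O' \<inter> closed_simplex \<sigma>"
              using y' by (auto simp: O'_def)
          qed
          ultimately show "\<exists>T. openin (?T \<sigma>) T \<and> y \<in> T \<and> T \<subseteq> O' \<inter> closed_simplex \<sigma>"
            using AB(3) by blast
        qed
      qed
      then have "openin (subtopology (realization K) W) O'"
        by (simp add: openin_open_subtopology[OF W] O'_def)
      moreover have "openin ?I ({0..1} \<inter> {t - d/2 <..< t + d/2})"
        by (simp add: openin_open_Int)
      moreover have "x \<in> O'"
        using x hJ by (simp add: O'_def)
      moreover have "({0..1} \<inter> {t - d/2 <..< t + d/2}) \<times> O' \<subseteq> ?S"
        unfolding S by (auto simp: O'_def J_def)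
      ultimately show ?thesis
        using t d(1) by (intro exI[of _ "{0..1} \<inter> {t - d/2 <..< t + d/2}"] exI[of _ O']) auto
    qed
    then show "openin (prod_topology ?I (subtopology (realization K) W)) ?S"
      unfolding openin_prod_topology_alt by blast
  qed
qed

text \<open>For homotopies whose formula changes from piece to piece: each simplex is cut into
  finitely many closed pieces.\<close>

lemma continuous_map_realization_pieces:
  fixes h :: "real \<times> ('v \<Rightarrow> real) \<Rightarrow> 'y" and D :: "'v set \<Rightarrow> 'i \<Rightarrow> ('v \<Rightarrow> real) set"
  assumes W: "openin (realization K) W"
    and fin: "\<And>\<sigma>. \<sigma> \<in> K \<Longrightarrow> finite (I \<sigma>)"
    and cover: "\<And>\<sigma>. \<sigma> \<in> K \<Longrightarrow> W \<inter> closed_simplex \<sigma> \<subseteq> (\<Union>i\<in>I \<sigma>. D \<sigma> i)"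
    and clo: "\<And>\<sigma> i. \<sigma> \<in> K \<Longrightarrow> i \<in> I \<sigma> \<Longrightarrow> closedin (subtopology (powertop_real UNIV) (W \<inter> closed_simplex \<sigma>)) (D \<sigma> i)"
    and h: "\<And>\<sigma> i. \<sigma> \<in> K \<Longrightarrow> i \<in> I \<sigma> \<Longrightarrow> continuous_map (prod_topology (top_of_set {0..1}) (subtopology (powertop_real UNIV) (D \<sigma> i))) Y h"
  shows "continuous_map (prod_topology (top_of_set {0..1}) (subtopology (realization K) W)) Y h"
proof (rule continuous_map_realization_homotopy[OF W])
  fix \<sigma> assume \<sigma>: "\<sigma> \<in> K"
  let ?I = "top_of_set {0..1::real}"
  let ?T = "subtopology (powertop_real UNIV) (W \<inter> closed_simplex \<sigma>)"
  show "continuous_map (prod_topology ?I ?T) Y h"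
  proof (rule pasting_lemma_closed[where I = "I \<sigma>" and T = "\<lambda>i. {0..1} \<times> D \<sigma> i" and f = "\<lambda>_. h"])
    show "finite (I \<sigma>)" by (rule fin[OF \<sigma>])
    fix i assume i: "i \<in> I \<sigma>"
    show "closedin (prod_topology ?I ?T) ({0..1} \<times> D \<sigma> i)"
      using clo[OF \<sigma> i] by (auto simp: closedin_prod_Times_iff)
    have "D \<sigma> i \<subseteq> W \<inter> closed_simplex \<sigma>"
      using closedin_subset[OF clo[OF \<sigma> i]] by simp
    then show "continuous_map (subtopology (prod_topology ?I ?T) ({0..1} \<times> D \<sigma> i)) Y h"
      using h[OF \<sigma> i] by (simp add: subtopology_Times subtopology_subtopology inf.absorb2)
  next
    fix z assume "z \<in> topspace (prod_topology ?I ?T)"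
    then show "\<exists>j. j \<in> I \<sigma> \<and> z \<in> {0..1} \<times> D \<sigma> j \<and> h z = h z"
      using cover[OF \<sigma>] by (auto simp: mem_Times_iff)
  qed simp
qed

section \<open>The categorical cover\<close>

text \<open>\<open>P\<close> and \<open>q\<close> stand for the universal covering of the
  realization and its projection, \<open>e i\<close> for a section over \<open>U i\<close>, and
  \<open>p0\<close> for the point to which everything is contracted.\<close>

context
  fixes K :: "'v set set" and n k :: nat and U :: "nat \<Rightarrow> ('v \<Rightarrow> real) set"
    and P :: "'p topology" and q :: "'p \<Rightarrow> 'v \<Rightarrow> real" and e :: "nat \<Rightarrow> ('v \<Rightarrow> real) \<Rightarrow> 'p" and p0 :: 'p
    and L :: "('v set \<times> nat) set set" and f :: "('v \<Rightarrow> real) \<Rightarrow> 'v set \<times> nat \<Rightarrow> real"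
    and g :: "'v set \<times> nat \<Rightarrow> 'v \<Rightarrow> real"
  assumes K: "abstract_simplicial_complex K" and dim: "\<And>\<sigma>. \<sigma> \<in> K \<Longrightarrow> card \<sigma> \<le> Suc n"
    and openU: "\<And>i. i \<le> k \<Longrightarrow> openin (realization K) (U i)"
    and e: "\<And>i. i \<le> k \<Longrightarrow> continuous_map (subtopology (realization K) (U i)) P (e i)"
      "\<And>i x. i \<le> k \<Longrightarrow> x \<in> U i \<Longrightarrow> q (e i x) = x"
    and q: "continuous_map P (realization K) q" and sc: "simply_connected_topology P" and p0: "p0 \<in> topspace P"
    and model: "small_model K (U ` {..k}) (Suc n) L f g"
begin

section \<open>Ranks, levels and patches\<close>

text \<open>A simplex and a strict face of it whose ranks are \<open>2j\<close> and \<open>2j + 1\<close> miss the same members of the cover: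
  the dimension already accounts for the difference of the ranks.\<close>

definition missed :: "('v set \<times> nat) set \<Rightarrow> nat set" where
  "missed s = {i. i \<le> k \<and> \<not> small {U i} g s}"

definition rank :: "('v set \<times> nat) set \<Rightarrow> nat" where
  "rank s = card s - 1 + card (missed s)"

text \<open>A function of \<open>missed s\<close> alone, so simplices missing the same members are
  lifted by the same section.\<close>

definition colour :: "('v set \<times> nat) set \<Rightarrow> nat" where
  "colour s = (LEAST i. i \<le> k \<and> i \<notin> missed s)"

definition level :: "nat \<Rightarrow> ('v set \<times> nat) set set" where
  "level j = {s \<in> L. rank s div 2 = j}"

definition weight :: "('v set \<times> nat) set \<Rightarrow> ('v \<Rightarrow> real) \<Rightarrow> real" where
  "weight s x = gap s (f x)"

text \<open>The preimage under \<open>f\<close> of the open star of the level-\<open>j\<close>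
  graph: some barycentre of that level has a positive coordinate.\<close>

definition patch :: "nat \<Rightarrow> ('v \<Rightarrow> real) set" where
  "patch j = {x \<in> topspace (realization K). \<exists>s\<in>level j. 0 < weight s x}"

definition carrier_of :: "'v set \<Rightarrow> ('v set \<times> nat) set set" where
  "carrier_of \<sigma> = (SOME A. carrier_over L f g \<sigma> A)"

lemma L: "abstract_simplicial_complex L" "s \<in> L \<Longrightarrow> card s \<le> Suc n" "s \<in> L \<Longrightarrow> small (U ` {..k}) g s"
  using model unfolding small_model_def by simp_all

lemma carrier_of:
  assumes "\<sigma> \<in> K"
  shows "carrier_of \<sigma> \<subseteq> L" "finite (carrier_of \<sigma>)" "abstract_simplicial_complex (carrier_of \<sigma>)"
    "g ` \<Union>(carrier_of \<sigma>) \<subseteq> closed_simplex \<sigma>"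
    "continuous_map (simplex_topology \<sigma>) (body_topology (carrier_of \<sigma>)) f"
proof -
  have "\<exists>A. carrier_over L f g \<sigma> A"
    using model assms dim[OF assms] unfolding small_model_def by simp
  then have "carrier_over L f g \<sigma> (carrier_of \<sigma>)"
    unfolding carrier_of_def by (rule someI_ex)
  then show "carrier_of \<sigma> \<subseteq> L" "finite (carrier_of \<sigma>)" "abstract_simplicial_complex (carrier_of \<sigma>)"
    "g ` \<Union>(carrier_of \<sigma>) \<subseteq> closed_simplex \<sigma>"
    "continuous_map (simplex_topology \<sigma>) (body_topology (carrier_of \<sigma>)) f"
    unfolding carrier_over_def by simp_all
qed

lemma finite_missed: "finite (missed s)"
  by (rule finite_subset[of _ "{..k}"]) (auto simp: missed_def)

lemma ex_not_missed:
  assumes "s \<in> L"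
  shows "\<exists>i\<le>k. i \<notin> missed s"
proof -
  obtain i where i: "i \<le> k" "\<exists>Q\<subseteq>U i. segment_closed Q \<and> g ` s \<subseteq> Q"
    using L(3)[OF assms] unfolding small_def by auto
  then have "small {U i} g s"
    unfolding small_def by simp
  then show ?thesis
    using i(1) by (auto simp: missed_def)
qed

lemma colour:
  assumes "s \<in> L"
  shows "colour s \<le> k" "small {U (colour s)} g s"
proof -
  have "\<exists>i. i \<le> k \<and> i \<notin> missed s"
    using ex_not_missed[OF assms] by blast
  from LeastI_ex[OF this] have "colour s \<le> k \<and> colour s \<notin> missed s"
    unfolding colour_def .
  then show "colour s \<le> k" "small {U (colour s)} g s"
    by (simp_all add: missed_def)
qed

text \<open>Some member is not missed, which leaves at most \<open>k\<close> of the
  \<open>k + 1\<close>.\<close>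

lemma rank_le:
  assumes "s \<in> L"
  shows "rank s \<le> n + k"
proof -
  obtain i where i: "i \<le> k" "i \<notin> missed s"
    using ex_not_missed[OF assms] by blast
  then have "missed s \<subseteq> {..k} - {i}"
    by (auto simp: missed_def)
  then have "card (missed s) \<le> card ({..k} - {i})"
    by (intro card_mono) auto
  also have "\<dots> = k"
    using i by simp
  finally show ?thesis
    using L(2)[OF assms] by (simp add: rank_def)
qed

text \<open>Smallness passes to faces, so \<open>missed\<close> grows with the simplex. The
  dimension grows strictly; if the rank grows by only one, nothing is left for
  \<open>missed\<close>.\<close>

lemma rank_face:
  assumes "s \<in> L" "t \<in> L" "s \<subset> t"
  shows "rank s < rank t" "rank t = Suc (rank s) \<Longrightarrow> missed s = missed t"
proof -
  have mono: "missed s \<subseteq> missed t"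
    using small_antimono[of _ g t s] assms(3) unfolding missed_def by blast
  have "card s < card t" "0 < card s"
    using assms simplexD[OF L(1)] by (auto simp: card_gt_0_iff psubset_card_mono)
  moreover have m: "card (missed s) \<le> card (missed t)"
    using card_mono[OF finite_missed mono] .
  ultimately show "rank s < rank t"
    by (simp add: rank_def)
  assume "rank t = Suc (rank s)"
  then have "card (missed t) \<le> card (missed s)"
    using \<open>card s < card t\<close> \<open>0 < card s\<close> by (simp add: rank_def)
  then show "missed s = missed t"
    using card_seteq[OF finite_missed mono] by blast
qed

lemma level_face:
  assumes "s \<in> level j" "t \<in> level j" "s \<subset> t"
  shows "missed s = missed t" "rank s = 2 * j" "rank t = Suc (2 * j)"
proof -
  have st: "s \<in> L" "t \<in> L" "rank s div 2 = j" "rank t div 2 = j"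
    using assms by (auto simp: level_def)
  show "rank s = 2 * j" "rank t = Suc (2 * j)"
    using rank_face(1)[OF st(1,2) assms(3)] st(3,4) by linarith+
  then show "missed s = missed t"
    using rank_face(2)[OF st(1,2) assms(3)] by simp
qed

section \<open>Weights on a simplex of the complex\<close>

lemma weight_support:
  assumes \<sigma>: "\<sigma> \<in> K" and x: "x \<in> closed_simplex \<sigma>"
  shows "finite {v. f x v \<noteq> 0}" "{v. f x v \<noteq> 0} \<in> carrier_of \<sigma>" "\<And>v. 0 \<le> f x v"
    "\<And>v. v \<notin> \<Union>(carrier_of \<sigma>) \<Longrightarrow> f x v = 0"
proof -
  have "f x \<in> body (carrier_of \<sigma>)"
    using continuous_map_funspace[OF carrier_of(5)[OF \<sigma>]] x by (auto simp: Pi_iff)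
  then obtain a where a: "a \<in> carrier_of \<sigma>" "f x \<in> closed_simplex a"
    by (auto simp: body_def)
  note s = closed_simplex_support[OF carrier_of(3)[OF \<sigma>] a]
  show "{v. f x v \<noteq> 0} \<in> carrier_of \<sigma>" "finite {v. f x v \<noteq> 0}"
    using s(1) simplexD[OF carrier_of(3)[OF \<sigma>] s(1)] by auto
  show "0 \<le> f x v" for v
    using a(2) unfolding closed_simplex_def by blast
  show "f x v = 0" if "v \<notin> \<Union>(carrier_of \<sigma>)" for v
  proof -
    have "v \<notin> a"
      using a(1) that by blast
    then show ?thesis
      using a(2) unfolding closed_simplex_def by blast
  qed
qed

lemma weight_nonneg: "0 \<le> weight s x"
  by (simp add: weight_def gap_nonneg)

text \<open>Local finiteness: on one simplex \<sigma> only the finitely many members of its carrier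
  can have positive weight.\<close>

lemma weight_pos_carrier:
  assumes \<sigma>: "\<sigma> \<in> K" and x: "x \<in> closed_simplex \<sigma>" and s: "s \<in> L" "0 < weight s x"
  shows "s \<in> carrier_of \<sigma>"
proof -
  have "s \<subseteq> {v. f x v \<noteq> 0}"
    using gap_pos_support[of s "f x"] simplexD[OF L(1) s(1)] s(2) weight_support(1)[OF \<sigma> x] by (simp add: weight_def)
  then show ?thesis
    using simplex_face[OF carrier_of(3)[OF \<sigma>] weight_support(2)[OF \<sigma> x]] simplexD[OF L(1) s(1)] by blast
qed

lemma weight_chain:
  assumes \<sigma>: "\<sigma> \<in> K" and x: "x \<in> closed_simplex \<sigma>" and "s \<in> L" "0 < weight s x" "t \<in> L" "0 < weight t x"
  shows "s \<subseteq> t \<or> t \<subseteq> s"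
  using gap_pos_chain[of s t "f x"] simplexD[OF L(1)] weight_support(1)[OF \<sigma> x] assms(3-) by (simp add: weight_def)

lemma continuous_map_weight:
  assumes \<sigma>: "\<sigma> \<in> K" and s: "s \<in> L"
  shows "continuous_map (simplex_topology \<sigma>) euclideanreal (weight s)"
  unfolding weight_def
proof (rule continuous_map_gap[where V = "\<Union>(carrier_of \<sigma>)"])
  show "finite (\<Union>(carrier_of \<sigma>))"
    using carrier_of(2)[OF \<sigma>] simplexD[OF carrier_of(3)[OF \<sigma>]] by auto
  show "f x w = 0" if "x \<in> topspace (simplex_topology \<sigma>)" "w \<notin> \<Union>(carrier_of \<sigma>)" for x w
    using weight_support(4)[OF \<sigma>, of x w] that by simp
  show "continuous_map (simplex_topology \<sigma>) euclideanreal (\<lambda>x. f x w)" for w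
    using carrier_of(5)[OF \<sigma>] unfolding continuous_map_in_subtopology continuous_map_componentwise_UNIV by blast
qed (use simplexD[OF L(1) s] in auto)

lemma ex_weight_pos:
  assumes \<sigma>: "\<sigma> \<in> K" and x: "x \<in> closed_simplex \<sigma>"
  shows "\<exists>s\<in>L. 0 < weight s x"
proof -
  have "{v. f x v \<noteq> 0} \<noteq> {}"
    using simplexD[OF carrier_of(3)[OF \<sigma>] weight_support(2)[OF \<sigma> x]] by blast
  then obtain v where "f x v \<noteq> 0" by blast
  then have v: "0 < f x v"
    using weight_support(3)[OF \<sigma> x, of v] by simp
  define s where "s = {v. \<forall>w. f x w \<le> f x v}"
  have s: "finite s" "s \<noteq> {}" "0 < gap s (f x)"
    unfolding s_def using gap_pos_Max[OF weight_support(1)[OF \<sigma> x] v] by blast+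
  have "s \<subseteq> {v. f x v \<noteq> 0}"
    by (rule gap_pos_support[OF s(1,2) weight_support(1)[OF \<sigma> x] s(3)])
  then have "s \<in> carrier_of \<sigma>"
    using simplex_face[OF carrier_of(3)[OF \<sigma>] weight_support(2)[OF \<sigma> x]] s(2) by blast
  then show ?thesis
    using carrier_of(1)[OF \<sigma>] s(3) by (auto simp: weight_def)
qed

lemma patch_cover: "(\<Union>j\<le>(n + k) div 2. patch j) = topspace (realization K)"
proof
  show "topspace (realization K) \<subseteq> (\<Union>j\<le>(n + k) div 2. patch j)"
  proof
    fix x assume x: "x \<in> topspace (realization K)"
    then obtain \<sigma> where "\<sigma> \<in> K" "x \<in> closed_simplex \<sigma>"
      by (auto simp: topspace_realization)
    then obtain s where s: "s \<in> L" "0 < weight s x"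
      using ex_weight_pos by blast
    have "x \<in> patch (rank s div 2)"
      using s x by (auto simp: patch_def level_def)
    moreover have "rank s div 2 \<le> (n + k) div 2"
      using rank_le[OF s(1)] by (rule div_le_mono)
    ultimately show "x \<in> (\<Union>j\<le>(n + k) div 2. patch j)"
      by blast
  qed
qed (auto simp: patch_def)

lemma openin_patch: "openin (realization K) (patch j)"
  unfolding openin_realization
proof (intro conjI ballI)
  show "patch j \<subseteq> (\<Union>s\<in>K. closed_simplex s)"
    unfolding patch_def topspace_realization by blast
  fix \<sigma> assume \<sigma>: "\<sigma> \<in> K"
  let ?T = "simplex_topology \<sigma>"
  have "patch j \<inter> closed_simplex \<sigma> = (\<Union>s\<in>level j. {x \<in> topspace ?T. weight s x \<in> {0<..}})"
    using \<sigma> by (auto simp: patch_def topspace_realization)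
  moreover have "openin ?T {x \<in> topspace ?T. weight s x \<in> {0<..}}" if "s \<in> level j" for s
    using that by (intro openin_continuous_map_preimage[OF continuous_map_weight[OF \<sigma>]]) (auto simp: level_def)
  ultimately show "openin ?T (patch j \<inter> closed_simplex \<sigma>)"
    by auto
qed

section \<open>Lifted edges and fans\<close>

definition centre :: "('v set \<times> nat) set \<Rightarrow> 'v \<Rightarrow> real" where
  "centre s = barycentre g s"

definition edge :: "('v set \<times> nat) set \<Rightarrow> ('v set \<times> nat) set \<Rightarrow> real \<Rightarrow> 'v \<Rightarrow> real" where
  "edge s t \<mu> = (\<lambda>v. (1 - \<mu>) * centre s v + \<mu> * centre t v)"

lemma edge_in:
  assumes "t \<in> L" "s \<subseteq> t" "s \<noteq> {}" "segment_closed Q" "g ` t \<subseteq> Q" "\<mu> \<in> {0..1}"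
  shows "edge s t \<mu> \<in> Q"
proof -
  have t: "finite t" "t \<noteq> {}"
    using simplexD[OF L(1) assms(1)] by auto
  have "g ` s \<subseteq> Q"
    using assms(2,5) by blast
  then have "centre s \<in> Q" "centre t \<in> Q"
    unfolding centre_def using segment_closed_barycentre[OF assms(4)] t assms(3,5) finite_subset[OF assms(2)] by simp_all
  then show ?thesis
    using assms(4,6) unfolding edge_def segment_closed_def by blast
qed

lemma edge_in_cover:
  assumes "t \<in> L" "s \<subseteq> t" "s \<noteq> {}" "\<mu> \<in> {0..1}"
  shows "edge s t \<mu> \<in> U (colour t)"
proof -
  obtain Q where "Q \<subseteq> U (colour t)" "segment_closed Q" "g ` t \<subseteq> Q"
    using colour(2)[OF assms(1)] unfolding small_def by auto
  then show ?thesis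
    using edge_in[OF assms(1-3) _ _ assms(4), of Q] by blast
qed

text \<open>Chosen once for each simplex, so that the fans of all edges at this vertex of the graph
  share it.\<close>

definition ray :: "('v set \<times> nat) set \<Rightarrow> real \<Rightarrow> 'p" where
  "ray s = (SOME \<gamma>. pathin P \<gamma> \<and> \<gamma> 0 = e (colour s) (centre s) \<and> \<gamma> 1 = p0)"

lemma edge_self: "edge s s \<mu> = centre s"
  by (simp add: edge_def algebra_simps)

lemma edge_0: "edge s t 0 = centre s" and edge_1: "edge s t 1 = centre t"
  by (simp_all add: edge_def)

lemma lift_in_P:
  assumes "s \<in> L" "x \<in> U (colour s)"
  shows "e (colour s) x \<in> topspace P"
proof -
  have "U (colour s) \<subseteq> topspace (realization K)"
    using openin_subset[OF openU[OF colour(1)[OF assms(1)]]] .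
  then show ?thesis
    using continuous_map_funspace[OF e(1)[OF colour(1)[OF assms(1)]]] assms(2) by (auto simp: Pi_iff)
qed

lemma ray:
  assumes "s \<in> L"
  shows "pathin P (ray s)" "ray s 0 = e (colour s) (centre s)" "ray s 1 = p0"
proof -
  have "centre s \<in> U (colour s)"
    using edge_in_cover[OF assms order_refl, of 0] simplexD[OF L(1) assms] by (simp add: edge_self)
  then have "\<exists>\<gamma>. pathin P \<gamma> \<and> \<gamma> 0 = e (colour s) (centre s) \<and> \<gamma> 1 = p0"
    using sc lift_in_P[OF assms] p0 unfolding simply_connected_topology_def path_connected_space_def by blast
  from someI_ex[OF this] show "pathin P (ray s)" "ray s 0 = e (colour s) (centre s)" "ray s 1 = p0"
    unfolding ray_def by simp_all
qed

text \<open>A square in \<open>P\<close> that contracts a lift of the edge to \<open>p0\<close> and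
  follows the chosen rays at its ends. The last clause treats a single vertex as a degenerate edge:
  the position on it must not matter.\<close>

definition is_fan :: "('v set \<times> nat) set \<Rightarrow> ('v set \<times> nat) set \<Rightarrow> (real \<times> real \<Rightarrow> 'p) \<Rightarrow> bool" where
  "is_fan s t F \<longleftrightarrow> continuous_map (prod_topology (top_of_set {0..1}) (top_of_set {0..1})) P F \<and>
     (\<forall>\<mu>\<in>{0..1}. q (F (\<mu>, 0)) = edge s t \<mu> \<and> F (\<mu>, 1) = p0 \<and>
        F (0, \<mu>) = ray s (min 1 (2 * \<mu>)) \<and> F (1, \<mu>) = ray t (min 1 (2 * \<mu>))) \<and>
     (s = t \<longrightarrow> (\<forall>\<mu>\<in>{0..1}. \<forall>\<tau>\<in>{0..1}. F (\<mu>, \<tau>) = ray s (min 1 (2 * \<tau>))))"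

definition fan :: "('v set \<times> nat) set \<Rightarrow> ('v set \<times> nat) set \<Rightarrow> real \<times> real \<Rightarrow> 'p" where
  "fan s t = (SOME F. is_fan s t F)"

lemma continuous_map_edge:
  assumes "\<sigma> \<in> K" "t \<in> L" "s \<subseteq> t" "s \<noteq> {}" "g ` t \<subseteq> closed_simplex \<sigma>"
    and m: "continuous_map T euclideanreal m" "\<And>z. z \<in> topspace T \<Longrightarrow> m z \<in> {0..1}"
  shows "continuous_map T (simplex_topology \<sigma>) (\<lambda>z. edge s t (m z))"
  unfolding continuous_map_in_subtopology continuous_map_componentwise_UNIV
proof (intro conjI allI)
  show "continuous_map T euclideanreal (\<lambda>z. edge s t (m z) v)" for v
    unfolding edge_def using m(1)
    by (intro continuous_map_add continuous_map_real_mult_right continuous_map_diff continuous_map_const[THEN iffD2]) auto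
  show "(\<lambda>z. edge s t (m z)) \<in> topspace T \<rightarrow> closed_simplex \<sigma>"
    using edge_in[OF assms(2-4) segment_closed_closed_simplex assms(5)] m(2) by blast
qed

text \<open>The edge lies in one member of the cover, so a section lifts it. The lift begins and
  ends where the two rays begin, and simple connectivity fills the resulting loop.\<close>

lemma fan:
  assumes "\<sigma> \<in> K" "s \<in> level j" "t \<in> level j" "s \<subseteq> t" "g ` t \<subseteq> closed_simplex \<sigma>"
  shows "is_fan s t (fan s t)"
proof -
  let ?I = "top_of_set {0..1::real}"
  have st: "s \<in> L" "t \<in> L"
    using assms by (auto simp: level_def)
  have "\<exists>F. is_fan s t F"
  proof (cases "s = t")
    case True
    let ?F = "\<lambda>z. ray s (min 1 (2 * snd z))"
    have "continuous_map (prod_topology ?I ?I) euclideanreal snd"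
      by (metis continuous_map_snd continuous_map_into_fulltopology)
    then have "continuous_map (prod_topology ?I ?I) euclideanreal (\<lambda>z. min 1 (2 * snd z))"
      by (intro continuous_map_real_min continuous_map_real_mult_left continuous_map_const[THEN iffD2]) auto
    then have "continuous_map (prod_topology ?I ?I) ?I (\<lambda>z. min 1 (2 * snd z))"
      by (auto simp: continuous_map_in_subtopology)
    from continuous_map_compose[OF this, of P "ray s"]
    have "continuous_map (prod_topology ?I ?I) P ?F"
      using ray(1)[OF st(1)] by (simp add: o_def pathin_def)
    moreover have "q (ray s 0) = edge s s \<mu>" for \<mu>
    proof -
      have "centre s \<in> U (colour s)"
        using edge_in_cover[OF st(1) order_refl, of 0] simplexD[OF L(1) st(1)] by (simp add: edge_self)
      then show ?thesis
        using ray(2)[OF st(1)] e(2)[OF colour(1)[OF st(1)]] by (simp add: edge_self)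
    qed
    ultimately have "is_fan s t ?F"
      using ray(3)[OF st(1)] True unfolding is_fan_def by simp
    then show ?thesis by blast
  next
    case False
    \<comment> \<open>Here the pairing of ranks is used: both ends get the same colour, so the
      section over the edge agrees with the lifts of its end points.\<close>
    then have "missed s = missed t"
      using level_face(1)[OF assms(2,3)] assms(4) by blast
    then have col: "colour s = colour t"
      by (simp add: colour_def)
    let ?a = "\<lambda>\<mu>. e (colour t) (edge s t \<mu>)"
    have sne: "s \<noteq> {}"
      using simplexD[OF L(1) st(1)] by simp
    have "continuous_map ?I (simplex_topology \<sigma>) (edge s t)"
      using continuous_map_edge[OF assms(1) st(2) assms(4) sne assms(5), of ?I "\<lambda>\<mu>. \<mu>"] by simp
    from continuous_map_compose[OF this continuous_map_closed_simplex_realization[OF assms(1)]]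
    have "continuous_map ?I (realization K) (edge s t)"
      by simp
    then have "continuous_map ?I (subtopology (realization K) (U (colour t))) (edge s t)"
      using edge_in_cover[OF st(2) assms(4) sne] by (auto simp: continuous_map_in_subtopology)
    from continuous_map_compose[OF this e(1)[OF colour(1)[OF st(2)]]]
    have a: "pathin P ?a"
      by (simp add: pathin_def o_def)
    have "ray s 0 = ?a 0" "ray t 0 = ?a 1"
      using ray(2)[OF st(1)] ray(2)[OF st(2)] col by (simp_all add: edge_0 edge_1)
    then obtain F where F: "continuous_map (prod_topology ?I ?I) P F"
      "\<And>\<mu>. \<mu> \<in> {0..1} \<Longrightarrow> F (\<mu>, 0) = ?a \<mu>" "\<And>\<mu>. \<mu> \<in> {0..1} \<Longrightarrow> F (\<mu>, 1) = p0"
      "\<And>\<mu>. \<mu> \<in> {0..1} \<Longrightarrow> F (0, \<mu>) = ray s (min 1 (2 * \<mu>))" "\<And>\<mu>. \<mu> \<in> {0..1} \<Longrightarrow> F (1, \<mu>) = ray t (min 1 (2 * \<mu>))"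
      using simply_connected_fill[OF sc a ray(1)[OF st(1)] _ ray(3)[OF st(1)] ray(1)[OF st(2)] _ ray(3)[OF st(2)]] by metis
    have "q (F (\<mu>, 0)) = edge s t \<mu>" if "\<mu> \<in> {0..1}" for \<mu>
      using F(2)[OF that] e(2)[OF colour(1)[OF st(2)] edge_in_cover[OF st(2) assms(4) sne that]] by simp
    then have "is_fan s t F"
      unfolding is_fan_def using F(1,3-5) False by simp
    then show ?thesis by blast
  qed
  then show ?thesis
    unfolding fan_def by (rule someI_ex)
qed

section \<open>Contracting a patch\<close>

definition active :: "nat \<Rightarrow> ('v \<Rightarrow> real) \<Rightarrow> ('v set \<times> nat) set set" where
  "active j x = {s \<in> level j. 0 < weight s x}"

definition mix :: "('v set \<times> nat) set \<Rightarrow> ('v set \<times> nat) set \<Rightarrow> ('v \<Rightarrow> real) \<Rightarrow> real" where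
  "mix s t x = weight t x / (weight s x + weight t x)"

text \<open>There are one or two active simplices and they are nested, so intersection and union
  name the smaller and the larger one, equal if there is just one.\<close>

definition contraction :: "nat \<Rightarrow> real \<times> ('v \<Rightarrow> real) \<Rightarrow> 'v \<Rightarrow> real" where
  "contraction j z = (let x = snd z; s = \<Inter>(active j x); t = \<Union>(active j x) in q (fan s t (mix s t x, fst z)))"

definition pairs :: "nat \<Rightarrow> 'v set \<Rightarrow> (('v set \<times> nat) set \<times> ('v set \<times> nat) set) set" where
  "pairs j \<sigma> = {(s, t). s \<in> carrier_of \<sigma> \<inter> level j \<and> t \<in> carrier_of \<sigma> \<inter> level j \<and> s \<subseteq> t}"

text \<open>A closed part of the patch on which a single fan describes the contraction.\<close>

definition piece :: "nat \<Rightarrow> 'v set \<Rightarrow> ('v set \<times> nat) set \<times> ('v set \<times> nat) set \<Rightarrow> ('v \<Rightarrow> real) set" where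
  "piece j \<sigma> st = {x \<in> patch j \<inter> closed_simplex \<sigma>. \<forall>r\<in>carrier_of \<sigma> \<inter> level j. r \<noteq> fst st \<and> r \<noteq> snd st \<longrightarrow> weight r x = 0}"

text \<open>Active simplices form a chain. Within a level a strict inclusion forces rank 2j below
  and 2j + 1 above, so there is no room for a third member.\<close>

lemma active_facts:
  assumes \<sigma>: "\<sigma> \<in> K" and x: "x \<in> patch j" "x \<in> closed_simplex \<sigma>"
  obtains s t where "active j x = {s, t}" "s \<subseteq> t" "(s, t) \<in> pairs j \<sigma>"
proof -
  have act: "s \<in> carrier_of \<sigma>" "s \<in> level j" if "s \<in> active j x" for s
    using that weight_pos_carrier[OF \<sigma> x(2)] by (auto simp: active_def level_def)
  have ch: "s \<subseteq> t \<or> t \<subseteq> s" if "s \<in> active j x" "t \<in> active j x" for s t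
    using weight_chain[OF \<sigma> x(2), of s t] that by (simp add: active_def level_def)
  have ne: "active j x \<noteq> {}"
    using x(1) by (auto simp: patch_def active_def)
  have fin: "finite (active j x)"
    using act carrier_of(2)[OF \<sigma>] finite_subset[of "active j x" "carrier_of \<sigma>"] by blast
  have fc: "face_chain (active j x)"
    using ch unfolding face_chain_def by blast
  obtain t where t: "t \<in> active j x" "\<And>r. r \<in> active j x \<Longrightarrow> r \<subseteq> t"
    using face_chain_top[OF fc fin ne] by blast
  show thesis
  proof (cases "active j x = {t}")
    case True
    then show thesis
      using that[of t t] act[OF t(1)] by (simp add: pairs_def)
  next
    case False
    then obtain s where s: "s \<in> active j x" "s \<noteq> t"
      using t(1) by blast
    then have st: "s \<subset> t"
      using t(2) by blast
    have "r = s \<or> r = t" if r: "r \<in> active j x" for r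
    proof (rule ccontr)
      assume *: "\<not> (r = s \<or> r = t)"
      then have "r \<subset> t"
        using t(2)[OF r] by blast
      then have rr: "rank r = 2 * j" "rank s = 2 * j"
        using level_face(2)[OF act(2)[OF r] act(2)[OF t(1)]] level_face(2)[OF act(2)[OF s(1)] act(2)[OF t(1)] st] by simp_all
      have "r \<subset> s \<or> s \<subset> r"
        using ch[OF r s(1)] * by blast
      then show False
        using level_face(3)[OF act(2)[OF r] act(2)[OF s(1)]] level_face(3)[OF act(2)[OF s(1)] act(2)[OF r]] rr by auto
    qed
    then have "active j x = {s, t}"
      using s t by blast
    then show thesis
      using that[of s t] st act[OF s(1)] act[OF t(1)] by (simp add: pairs_def)
  qed
qed

text \<open>At a point of the piece one of \<open>s\<close> and \<open>t\<close> may be inactive,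
  and \<open>contraction\<close> then uses a degenerate fan. The formula with \<open>fan s t\<close>
  still gives the same point, because the sides of a fan are the rays that make up the degenerate
  fans.\<close>

lemma piece_facts:
  assumes \<sigma>: "\<sigma> \<in> K" and st: "(s, t) \<in> pairs j \<sigma>" and x: "x \<in> piece j \<sigma> (s, t)"
  shows "0 < weight s x + weight t x" "mix s t x \<in> {0..1}"
    "\<tau> \<in> {0..1} \<Longrightarrow> contraction j (\<tau>, x) = q (fan s t (mix s t x, \<tau>))"
proof -
  have xp: "x \<in> patch j" "x \<in> closed_simplex \<sigma>"
    using x by (auto simp: piece_def)
  have stA: "s \<in> level j" "t \<in> level j" "s \<in> carrier_of \<sigma>" "t \<in> carrier_of \<sigma>" "s \<subseteq> t"
    using st by (auto simp: pairs_def)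
  have gt: "g ` r \<subseteq> closed_simplex \<sigma>" if "r \<in> carrier_of \<sigma>" for r
    using carrier_of(4)[OF \<sigma>] that by blast
  obtain a b where ab: "active j x = {a, b}" "a \<subseteq> b" "(a, b) \<in> pairs j \<sigma>"
    by (rule active_facts[OF \<sigma> xp])
  have sub: "active j x \<subseteq> {s, t}"
  proof
    fix r assume r: "r \<in> active j x"
    then have "0 < weight r x" "r \<in> level j" "r \<in> carrier_of \<sigma>"
      using weight_pos_carrier[OF \<sigma> xp(2)] by (auto simp: active_def level_def)
    then show "r \<in> {s, t}"
      using x by (auto simp: piece_def)
  qed
  have pos: "r \<in> active j x \<longleftrightarrow> 0 < weight r x" if "r \<in> {s, t}" for r
    using that stA by (auto simp: active_def)
  have "0 < weight s x \<or> 0 < weight t x"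
    using sub pos ab(1) by blast
  then show sum: "0 < weight s x + weight t x"
    using weight_nonneg[of s x] weight_nonneg[of t x] by linarith
  then show "mix s t x \<in> {0..1}"
    using weight_nonneg[of s x] weight_nonneg[of t x] by (simp add: mix_def)
  assume \<tau>: "\<tau> \<in> {0..1}"
  have c: "contraction j (\<tau>, x) = q (fan a b (mix a b x, \<tau>))"
  proof -
    have "\<Inter>(active j x) = a" "\<Union>(active j x) = b"
      using ab(1,2) by auto
    then show ?thesis
      by (simp add: contraction_def Let_def)
  qed
  have "fan a b (mix a b x, \<tau>) = fan s t (mix s t x, \<tau>)"
  \<comment> \<open>Two active simplices must be \<open>s\<close> and \<open>t\<close> themselves;
    only a single active one needs comparison.\<close>
  proof (cases "a = b")
    case False
    then have "s = a" "t = b"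
      using sub ab(1,2) stA(5) by auto
    then show ?thesis by simp
  next
    case True
    have "a \<in> level j" "a \<in> carrier_of \<sigma>" "a \<in> active j x"
      using ab(1,3) by (auto simp: pairs_def)
    note a = this
    have "is_fan a a (fan a a)"
      using fan[OF \<sigma> a(1,1) order_refl gt[OF a(2)]] .
    moreover have "mix a a x \<in> {0..1}"
      using a(3) by (simp add: mix_def active_def)
    ultimately have l: "fan a b (mix a b x, \<tau>) = ray a (min 1 (2 * \<tau>))"
      using \<tau> True unfolding is_fan_def by blast
    have F: "is_fan s t (fan s t)"
      using fan[OF \<sigma> stA(1,2,5) gt[OF stA(4)]] .
    \<comment> \<open>In the last two cases the inactive simplex has weight 0, so
      \<open>mix s t x\<close> is 0 or 1 and the point lies on a side of the fan.\<close>
    consider "s = t" "s = a" | "s \<noteq> t" "a = s" | "s \<noteq> t" "a = t"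
      using sub a(3) by blast
    then have "fan s t (mix s t x, \<tau>) = ray a (min 1 (2 * \<tau>))"
    proof cases
      case 1
      then show ?thesis
        using F \<open>mix s t x \<in> {0..1}\<close> \<tau> unfolding is_fan_def by blast
    next
      case 2
      then have "t \<notin> active j x"
        using ab(1) True by blast
      then have "weight t x = 0"
        using pos[of t] weight_nonneg[of t x] by simp
      then have "mix s t x = 0"
        by (simp add: mix_def)
      then show ?thesis
        using F \<tau> 2 unfolding is_fan_def by simp
    next
      case 3
      then have "s \<notin> active j x"
        using ab(1) True by blast
      then have "weight s x = 0"
        using pos[of s] weight_nonneg[of s x] by simp
      then have "mix s t x = 1"
        using sum by (simp add: mix_def)
      then show ?thesis
        using F \<tau> 3 unfolding is_fan_def by simp
    qed
    then show ?thesis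
      using l by simp
  qed
  then show "contraction j (\<tau>, x) = q (fan s t (mix s t x, \<tau>))"
    using c by simp
qed

lemma continuous_map_mix:
  assumes \<sigma>: "\<sigma> \<in> K" and st: "(s, t) \<in> pairs j \<sigma>"
  shows "continuous_map (prod_topology (top_of_set {0..1::real}) (subtopology (powertop_real UNIV) (piece j \<sigma> (s, t))))
    euclideanreal (\<lambda>z. mix s t (snd z))"
proof -
  let ?T = "prod_topology (top_of_set {0..1::real}) (subtopology (powertop_real UNIV) (piece j \<sigma> (s, t)))"
  have sub: "piece j \<sigma> (s, t) \<subseteq> closed_simplex \<sigma>"
    by (auto simp: piece_def)
  have w: "continuous_map ?T euclideanreal (\<lambda>z. weight r (snd z))" if "r \<in> L" for r
  proof -
    have "continuous_map (subtopology (powertop_real UNIV) (piece j \<sigma> (s, t))) euclideanreal (weight r)"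
      using continuous_map_from_subtopology_mono[OF continuous_map_weight[OF \<sigma> that] sub] .
    from continuous_map_compose[OF continuous_map_snd this] show ?thesis
      by (simp add: o_def)
  qed
  have L: "s \<in> L" "t \<in> L"
    using st by (auto simp: pairs_def level_def)
  show ?thesis
    unfolding mix_def
  proof (intro continuous_map_real_divide continuous_map_add w L)
    fix z assume "z \<in> topspace ?T"
    then show "weight s (snd z) + weight t (snd z) \<noteq> 0"
      using piece_facts(1)[OF \<sigma> st, of "snd z"] by auto
  qed
qed

lemma piece_cover:
  assumes "\<sigma> \<in> K"
  shows "patch j \<inter> closed_simplex \<sigma> \<subseteq> (\<Union>st\<in>pairs j \<sigma>. piece j \<sigma> st)"
proof
  fix x assume x: "x \<in> patch j \<inter> closed_simplex \<sigma>"
  then have x': "x \<in> patch j" "x \<in> closed_simplex \<sigma>"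
    by simp_all
  obtain s t where st: "active j x = {s, t}" "s \<subseteq> t" "(s, t) \<in> pairs j \<sigma>"
    by (rule active_facts[OF assms x'])
  have "weight r x = 0" if "r \<in> level j" "r \<noteq> s" "r \<noteq> t" for r
  proof -
    have "r \<notin> active j x"
      using st(1) that by blast
    then show ?thesis
      using that(1) weight_nonneg[of r x] by (simp add: active_def)
  qed
  then have "x \<in> piece j \<sigma> (s, t)"
    using x by (simp add: piece_def)
  then show "x \<in> (\<Union>st\<in>pairs j \<sigma>. piece j \<sigma> st)"
    using st(3) by blast
qed

lemma finite_pairs:
  assumes "\<sigma> \<in> K"
  shows "finite (pairs j \<sigma>)"
  by (rule finite_subset[of _ "carrier_of \<sigma> \<times> carrier_of \<sigma>"]) (auto simp: pairs_def carrier_of(2)[OF assms])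

lemma closedin_piece:
  assumes \<sigma>: "\<sigma> \<in> K"
  shows "closedin (subtopology (powertop_real UNIV) (patch j \<inter> closed_simplex \<sigma>)) (piece j \<sigma> st)"
proof -
  let ?T = "subtopology (powertop_real UNIV) (patch j \<inter> closed_simplex \<sigma>)"
  let ?R = "{r \<in> carrier_of \<sigma> \<inter> level j. r \<noteq> fst st \<and> r \<noteq> snd st}"
  have c: "closedin ?T {x \<in> topspace ?T. weight r x \<in> {0}}" if "r \<in> ?R" for r
  proof (rule closedin_continuous_map_preimage)
    have "r \<in> L"
      using that by (simp add: level_def)
    then show "continuous_map ?T euclideanreal (weight r)"
      by (intro continuous_map_from_subtopology_mono[OF continuous_map_weight[OF \<sigma>]]) auto
  qed simp
  have "closedin ?T (topspace ?T \<inter> (\<Inter>r\<in>?R. {x \<in> topspace ?T. weight r x \<in> {0}}))"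
  proof (cases "?R = {}")
    case True
    show ?thesis
      by (simp only: True INT_empty Int_UNIV_right closedin_topspace)
  next
    case False
    then show ?thesis
      using c by (intro closedin_Int closedin_topspace closedin_INT) auto
  qed
  moreover have "topspace ?T \<inter> (\<Inter>r\<in>?R. {x \<in> topspace ?T. weight r x \<in> {0}}) = piece j \<sigma> st"
    by (auto simp: piece_def)
  ultimately show ?thesis by simp
qed

text \<open>Two homotopies in succession. The first moves points straight onto the graph, inside a
  simplex \<sigma> of \<open>K\<close>, because the carrier of \<sigma> has its
  \<open>g\<close>-image there. The second is the projection of the contraction of the lifted
  graph.\<close>

lemma patch_null_homotopic: "null_homotopic (subtopology (realization K) (patch j)) (realization K) id"
proof -
  let ?I = "top_of_set {0..1::real}" and ?X = "realization K"
  let ?D = "\<lambda>\<sigma> st. prod_topology ?I (subtopology (powertop_real UNIV) (piece j \<sigma> st))"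
  note pieces = continuous_map_realization_pieces[OF openin_patch finite_pairs piece_cover closedin_piece]
  have gt: "g ` r \<subseteq> closed_simplex \<sigma>" if "\<sigma> \<in> K" "r \<in> carrier_of \<sigma>" for r \<sigma>
    using carrier_of(4)[OF that(1)] that(2) by blast
  have H2: "continuous_map (prod_topology ?I (subtopology ?X (patch j))) ?X (contraction j)"
  proof (rule pieces)
    fix \<sigma> st assume \<sigma>: "\<sigma> \<in> K" and stp: "st \<in> pairs j \<sigma>"
    obtain s t where [simp]: "st = (s, t)" by fastforce
    have st: "(s, t) \<in> pairs j \<sigma>" using stp by simp
    have stA: "s \<in> level j" "t \<in> level j" "t \<in> carrier_of \<sigma>" "s \<subseteq> t"
      using st by (auto simp: pairs_def)
    have F: "is_fan s t (fan s t)"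
      using fan[OF \<sigma> stA(1,2,4) gt[OF \<sigma> stA(3)]] .
    have mx: "mix s t (snd z) \<in> {0..1}" if "z \<in> topspace (?D \<sigma> (s, t))" for z
      using piece_facts(2)[OF \<sigma> st, of "snd z"] that by auto
    have "continuous_map (?D \<sigma> (s, t)) (prod_topology ?I ?I) (\<lambda>z. (mix s t (snd z), fst z))"
      using continuous_map_mix[OF \<sigma> st] mx
      by (intro continuous_map_pairedI continuous_map_fst) (auto simp: continuous_map_in_subtopology simp del: topspace_prod_topology)
    moreover have "continuous_map (prod_topology ?I ?I) P (fan s t)"
      using F by (simp add: is_fan_def)
    ultimately have "continuous_map (?D \<sigma> (s, t)) P (fan s t \<circ> (\<lambda>z. (mix s t (snd z), fst z)))"
      by (rule continuous_map_compose)
    then have "continuous_map (?D \<sigma> (s, t)) ?X (q \<circ> (fan s t \<circ> (\<lambda>z. (mix s t (snd z), fst z))))"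
      using q by (rule continuous_map_compose)
    then have "continuous_map (?D \<sigma> (s, t)) ?X (contraction j)"
    proof (rule continuous_map_eq)
      fix z assume z: "z \<in> topspace (?D \<sigma> (s, t))"
      have "contraction j (fst z, snd z) = q (fan s t (mix s t (snd z), fst z))"
        using z by (intro piece_facts(3)[OF \<sigma> st]) auto
      then show "(q \<circ> (fan s t \<circ> (\<lambda>z. (mix s t (snd z), fst z)))) z = contraction j z"
        by simp
    qed
    then show "continuous_map (?D \<sigma> st) ?X (contraction j)"
      by simp
  qed
  let ?h = "\<lambda>z v. (1 - fst z) * snd z v + fst z * contraction j (0, snd z) v"
  have H1: "continuous_map (prod_topology ?I (subtopology ?X (patch j))) ?X ?h"
  proof (rule pieces)
    fix \<sigma> st assume \<sigma>: "\<sigma> \<in> K" and stp: "st \<in> pairs j \<sigma>"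
    obtain s t where [simp]: "st = (s, t)" by fastforce
    have st: "(s, t) \<in> pairs j \<sigma>" using stp by simp
    have stA: "s \<in> level j" "t \<in> level j" "t \<in> carrier_of \<sigma>" "s \<subseteq> t"
      using st by (auto simp: pairs_def)
    have stL: "t \<in> L" "s \<noteq> {}"
      using stA simplexD[OF L(1), of s] by (auto simp: level_def)
    have F: "is_fan s t (fan s t)"
      using fan[OF \<sigma> stA(1,2,4) gt[OF \<sigma> stA(3)]] .
    let ?T = "simplex_topology \<sigma>"
    have zD: "snd z \<in> piece j \<sigma> (s, t)" "fst z \<in> {0..1}" if "z \<in> topspace (?D \<sigma> (s, t))" for z
      using that by auto
    have E: "continuous_map (?D \<sigma> (s, t)) ?T (\<lambda>z. edge s t (mix s t (snd z)))"
      using continuous_map_edge[OF \<sigma> stL(1) stA(4) stL(2) gt[OF \<sigma> stA(3)] continuous_map_mix[OF \<sigma> st]]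
        piece_facts(2)[OF \<sigma> st] zD(1) by blast
    \<comment> \<open>The initial edge of a fan lies over the edge of the graph, so the end of the
      straight-line homotopy is a point of that edge.\<close>
    have c: "contraction j (0, snd z) = edge s t (mix s t (snd z))" if z: "z \<in> topspace (?D \<sigma> (s, t))" for z
      using piece_facts(2)[OF \<sigma> st zD(1)[OF z]] piece_facts(3)[OF \<sigma> st zD(1)[OF z], of 0] F unfolding is_fan_def by simp
    let ?k = "\<lambda>z v. (1 - fst z) * snd z v + fst z * edge s t (mix s t (snd z)) v"
    have "continuous_map (?D \<sigma> (s, t)) ?T ?k"
      unfolding continuous_map_in_subtopology continuous_map_componentwise_UNIV
    proof (intro conjI allI)
      fix v
      have 1: "continuous_map (?D \<sigma> (s, t)) euclideanreal fst"
        by (metis continuous_map_fst continuous_map_into_fulltopology)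
      have "continuous_map (?D \<sigma> (s, t)) (powertop_real UNIV) snd"
        by (metis continuous_map_snd continuous_map_into_fulltopology)
      then have 2: "continuous_map (?D \<sigma> (s, t)) euclideanreal (\<lambda>z. snd z v)"
        by (simp add: continuous_map_componentwise_UNIV)
      have 3: "continuous_map (?D \<sigma> (s, t)) euclideanreal (\<lambda>z. edge s t (mix s t (snd z)) v)"
        using E unfolding continuous_map_in_subtopology continuous_map_componentwise_UNIV by blast
      show "continuous_map (?D \<sigma> (s, t)) euclideanreal (\<lambda>z. ?k z v)"
        by (intro continuous_map_add continuous_map_real_mult continuous_map_diff 1 2 3 continuous_map_const[THEN iffD2]) auto
    next
      show "?k \<in> topspace (?D \<sigma> (s, t)) \<rightarrow> closed_simplex \<sigma>"
      proof
        fix z assume z: "z \<in> topspace (?D \<sigma> (s, t))"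
        have "edge s t (mix s t (snd z)) \<in> closed_simplex \<sigma>"
          using edge_in[OF stL(1) stA(4) stL(2) segment_closed_closed_simplex gt[OF \<sigma> stA(3)]]
            piece_facts(2)[OF \<sigma> st zD(1)[OF z]] by blast
        moreover have "snd z \<in> closed_simplex \<sigma>"
          using zD(1)[OF z] by (simp add: piece_def)
        ultimately show "?k z \<in> closed_simplex \<sigma>"
          using segment_closed_closed_simplex[of \<sigma>] zD(2)[OF z] unfolding segment_closed_def by blast
      qed
    qed
    from continuous_map_compose[OF this continuous_map_closed_simplex_realization[OF \<sigma>]]
    have "continuous_map (?D \<sigma> (s, t)) ?X ?k"
      by simp
    then have "continuous_map (?D \<sigma> (s, t)) ?X ?h"
      by (rule continuous_map_eq) (simp only: c)
    then show "continuous_map (?D \<sigma> st) ?X ?h"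
      by simp
  qed
  have "homotopic_with (\<lambda>h. True) (subtopology ?X (patch j)) ?X id (\<lambda>x. contraction j (0, x))"
    unfolding homotopic_with_def by (rule exI[of _ ?h]) (use H1 in simp)
  moreover have "homotopic_with (\<lambda>h. True) (subtopology ?X (patch j)) ?X (\<lambda>x. contraction j (0, x)) (\<lambda>x. q p0)"
  proof (subst homotopic_with)
    have "contraction j (1, x) = q p0" if x: "x \<in> patch j" for x
    proof -
      obtain \<sigma> where \<sigma>: "\<sigma> \<in> K" "x \<in> closed_simplex \<sigma>"
        using x by (auto simp: patch_def topspace_realization)
      then obtain st where st: "st \<in> pairs j \<sigma>" "x \<in> piece j \<sigma> st"
        using piece_cover[OF \<sigma>(1)] x by blast
      obtain s t where stp: "st = (s, t)" by fastforce
      have st': "(s, t) \<in> pairs j \<sigma>" "x \<in> piece j \<sigma> (s, t)"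
        using st stp by simp_all
      then have "s \<in> level j" "t \<in> level j" "t \<in> carrier_of \<sigma>" "s \<subseteq> t"
        by (auto simp: pairs_def)
      then have "is_fan s t (fan s t)"
        using fan[OF \<sigma>(1) _ _ _ gt[OF \<sigma>(1)]] by blast
      then show ?thesis
        using piece_facts(2)[OF \<sigma>(1) st'] piece_facts(3)[OF \<sigma>(1) st', of 1] unfolding is_fan_def by simp
    qed
    then show "\<exists>h. continuous_map (prod_topology ?I (subtopology ?X (patch j))) ?X h \<and>
        (\<forall>x\<in>topspace (subtopology ?X (patch j)). h (0, x) = contraction j (0, x)) \<and>
        (\<forall>x\<in>topspace (subtopology ?X (patch j)). h (1, x) = q p0) \<and> (\<forall>t\<in>{0..1}. True)"
      by (intro exI[of _ "contraction j"]) (use H2 in simp)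
  qed simp
  ultimately show ?thesis
    unfolding null_homotopic_def using homotopic_with_trans by blast
qed

lemma LS_cat_realization_le: "LS_cat (realization K) \<le> enat ((n + k) div 2)"
  unfolding LS_cat_def
proof (rule Inf_lower, rule CollectI, intro exI conjI allI impI)
  show "enat ((n + k) div 2) = enat ((n + k) div 2)" ..
  show "openin (realization K) (patch j)" "null_homotopic (subtopology (realization K) (patch j)) (realization K) id" for j
    by (rule openin_patch, rule patch_null_homotopic)
  show "(\<Union>j\<le>(n + k) div 2. patch j) = topspace (realization K)"
    by (rule patch_cover)
qed

end

section \<open>The inequality\<close>

theorem theorem4p1:
  fixes K :: "'v set set" and x\<^sub>0 :: "'v \<Rightarrow> real"
    and B :: "'b topology" and u :: "('v \<Rightarrow> real) \<Rightarrow> 'b"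
    and E :: "'e topology" and p :: "'e \<Rightarrow> 'b"
  assumes "abstract_simplicial_complex K"
    and "connected_space (realization K)"
    and "x\<^sub>0 \<in> topspace (realization K)"
    and "classifying_space B (fundamental_group (realization K) x\<^sub>0)"
    and "classifying_map (realization K) u E p B"
  shows "ereal_of_enat (LS_cat (realization K))
         \<le> (ereal_of_enat (LS_cat_map (realization K) B u) + ereal_of_enat (complex_dim K)) / 2"
\<comment> \<open>If either summand is infinite, so is the right-hand side.\<close>
proof (cases "LS_cat_map (realization K) B u = \<infinity> \<or> complex_dim K = \<infinity>")
  case True
  have "0 \<le> ereal_of_enat m" for m
    by simp
  then have *: "ereal_of_enat (LS_cat_map (realization K) B u) + ereal_of_enat (complex_dim K) = \<infinity>"
    using True by (metis ereal_of_enat_simps(2) ereal_infty_less_eq(1) ereal_plus_eq_PInfty)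
  show ?thesis
    unfolding * by simp
next
  case False
  let ?X = "realization K"
  obtain n where n: "complex_dim K = enat n"
    using False by auto
  have dim: "card \<sigma> \<le> Suc n" if "\<sigma> \<in> K" for \<sigma>
  proof -
    have "enat (card \<sigma> - 1) \<le> complex_dim K"
      unfolding complex_dim_def using that by (rule SUP_upper)
    then show ?thesis
      using n by simp
  qed
  define S where "S = {enat k | k. \<exists>U :: nat \<Rightarrow> ('v \<Rightarrow> real) set.
      (\<forall>i\<le>k. openin ?X (U i) \<and> null_homotopic (subtopology ?X (U i)) B u) \<and> (\<Union>i\<le>k. U i) = topspace ?X}"
  have cS: "LS_cat_map ?X B u = Inf S"
    by (simp add: LS_cat_map_def S_def)
  \<comment> \<open>The infimum of the empty set is \<infinity>, so a finite category has covers,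
    and a minimal one exists by well-ordering.\<close>
  have "S \<noteq> {}"
    using False cS by (auto simp: Inf_enat_def)
  then obtain m where "m \<in> S" by blast
  then have "Inf S \<in> S"
    unfolding Inf_enat_def using LeastI[of "\<lambda>x. x \<in> S" m] by auto
  then obtain k U where k: "LS_cat_map ?X B u = enat k"
    and U: "\<forall>i\<le>k. openin ?X (U i) \<and> null_homotopic (subtopology ?X (U i)) B u" "(\<Union>i\<le>k. U i) = topspace ?X"
    unfolding cS S_def by blast
  let ?P = "pullback ?X u E p"
  have "\<exists>e. i \<le> k \<longrightarrow> continuous_map (subtopology ?X (U i)) ?P e \<and> (\<forall>x\<in>U i. fst (e x) = x)" for i
  proof (cases "i \<le> k")
    case True
    then obtain e where e: "continuous_map (subtopology ?X (U i)) ?P e" "\<And>x. x \<in> topspace ?X \<inter> U i \<Longrightarrow> fst (e x) = x"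
      using pullback_section[OF assms(5)] U(1) by metis
    moreover have "U i \<subseteq> topspace ?X"
      using U(1) True openin_subset by blast
    ultimately show ?thesis
      by (intro exI[of _ e]) auto
  qed simp
  then obtain e where e: "\<And>i. i \<le> k \<Longrightarrow> continuous_map (subtopology ?X (U i)) ?P (e i) \<and> (\<forall>x\<in>U i. fst (e i x) = x)"
    by metis
  \<comment> \<open>A section applied to the base point supplies a point of the covering.\<close>
  obtain i where i: "i \<le> k" "x\<^sub>0 \<in> U i"
    using U(2) assms(3) by blast
  have p0: "e i x\<^sub>0 \<in> topspace ?P"
    using continuous_map_funspace[OF conjunct1[OF e[OF i(1)]]] i(2) assms(3) by (auto simp: Pi_iff)
  have fst: "continuous_map ?P ?X fst" and sc: "simply_connected_topology ?P"
    using assms(5) by (simp_all add: classifying_map_def universal_covering_def covering_map_def)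
  obtain L f g where model: "small_model K (U ` {..k}) (Suc n) L f g"
  proof -
    have "\<exists>L f g. small_model K (U ` {..k}) (Suc n) L f g"
      by (rule ex_small_model[OF assms(1)]) (use U in auto)
    then show thesis
      using that by blast
  qed
  have "LS_cat ?X \<le> enat ((n + k) div 2)"
  proof (rule LS_cat_realization_le[OF assms(1) dim _ _ _ fst sc p0 model])
    show "openin ?X (U i)" "continuous_map (subtopology ?X (U i)) ?P (e i)" if "i \<le> k" for i
      using U(1) e that by simp_all
    show "fst (e i x) = x" if "i \<le> k" "x \<in> U i" for i x
      using e that by simp
  qed
  then have "ereal_of_enat (LS_cat ?X) \<le> ereal_of_enat (enat ((n + k) div 2))"
    by (simp only: ereal_of_enat_le_iff)
  also have "\<dots> \<le> (ereal_of_enat (enat k) + ereal_of_enat (enat n)) / 2"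
  proof -
    \<comment> \<open>Rounding down only strengthens the bound.\<close>
    have "real ((n + k) div 2) \<le> (real k + real n) / 2"
      by (simp add: real_of_nat_div)
    then show ?thesis
      by simp
  qed
  finally show ?thesis
    using k n by simp
qed

end
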